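(* Let $m\in\mathbb N$. For every $\varepsilon>0$ there is a constant $C_\varepsilon$ such that for every $f\in C^\infty(\mathbb S^3)$ with $\int_{\mathbb S^3}p\,e^{3f}d\mu_{\mathbb S^3}=0$ for all $p\in\mathring{\mathcal P}_m$, and every smooth $u$ on $\overline{\mathbb B^4}$ with $u=f$ and $\frac{\partial u}{\partial r}=0$ on $\mathbb S^3$, $$\log\Big(\frac{1}{2\pi^2}\int_{\mathbb S^3}e^{3(f-\bar f)}d\mu_{\mathbb S^3}\Big)\le\Big(\frac{3}{16\pi^2N_m(\mathbb S^3)}+\varepsilon\Big)\Big[\int_{\mathbb B^4}(\Delta u)^2dx+2\int_{\mathbb S^3}|\nabla f|^2_{\mathbb S^3}d\mu_{\mathbb S^3}\Big]+C_\varepsilon,$$ where $\bar f=\frac{1}{2\pi^2}\int_{\mathbb S^3}f\,d\mu_{\mathbb S^3}$.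
   Context: $\mathbb B^4$ is the open unit ball in $\mathbb R^4$, $\mathbb S^3=\partial\mathbb B^4$ with standard measure $\mu_{\mathbb S^3}$ (total volume $2\pi^2$); $\partial_r$ is the radial derivative. $\mathcal P_m$ denotes the polynomials on $\mathbb R^n$ of degree at most $m$, and $\mathring{\mathcal P}_m=\{p\in\mathcal P_m:\int_{\mathbb S^{n-1}}p\,d\mu_{\mathbb S^{n-1}}=0\}$. $N_m(\mathbb S^{n-1})$ is the smallest $N\in\mathbb N$ for which there exist $x_1,\dots,x_N\in\mathbb S^{n-1}$ and $\nu_1,\dots,\nu_N\ge0$ with $\sum_i\nu_i=1$ and $\sum_i\nu_ip(x_i)=0$ for all $p\in\mathring{\mathcal P}_m$. *)

theory Defs
  imports "HOL-Analysis.Analysis"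
begin

type_synonym R4 = "real ^ 4"

definition pd :: "4 \<Rightarrow> (R4 \<Rightarrow> real) \<Rightarrow> R4 \<Rightarrow> real" where
  "pd i g x = deriv (\<lambda>t. g (x + t *\<^sub>R axis i 1)) 0"

fun pds :: "4 list \<Rightarrow> (R4 \<Rightarrow> real) \<Rightarrow> R4 \<Rightarrow> real" where
  "pds [] g = g"
| "pds (i # is) g = pd i (pds is g)"

definition smooth_on :: "R4 set \<Rightarrow> (R4 \<Rightarrow> real) \<Rightarrow> bool" where
  "smooth_on U g \<longleftrightarrow> open U \<and>
     (\<forall>is. continuous_on U (pds is g)) \<and>
     (\<forall>is i. \<forall>x\<in>U. ((\<lambda>t. pds is g (x + t *\<^sub>R axis i 1)) has_real_derivative pds (i # is) g x) (at 0))"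

definition smooth_closed_ball :: "(R4 \<Rightarrow> real) \<Rightarrow> bool" where
  "smooth_closed_ball u \<longleftrightarrow> (\<exists>U. cball 0 1 \<subseteq> U \<and> smooth_on U u)"

text \<open>f is C-infinity on S^3 iff its 0-homogeneous extension is C-infinity on R^4 - {0}.\<close>
definition smooth_sphere :: "(R4 \<Rightarrow> real) \<Rightarrow> bool" where
  "smooth_sphere f \<longleftrightarrow> smooth_on (- {0}) (\<lambda>x. f (x /\<^sub>R norm x))"

definition grad :: "(R4 \<Rightarrow> real) \<Rightarrow> R4 \<Rightarrow> R4" where
  "grad g x = (\<chi> i. pd i g x)"

definition laplacian :: "(R4 \<Rightarrow> real) \<Rightarrow> R4 \<Rightarrow> real" where
  "laplacian g x = (\<Sum>i\<in>UNIV. pds [i, i] g x)"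

definition radial_deriv :: "(R4 \<Rightarrow> real) \<Rightarrow> R4 \<Rightarrow> real" where
  "radial_deriv g x = grad g x \<bullet> (x /\<^sub>R norm x)"

text \<open>Squared length of the tangential (spherical) gradient of f at a point of S^3: the
  Euclidean gradient of the 0-homogeneous extension of f.\<close>
definition sph_grad_sq :: "(R4 \<Rightarrow> real) \<Rightarrow> R4 \<Rightarrow> real" where
  "sph_grad_sq f x = (norm (grad (\<lambda>y. f (y /\<^sub>R norm y)) x))\<^sup>2"

text \<open>Integral over S^3 w.r.t. the standard surface measure (total mass 2\<pi>^2), via the
  cone-measure formula  \<integral>_{S^3} g d\<mu> = 4 \<integral>_{B^4} g(x/|x|) dx.\<close>
definition sphere_integral :: "(R4 \<Rightarrow> real) \<Rightarrow> real" where
  "sphere_integral g = 4 * integral (ball 0 1) (\<lambda>x. g (x /\<^sub>R norm x))"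

definition polys :: "nat \<Rightarrow> (R4 \<Rightarrow> real) set" where
  "polys m = {p. \<exists>c :: (4 \<Rightarrow> nat) \<Rightarrow> real.
      p = (\<lambda>x. \<Sum>\<alpha>\<in>{\<alpha>. (\<Sum>i\<in>UNIV. \<alpha> i) \<le> m}. c \<alpha> * (\<Prod>i\<in>UNIV. (x $ i) ^ \<alpha> i))}"

definition polys0 :: "nat \<Rightarrow> (R4 \<Rightarrow> real) set" where
  "polys0 m = {p \<in> polys m. sphere_integral p = 0}"

definition N_m :: "nat \<Rightarrow> nat" where
  "N_m m = (LEAST N. \<exists>(x :: nat \<Rightarrow> R4) (\<nu> :: nat \<Rightarrow> real).
      (\<forall>i<N. x i \<in> sphere 0 1 \<and> \<nu> i \<ge> 0) \<and> (\<Sum>i<N. \<nu> i) = 1 \<and>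
      (\<forall>p\<in>polys0 m. (\<Sum>i<N. \<nu> i * p (x i)) = 0))"

end

theory Submission
  imports Defs "HOL-Real_Asymp.Real_Asymp"
begin

text \<open>
  Only \<open>A\<^sup>2 = \<integral> (\<Delta>u)\<^sup>2\<close> is needed on the right-hand side. Because of the Neumann condition, the kernels
  \<open>|x - \<tau> y|\<^sup>-\<^sup>2\<close>, harmonic in \<open>y\<close>, and their \<open>\<tau>\<close>-derivatives give for \<open>|x| = 1\<close>
  \<open>2 \<pi>\<^sup>2 (f x - mean f) \<le> \<integral>\<^sub>B |x - y|\<^sup>-\<^sup>2 |\<Delta>u y| dy + O(A)\<close>. The kernel is local up to bounded terms, so on a set
  \<open>\<Omega>\<close> only the part \<open>a\<^sup>2\<close> of \<open>A\<^sup>2\<close> near \<open>\<Omega>\<close> matters to leading order. Averaging the potential over a level set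
  and using \<open>\<integral>\<^sub>B |x - y|\<^sup>-\<^sup>4 dy = \<pi>\<^sup>2 ln (1 / \<rho>) + O(1)\<close> outside the \<open>\<rho>\<close>-ball bounds the level set at height \<open>t\<close>
  by \<open>exp (- 12 \<pi>\<^sup>2 t\<^sup>2 / a\<^sup>2)\<close>, hence \<open>\<integral>\<^sub>\<Omega> exp (3 (f - mean f))\<close> by \<open>exp ((3 / (16 \<pi>\<^sup>2) + \<epsilon>) a\<^sup>2 + O(A))\<close>.
  By compactness, the moment condition forces \<open>exp (3 f)\<close> to charge \<open>N = N_m\<close> uniformly separated balls with
  a fixed fraction of its mass; near one of them the local energy is at most \<open>A\<^sup>2 / N\<close>.
\<close>

text \<open>The constant: half the annulus mass of \<open>|z|^(-4)\<close> and Cauchy-Schwarz give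
  \<open>2 * pi^2 * t \<le> a * sqrt (pi^2 * ln (1 / \<rho>))\<close> to leading order, so
  \<open>ln (1 / \<rho>) \<ge> 4 * pi^2 * t^2 / a^2\<close>. A level set of measure
  \<open>\<rho>^3\<close> brings in the factor 3, and \<open>3 * t - 12 * pi^2 * t^2 / a^2\<close>
  has maximum \<open>3 * a^2 / (16 * pi^2)\<close>, at \<open>t = a^2 / (8 * pi^2)\<close>. The
  Neumann function of the ball is not computed. With \<open>M \<tau>\<close> the integral of
  \<open>u y / |x - \<tau> y|^2\<close> over the sphere, \<open>M + \<tau> * M'\<close> is the
  Poisson integral and tends to \<open>2 * pi^2 * u x\<close>, Green's formula turns
  \<open>- \<tau> * M'\<close> into the integral of \<open>\<Delta>u y / |x - \<tau> y|^2\<close>,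
  and \<open>M\<close> itself grows by \<open>O(A)\<close> because \<open>M'\<close> is
  \<open>O(A * (1 - \<tau>)^(-1/2))\<close>. The obstacle is that \<open>|x - y|^(-2)\<close> just
  fails to be square integrable on the ball, so Cauchy-Schwarz gives no pointwise bound; hence the
  cutoff radius tied to the measure of the level set. Errors linear in \<open>A\<close> are harmless
  because \<open>A \<le> \<epsilon> * A^2 + 1 / \<epsilon>\<close>.\<close>

section \<open>The surface measure of the sphere and polar coordinates\<close>

text \<open>The cone measure behind \<open>sphere_integral\<close>, as a Borel measure on all of
  \<open>R4\<close>, so that Fubini, densities and dominated convergence apply. It is carried by the
  unit sphere almost everywhere; the factor 4 is the dimension.\<close>

definition S3 :: "R4 measure" where
  "S3 = distr (density lborel (\<lambda>x. 4 * indicator (ball 0 1) x)) borel sgn"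

lemma borel_measurable_sgn_R4 [measurable (raw)]:
  "f \<in> borel_measurable M \<Longrightarrow> (\<lambda>x. sgn (f x :: R4)) \<in> borel_measurable M"
  unfolding sgn_div_norm by measurable

lemma ball_sets_borel [measurable]: "ball c r \<in> sets (borel :: R4 measure)"
  and sphere_sets_borel [measurable]: "sphere c r \<in> sets (borel :: R4 measure)"
  and cball_sets_borel [measurable]: "cball c r \<in> sets (borel :: R4 measure)"
  by (auto intro: borel_closed)

lemma sets_S3 [simp, measurable_cong]: "sets S3 = sets borel"
  and space_S3 [simp]: "space S3 = UNIV"
  by (simp_all add: S3_def)

lemma nn_integral_S3:
  assumes [measurable]: "h \<in> borel_measurable borel"
  shows "(\<integral>\<^sup>+x. h x \<partial>S3) = (\<integral>\<^sup>+y. 4 * indicator (ball 0 1) y * h (sgn y) \<partial>lborel)"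
proof -
  have "(\<integral>\<^sup>+x. h x \<partial>S3) = (\<integral>\<^sup>+y. h (sgn y) \<partial>density lborel (\<lambda>x. 4 * indicator (ball 0 1) x))"
    unfolding S3_def by (rule nn_integral_distr) measurable
  also have "\<dots> = (\<integral>\<^sup>+y. 4 * indicator (ball 0 1) y * h (sgn y) \<partial>lborel)"
    by (rule nn_integral_density) measurable
  finally show ?thesis .
qed

lemma emeasure_ball_R4: "r \<ge> 0 \<Longrightarrow> emeasure lborel (ball (c::R4) r) = ennreal (pi\<^sup>2 / 2 * r ^ 4)"
  by (simp add: emeasure_ball unit_ball_vol_numeral fact_numeral)

lemma emeasure_S3_UNIV: "emeasure S3 UNIV = ennreal (2 * pi\<^sup>2)"
proof -
  have "emeasure S3 UNIV = (\<integral>\<^sup>+x. 1 \<partial>S3)" by simp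
  also have "\<dots> = (\<integral>\<^sup>+y. 4 * indicator (ball 0 1) (y::R4) \<partial>lborel)"
    by (subst nn_integral_S3) auto
  also have "\<dots> = 4 * emeasure lborel (ball (0::R4) 1)"
    by (subst nn_integral_cmult_indicator) auto
  also have "\<dots> = ennreal (2 * pi\<^sup>2)"
    by (simp add: emeasure_ball_R4 ennreal_mult'[symmetric] flip: ennreal_numeral)
  finally show ?thesis .
qed

interpretation S3: finite_measure S3
  by standard (simp add: emeasure_S3_UNIV)

lemma measure_S3_UNIV: "measure S3 UNIV = 2 * pi\<^sup>2"
  by (simp add: measure_def emeasure_S3_UNIV)

lemma AE_lborel_nonzero: "AE y in (lborel :: R4 measure). y \<noteq> 0"
proof -
  have "{0::R4} \<in> null_sets lborel" by auto
  then show ?thesis using AE_not_in by fastforce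
qed

lemma AE_S3: "AE x in S3. norm x = 1"
proof -
  have "AE x in lborel. x \<noteq> (0::R4)" by (rule AE_lborel_nonzero)
  then have "AE x in lborel. norm (sgn (x::R4)) = 1"
    by eventually_elim (simp add: norm_sgn)
  then show ?thesis
    unfolding S3_def
    by (simp add: AE_distr_iff AE_density) (auto elim: eventually_mono)
qed

text \<open>Bridge between the gauge integral \<open>sphere_integral\<close> and the Lebesgue
  integral over \<open>S3\<close>. The functions at hand are controlled on the sphere only, and the
  indicator turns continuity there into Borel measurability everywhere.\<close>

lemma integral_S3_indicator:
  assumes "continuous_on (sphere 0 1) (h :: R4 \<Rightarrow> real)"
  shows "integrable S3 (\<lambda>x. indicator (sphere 0 1) x * h x)"
    and "sphere_integral h = (LINT x|S3. indicator (sphere 0 1) x * h x)"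
    and "(\<lambda>x. indicator (sphere 0 1) x * h x) \<in> borel_measurable borel"
proof -
  let ?h = "\<lambda>x. indicator (sphere 0 1) x * h x"
  show m [measurable]: "?h \<in> borel_measurable borel"
    using borel_measurable_continuous_on_indicator[OF _ assms] by simp
  have "compact (h ` sphere 0 1)" by (intro compact_continuous_image assms) auto
  then obtain B where B: "\<And>x. x \<in> sphere 0 1 \<Longrightarrow> \<bar>h x\<bar> \<le> B"
    using compact_imp_bounded bounded_iff by (metis imageI real_norm_def)
  have Bd: "\<bar>?h x\<bar> \<le> \<bar>B\<bar>" for x using B[of x] by (auto simp: indicator_def split: if_splits)
  show i: "integrable S3 ?h"
    by (rule S3.integrable_const_bound[where B="\<bar>B\<bar>"]) (use Bd in auto)
  have i2: "set_integrable lborel (ball 0 1) (\<lambda>x. ?h (sgn x))"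
    unfolding set_integrable_def
  proof (rule Bochner_Integration.integrable_bound)
    show "integrable lborel (\<lambda>x::R4. \<bar>B\<bar> * indicator (ball 0 1) x)"
      by (intro integrable_mult_right integrable_real_indicator) (auto simp: emeasure_ball_R4)
    show "(\<lambda>x. indicator (ball 0 1) x *\<^sub>R ?h (sgn x)) \<in> borel_measurable lborel" by measurable
    show "AE x in lborel. norm (indicator (ball 0 1) x *\<^sub>R ?h (sgn x)) \<le> norm (\<bar>B\<bar> * indicator (ball 0 1) x)"
      using Bd by (intro AE_I2) (auto simp: indicator_def split: if_splits)
  qed
  have "(LINT x|S3. ?h x) = (LINT y|lborel. (4 * indicator (ball 0 1) y) *\<^sub>R ?h (sgn y))"
  proof -
    have "(LINT x|S3. ?h x) = (LINT y|density lborel (\<lambda>x. ennreal (4 * indicator (ball 0 1) x)). ?h (sgn y))"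
      unfolding S3_def by (subst integral_distr) (auto simp: ennreal_mult ennreal_indicator)
    also have "\<dots> = (LINT y|lborel. (4 * indicator (ball 0 1) y) *\<^sub>R ?h (sgn y))"
      by (rule integral_density) auto
    finally show ?thesis .
  qed
  also have "\<dots> = 4 * (LINT y:ball 0 1|lborel. ?h (sgn y))"
    unfolding set_lebesgue_integral_def
    by (subst integral_mult_right_zero[symmetric]) (simp add: mult_ac)
  also have "(LINT y:ball 0 1|lborel. ?h (sgn y)) = integral (ball 0 1) (\<lambda>y. ?h (sgn y))"
    by (rule set_borel_integral_eq_integral[OF i2])
  \<comment> \<open>The origin is sent to 0, where \<open>h\<close> is arbitrary but the indicator
    vanishes.\<close>
  also have "\<dots> = integral (ball 0 1) (\<lambda>x. h (x /\<^sub>R norm x))"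
    by (rule integral_spike[where S="{0}"]) (auto simp: sgn_div_norm)
  finally show "sphere_integral h = (LINT x|S3. ?h x)"
    by (simp add: sphere_integral_def)
qed

lemma nn_integral_scale_R4:
  assumes [measurable]: "h \<in> borel_measurable (borel :: R4 measure)" and s: "s > 0"
  shows "(\<integral>\<^sup>+y. h (s *\<^sub>R y) \<partial>lborel) = (\<integral>\<^sup>+z. ennreal (1 / s ^ 4) * h z \<partial>lborel)"
proof -
  have "(\<integral>\<^sup>+z. ennreal (1 / s ^ 4) * h z \<partial>lborel)
      = (\<integral>\<^sup>+y. ennreal (s ^ 4) * (ennreal (1 / s ^ 4) * h (s *\<^sub>R y)) \<partial>lborel)"
    using s
    by (subst lborel_affine[of s "0::R4"])
       (simp_all add: nn_integral_density nn_integral_distr ennreal_power)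
  also have "\<dots> = (\<integral>\<^sup>+y. h (s *\<^sub>R y) \<partial>lborel)"
    using s by (simp flip: mult.assoc ennreal_mult)
  finally show ?thesis ..
qed

lemma nn_integral_inverse_power5:
  assumes "a > 0"
  shows "(\<integral>\<^sup>+s. ennreal (4 / s ^ 5) * indicator {a..} s \<partial>lborel) = ennreal (1 / a ^ 4)"
proof -
  have "(\<integral>\<^sup>+s. ennreal (4 / \<bar>s\<bar> ^ 5) * indicator {a..} s \<partial>lborel) = ennreal (0 - (- 1 / a ^ 4))"
  proof (rule nn_integral_FTC_atLeast)
    show "((\<lambda>s::real. - 1 / s ^ 4) \<longlongrightarrow> 0) at_top" by real_asymp
    show "DERIV (\<lambda>s. - 1 / s ^ 4) x :> 4 / \<bar>x\<bar> ^ 5" if "a \<le> x" for x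
      using that assms by (auto intro!: derivative_eq_intros simp: field_simps eval_nat_numeral)
  qed auto
  moreover have "(\<integral>\<^sup>+s. ennreal (4 / s ^ 5) * indicator {a..} s \<partial>lborel)
     = (\<integral>\<^sup>+s. ennreal (4 / \<bar>s\<bar> ^ 5) * indicator {a..} s \<partial>lborel)"
    using assms by (intro nn_integral_cong) (auto simp: indicator_def)
  ultimately show ?thesis by simp
qed

text \<open>Unfolding \<open>S3\<close> on the right gives an integral over \<open>r\<close> and
  \<open>y\<close>. The substitution \<open>r = s * norm y\<close> makes the argument of
  \<open>h\<close> equal to \<open>s y\<close>; after a swap, \<open>z = s y\<close> makes it
  \<open>z\<close>; after another swap, the integral of \<open>4 * norm z ^ 4 / s ^ 5\<close> over
  \<open>s > norm z\<close> is 1.\<close>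

lemma nn_integral_polar:
  assumes [measurable]: "h \<in> borel_measurable (borel :: R4 measure)"
  shows "(\<integral>\<^sup>+x. h x \<partial>lborel) =
    (\<integral>\<^sup>+r. ennreal (r ^ 3) * indicator {0<..} r * (\<integral>\<^sup>+\<omega>. h (r *\<^sub>R \<omega>) \<partial>S3) \<partial>lborel)"
proof -
  have "(\<integral>\<^sup>+r. ennreal (r ^ 3) * indicator {0<..} r * (\<integral>\<^sup>+\<omega>. h (r *\<^sub>R \<omega>) \<partial>S3) \<partial>lborel)
    = (\<integral>\<^sup>+r. \<integral>\<^sup>+y. ennreal (r ^ 3) * indicator {0<..} r * (4 * indicator (ball 0 1) y * h (r *\<^sub>R sgn y)) \<partial>lborel \<partial>lborel)"
  proof (rule nn_integral_cong)
    fix r :: real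
    have "(\<integral>\<^sup>+\<omega>. h (r *\<^sub>R \<omega>) \<partial>S3) = (\<integral>\<^sup>+y. 4 * indicator (ball 0 1) y * h (r *\<^sub>R sgn y) \<partial>lborel)"
      by (rule nn_integral_S3) measurable
    then show "ennreal (r ^ 3) * indicator {0<..} r * (\<integral>\<^sup>+\<omega>. h (r *\<^sub>R \<omega>) \<partial>S3)
      = (\<integral>\<^sup>+y. ennreal (r ^ 3) * indicator {0<..} r * (4 * indicator (ball 0 1) y * h (r *\<^sub>R sgn y)) \<partial>lborel)"
      by (simp only:) (subst nn_integral_cmult; measurable)
  qed
  also have "\<dots> = (\<integral>\<^sup>+y. \<integral>\<^sup>+r. ennreal (r ^ 3) * indicator {0<..} r * (4 * indicator (ball 0 1) y * h (r *\<^sub>R sgn y)) \<partial>lborel \<partial>lborel)"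
    by (rule lborel_pair.Fubini') measurable
  also have "\<dots> = (\<integral>\<^sup>+y. \<integral>\<^sup>+s. ennreal (4 * s ^ 3 * norm y ^ 4) * indicator {0<..} s * (indicator (ball 0 1) y * h (s *\<^sub>R y)) \<partial>lborel \<partial>lborel)"
  proof (rule nn_integral_cong_AE)
    show "AE y in lborel. (\<integral>\<^sup>+r. ennreal (r ^ 3) * indicator {0<..} r * (4 * indicator (ball 0 1) y * h (r *\<^sub>R sgn y)) \<partial>lborel)
       = (\<integral>\<^sup>+s. ennreal (4 * s ^ 3 * norm y ^ 4) * indicator {0<..} s * (indicator (ball 0 1) y * h (s *\<^sub>R y)) \<partial>lborel)"
      using AE_lborel_nonzero
    proof eventually_elim
      case (elim y)
      then have n: "norm y > 0" by simp
      have "(\<integral>\<^sup>+r. ennreal (r ^ 3) * indicator {0<..} r * (4 * indicator (ball 0 1) y * h (r *\<^sub>R sgn y)) \<partial>lborel)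
        = ennreal \<bar>norm y\<bar> * (\<integral>\<^sup>+s. ennreal ((0 + norm y * s) ^ 3) * indicator {0<..} (0 + norm y * s)
             * (4 * indicator (ball 0 1) y * h ((0 + norm y * s) *\<^sub>R sgn y)) \<partial>lborel)"
        using n by (intro nn_integral_real_affine) auto
      also have "\<dots> = (\<integral>\<^sup>+s. ennreal (norm y) * (ennreal ((norm y * s) ^ 3) * indicator {0<..} s
             * (4 * indicator (ball 0 1) y * h (s *\<^sub>R y))) \<partial>lborel)"
        using n by (subst nn_integral_cmult[symmetric])
           (auto intro!: nn_integral_cong simp: sgn_div_norm indicator_def zero_less_mult_iff mult_ac)
      also have "\<dots> = (\<integral>\<^sup>+s. ennreal (4 * s ^ 3 * norm y ^ 4) * indicator {0<..} s * (indicator (ball 0 1) y * h (s *\<^sub>R y)) \<partial>lborel)"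
      proof (rule nn_integral_cong)
        fix s :: real
        show "ennreal (norm y) * (ennreal ((norm y * s) ^ 3) * indicator {0<..} s
             * (4 * indicator (ball 0 1) y * h (s *\<^sub>R y)))
           = ennreal (4 * s ^ 3 * norm y ^ 4) * indicator {0<..} s * (indicator (ball 0 1) y * h (s *\<^sub>R y))"
        proof (cases "s > 0")
          case True
          have "ennreal (4 * s ^ 3 * norm y ^ 4) = ennreal (norm y) * ennreal ((norm y * s) ^ 3) * 4"
            using True by (simp add: ennreal_mult'[symmetric] power_mult_distrib mult_ac eval_nat_numeral flip: ennreal_numeral)
          then show ?thesis by (simp add: mult_ac)
        qed simp
      qed
      finally show ?case .
    qed
  qed
  also have "\<dots> = (\<integral>\<^sup>+s. \<integral>\<^sup>+y. ennreal (4 * s ^ 3 * norm y ^ 4) * indicator {0<..} s * (indicator (ball 0 1) y * h (s *\<^sub>R y)) \<partial>lborel \<partial>lborel)"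
    by (rule lborel_pair.Fubini') measurable
  also have "\<dots> = (\<integral>\<^sup>+s. \<integral>\<^sup>+z. ennreal (4 / s ^ 5 * norm z ^ 4) * (if norm z < s then 1 else 0) * h z \<partial>lborel \<partial>lborel)"
  proof (rule nn_integral_cong)
    fix s :: real
    show "(\<integral>\<^sup>+y. ennreal (4 * s ^ 3 * norm y ^ 4) * indicator {0<..} s * (indicator (ball 0 1) y * h (s *\<^sub>R y)) \<partial>lborel)
      = (\<integral>\<^sup>+z. ennreal (4 / s ^ 5 * norm z ^ 4) * (if norm z < s then 1 else 0) * h z \<partial>lborel)"
    proof (cases "s > 0")
      case True
      let ?k = "\<lambda>z. ennreal (4 / s * norm z ^ 4) * (if norm z < s then 1 else 0) * h z"
      have "(\<integral>\<^sup>+y. ennreal (4 * s ^ 3 * norm y ^ 4) * indicator {0<..} s * (indicator (ball 0 1) y * h (s *\<^sub>R y)) \<partial>lborel)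
        = (\<integral>\<^sup>+y. ?k (s *\<^sub>R y) \<partial>lborel)"
        using True by (intro nn_integral_cong)
          (auto simp: indicator_def field_simps eval_nat_numeral)
      also have "\<dots> = (\<integral>\<^sup>+z. ennreal (1 / s ^ 4) * ?k z \<partial>lborel)"
        using True by (intro nn_integral_scale_R4) auto
      also have "\<dots> = (\<integral>\<^sup>+z. ennreal (4 / s ^ 5 * norm z ^ 4) * (if norm z < s then 1 else 0) * h z \<partial>lborel)"
      proof (rule nn_integral_cong)
        fix z :: R4
        have "ennreal (4 / s ^ 5 * norm z ^ 4) = ennreal (1 / s ^ 4) * ennreal (4 / s * norm z ^ 4)"
          using True by (subst ennreal_mult[symmetric]) (auto simp: eval_nat_numeral)
        then show "ennreal (1 / s ^ 4) * ?k z
          = ennreal (4 / s ^ 5 * norm z ^ 4) * (if norm z < s then 1 else 0) * h z"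
          by (simp only: mult.assoc)
      qed
      finally show ?thesis .
    next
      case False
      then have "\<not> norm z < s" for z :: R4
        using norm_ge_zero[of z] by linarith
      with False show ?thesis by simp
    qed
  qed
  also have "\<dots> = (\<integral>\<^sup>+z. \<integral>\<^sup>+s. ennreal (4 / s ^ 5 * norm z ^ 4) * (if norm z < s then 1 else 0) * h z \<partial>lborel \<partial>lborel)"
    by (rule lborel_pair.Fubini') measurable
  also have "\<dots> = (\<integral>\<^sup>+z. h z \<partial>lborel)"
  proof (rule nn_integral_cong_AE)
    show "AE z in lborel. (\<integral>\<^sup>+s. ennreal (4 / s ^ 5 * norm z ^ 4) * (if norm z < s then 1 else 0) * h z \<partial>lborel) = h z"
      using AE_lborel_nonzero
    proof eventually_elim
      case (elim z)
      then have n: "norm z > 0" by simp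
      have "AE s in lborel. s \<noteq> norm z"
        by (rule AE_lborel_singleton)
      then have "(\<integral>\<^sup>+s. ennreal (4 / s ^ 5 * norm z ^ 4) * (if norm z < s then 1 else 0) * h z \<partial>lborel)
        = (\<integral>\<^sup>+s. (ennreal (norm z ^ 4) * h z) * (ennreal (4 / s ^ 5) * indicator {norm z..} s) \<partial>lborel)"
      proof (intro nn_integral_cong_AE, eventually_elim)
        fix s :: real assume "s \<noteq> norm z"
        then consider "s < norm z" | "s > norm z" by linarith
        then show "ennreal (4 / s ^ 5 * norm z ^ 4) * (if norm z < s then 1 else 0) * h z
          = (ennreal (norm z ^ 4) * h z) * (ennreal (4 / s ^ 5) * indicator {norm z..} s)"
        proof cases
          case 2
          have "ennreal (4 / s ^ 5 * norm z ^ 4) = ennreal (4 / s ^ 5) * ennreal (norm z ^ 4)"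
            using less_trans[OF n 2] by (intro ennreal_mult) auto
          with 2 show ?thesis by (simp add: mult_ac)
        qed simp
      qed
      also have "\<dots> = (ennreal (norm z ^ 4) * h z) * ennreal (1 / norm z ^ 4)"
        using n by (subst nn_integral_cmult) (auto simp: nn_integral_inverse_power5)
      also have "\<dots> = h z * (ennreal (norm z ^ 4) * ennreal (1 / norm z ^ 4))" by (simp add: mult_ac)
      also have "ennreal (norm z ^ 4) * ennreal (1 / norm z ^ 4) = 1"
        using n by (simp flip: ennreal_mult)
      finally show ?case by simp
    qed
  qed
  finally show ?thesis ..
qed

lemma nn_integral_radial:
  assumes [measurable]: "\<phi> \<in> borel_measurable borel"
  shows "(\<integral>\<^sup>+x. \<phi> (norm (x::R4)) \<partial>lborel) =
    ennreal (2 * pi\<^sup>2) * (\<integral>\<^sup>+r. ennreal (r ^ 3) * indicator {0<..} r * \<phi> r \<partial>lborel)"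
proof -
  have *: "indicator {0<..} r * (\<integral>\<^sup>+\<omega>. \<phi> (norm (r *\<^sub>R \<omega>)) \<partial>S3)
      = indicator {0<..} r * (\<phi> r * ennreal (2 * pi\<^sup>2))" for r :: real
  proof (cases "r > 0")
    case True
    have "(\<integral>\<^sup>+\<omega>. \<phi> (norm (r *\<^sub>R \<omega>)) \<partial>S3) = (\<integral>\<^sup>+\<omega>. \<phi> r \<partial>S3)"
      using AE_S3 True by (intro nn_integral_cong_AE) (auto elim!: eventually_mono)
    then show ?thesis by (simp add: emeasure_S3_UNIV)
  qed simp
  have "(\<integral>\<^sup>+x. \<phi> (norm (x::R4)) \<partial>lborel)
     = (\<integral>\<^sup>+r. ennreal (r ^ 3) * (indicator {0<..} r * (\<phi> r * ennreal (2 * pi\<^sup>2))) \<partial>lborel)"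
    by (subst nn_integral_polar) (auto simp: mult.assoc * simp del: norm_scaleR)
  also have "\<dots> = (\<integral>\<^sup>+r. ennreal (2 * pi\<^sup>2) * (ennreal (r ^ 3) * indicator {0<..} r * \<phi> r) \<partial>lborel)"
    by (simp add: mult_ac)
  also have "\<dots> = ennreal (2 * pi\<^sup>2) * (\<integral>\<^sup>+r. ennreal (r ^ 3) * indicator {0<..} r * \<phi> r \<partial>lborel)"
    by (rule nn_integral_cmult) measurable
  finally show ?thesis .
qed

section \<open>Volume estimates\<close>

lemma nn_integral_translate_R4:
  assumes [measurable]: "h \<in> borel_measurable (borel :: R4 measure)"
  shows "(\<integral>\<^sup>+y. h (y - x) \<partial>lborel) = (\<integral>\<^sup>+z. h z \<partial>lborel)"
proof -
  have "(\<integral>\<^sup>+z. h z \<partial>lborel) = (\<integral>\<^sup>+z. h z \<partial>distr lborel borel ((+) (- x)))"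
    by (simp add: lborel_distr_plus)
  also have "\<dots> = (\<integral>\<^sup>+y. h (- x + y) \<partial>lborel)"
    by (rule nn_integral_distr) measurable
  finally show ?thesis by simp
qed

lemma nn_integral_reflect_R4:
  assumes [measurable]: "h \<in> borel_measurable (borel :: R4 measure)"
  shows "(\<integral>\<^sup>+z. h (- z) \<partial>lborel) = (\<integral>\<^sup>+z. h z \<partial>lborel)"
proof -
  have "(\<integral>\<^sup>+z. h z \<partial>lborel) = (\<integral>\<^sup>+z. h z \<partial>density (distr lborel borel (\<lambda>x. 0 + (-1) *\<^sub>R x)) (\<lambda>_. ennreal (\<bar>- 1\<bar> ^ DIM(R4))))"
    by (subst lborel_affine[of "-1" "0::R4"]) auto
  also have "\<dots> = (\<integral>\<^sup>+z. h (- z) \<partial>lborel)"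
    by (simp add: nn_integral_density nn_integral_distr)
  finally show ?thesis ..
qed

text \<open>Serves near the pole, where the fourth power of \<open>1 / norm (y - x)\<close> is no
  longer integrable.\<close>

lemma nn_integral_norm_cube_ball:
  fixes x :: R4
  assumes "\<rho> > 0"
  shows "(\<integral>\<^sup>+y. ennreal (1 / norm (y - x) ^ 3) * indicator (ball x \<rho>) y \<partial>lborel) = ennreal (2 * pi\<^sup>2 * \<rho>)"
proof -
  have "(\<integral>\<^sup>+y. ennreal (1 / norm (y - x) ^ 3) * indicator (ball x \<rho>) y \<partial>lborel)
      = (\<integral>\<^sup>+y. ennreal (1 / norm (y - x) ^ 3) * indicator {..<\<rho>} (norm (y - x)) \<partial>lborel)"
    by (intro nn_integral_cong) (auto simp: indicator_def dist_norm norm_minus_commute)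
  also have "\<dots> = (\<integral>\<^sup>+z. ennreal (1 / norm (z::R4) ^ 3) * indicator {..<\<rho>} (norm z) \<partial>lborel)"
    by (rule nn_integral_translate_R4[where h="\<lambda>z. ennreal (1 / norm z ^ 3) * indicator {..<\<rho>} (norm z)"]) measurable
  also have "\<dots> = ennreal (2 * pi\<^sup>2) * (\<integral>\<^sup>+r. ennreal (r ^ 3) * indicator {0<..} r * (ennreal (1 / r ^ 3) * indicator {..<\<rho>} r) \<partial>lborel)"
    by (rule nn_integral_radial) measurable
  also have "(\<integral>\<^sup>+r. ennreal (r ^ 3) * indicator {0<..} r * (ennreal (1 / r ^ 3) * indicator {..<\<rho>} r) \<partial>lborel)
      = (\<integral>\<^sup>+r. indicator {0<..<\<rho>} r \<partial>lborel)"
    by (intro nn_integral_cong) (auto simp: indicator_def simp flip: ennreal_mult)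
  also have "\<dots> = ennreal \<rho>" using assms by simp
  finally show ?thesis by (simp add: ennreal_mult' assms less_imp_le)
qed

lemma nn_integral_norm_four_annulus:
  assumes "0 < \<rho>" "\<rho> \<le> R"
  shows "(\<integral>\<^sup>+z. ennreal (1 / norm (z::R4) ^ 4) * indicator {\<rho>..R} (norm z) \<partial>lborel) = ennreal (2 * pi\<^sup>2 * ln (R / \<rho>))"
proof -
  have "(\<integral>\<^sup>+z. ennreal (1 / norm (z::R4) ^ 4) * indicator {\<rho>..R} (norm z) \<partial>lborel)
     = ennreal (2 * pi\<^sup>2) * (\<integral>\<^sup>+r. ennreal (r ^ 3) * indicator {0<..} r * (ennreal (1 / r ^ 4) * indicator {\<rho>..R} r) \<partial>lborel)"
    by (rule nn_integral_radial) measurable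
  also have "(\<integral>\<^sup>+r. ennreal (r ^ 3) * indicator {0<..} r * (ennreal (1 / r ^ 4) * indicator {\<rho>..R} r) \<partial>lborel)
      = (\<integral>\<^sup>+r. ennreal (1 / r) * indicator {\<rho>..R} r \<partial>lborel)"
    using assms by (intro nn_integral_cong) (auto simp: indicator_def eval_nat_numeral simp flip: ennreal_mult)
  also have "\<dots> = ennreal (ln R - ln \<rho>)"
    using assms by (intro nn_integral_FTC_Icc)
      (auto intro!: derivative_eq_intros simp flip: has_real_derivative_iff_has_vector_derivative)
  finally show ?thesis using assms by (simp add: ennreal_mult' ln_div)
qed

text \<open>The ball lies on one side of its tangent hyperplane at \<open>x\<close>, so it sees only half of the annulus;
  this half is what produces the sharp constant.\<close>
lemma nn_integral_half_annulus:
  assumes x: "norm (x::R4) = 1" and "0 < \<rho>" "\<rho> \<le> R"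
  shows "(\<integral>\<^sup>+y. indicator (ball 0 1) y * (ennreal (1 / norm (y - x) ^ 4) * indicator {\<rho>..R} (norm (y - x))) \<partial>lborel)
     \<le> ennreal (pi\<^sup>2 * ln (R / \<rho>))"
proof -
  let ?K = "\<lambda>z::R4. ennreal (1 / norm z ^ 4) * indicator {\<rho>..R} (norm z)"
  let ?I = "\<lambda>P. \<integral>\<^sup>+z. indicator {z. P z} z * ?K z \<partial>lborel"
  have "(\<integral>\<^sup>+y. indicator (ball 0 1) y * ?K (y - x) \<partial>lborel) \<le> (\<integral>\<^sup>+y. indicator {z. z \<bullet> x < 0} (y - x) * ?K (y - x) \<partial>lborel)"
  proof (rule nn_integral_mono)
    fix y :: R4
    have "(y - x) \<bullet> x < 0" if "y \<in> ball 0 1"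
    proof -
      have "y \<bullet> x \<le> norm y * norm x" by (rule norm_cauchy_schwarz)
      then have "y \<bullet> x < 1" using that x by simp
      moreover have "x \<bullet> x = 1" using x by (simp add: dot_square_norm)
      ultimately show ?thesis by (simp add: inner_diff_left)
    qed
    then show "indicator (ball 0 1) y * ?K (y - x) \<le> indicator {z. z \<bullet> x < 0} (y - x) * ?K (y - x)"
      by (auto simp: indicator_def)
  qed
  also have "\<dots> = ?I (\<lambda>z. z \<bullet> x < 0)"
    by (rule nn_integral_translate_R4) measurable
  finally have 1: "(\<integral>\<^sup>+y. indicator (ball 0 1) y * ?K (y - x) \<partial>lborel) \<le> ?I (\<lambda>z. z \<bullet> x < 0)" .
  have 2: "?I (\<lambda>z. z \<bullet> x < 0) = ?I (\<lambda>z. z \<bullet> x > 0)"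
    by (subst nn_integral_reflect_R4[symmetric]) (auto simp: indicator_def)
  have "?I (\<lambda>z. z \<bullet> x < 0) + ?I (\<lambda>z. z \<bullet> x > 0)
     = (\<integral>\<^sup>+z. indicator {z. z \<bullet> x < 0} z * ?K z + indicator {z. z \<bullet> x > 0} z * ?K z \<partial>lborel)"
    by (rule nn_integral_add[symmetric]) measurable
  also have "\<dots> \<le> (\<integral>\<^sup>+z. ?K z \<partial>lborel)"
    by (rule nn_integral_mono) (auto simp: indicator_def)
  also have "\<dots> = ennreal (2 * pi\<^sup>2 * ln (R / \<rho>))"
    by (rule nn_integral_norm_four_annulus) fact+
  also have "\<dots> = 2 * ennreal (pi\<^sup>2 * ln (R / \<rho>))"
    using assms by (simp add: ennreal_mult'[symmetric] mult_ac flip: ennreal_numeral)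
  finally have "2 * ?I (\<lambda>z. z \<bullet> x < 0) \<le> 2 * ennreal (pi\<^sup>2 * ln (R / \<rho>))"
    using 2 by (simp add: mult_2)
  then have "?I (\<lambda>z. z \<bullet> x < 0) \<le> ennreal (pi\<^sup>2 * ln (R / \<rho>))"
    by (subst (asm) ennreal_mult_le_mult_iff) auto
  with 1 show ?thesis by (rule order_trans)
qed

text \<open>The cone over \<open>ball x \<rho>\<close> inside the unit ball lies in a tube about the
  segment from 0 to \<open>x\<close>: \<open>n + 1\<close> balls of radius
  \<open>2 * \<rho>\<close>, with centres spaced by \<rho>, cover it, each of volume
  \<open>8 * pi^2 * \<rho>^4\<close>. Since \<open>(n + 1) * \<rho>\<close> is at most 3, the factor
  4 in \<open>S3\<close> leads to 96.\<close>

lemma emeasure_S3_ball_sphere: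
  assumes x: "norm x = 1" and \<rho>: "0 < \<rho>"
  shows "emeasure S3 (ball x \<rho>) \<le> ennreal (96 * pi\<^sup>2 * \<rho> ^ 3)"
proof (cases "\<rho> \<le> 1")
  case False
  have "emeasure S3 (ball x \<rho>) \<le> emeasure S3 UNIV" by (rule emeasure_mono) auto
  also have "\<dots> \<le> ennreal (96 * pi\<^sup>2 * \<rho> ^ 3)"
  proof -
    have "1 \<le> \<rho> ^ 3" using False by (intro one_le_power) auto
    then have "2 * pi\<^sup>2 * 1 \<le> 96 * pi\<^sup>2 * \<rho> ^ 3" by (intro mult_mono) auto
    then show ?thesis by (simp add: emeasure_S3_UNIV ennreal_leI)
  qed
  finally show ?thesis .
next
  case True
  define n where "n = nat \<lceil>1 / \<rho>\<rceil>"
  let ?U = "\<Union>j\<le>n. ball ((real j * \<rho>) *\<^sub>R x) (2 * \<rho>)"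
  have sub: "z \<in> ?U" if "z \<in> ball 0 1" "sgn z \<in> ball x \<rho>" for z :: R4
  proof -
    define j where "j = nat \<lfloor>norm z / \<rho>\<rfloor>"
    have j: "real j = of_int \<lfloor>norm z / \<rho>\<rfloor>" using \<rho> by (simp add: j_def)
    have "real j \<le> norm z / \<rho>" "norm z / \<rho> < real j + 1" unfolding j by linarith+
    then have j1: "real j * \<rho> \<le> norm z" "norm z < real j * \<rho> + \<rho>"
      using \<rho> by (auto simp: field_simps)
    have "real j * \<rho> < 1" using j1 that by simp
    then have "real j < 1 / \<rho>" using \<rho> by (simp add: field_simps)
    then have "j \<le> n" unfolding n_def by linarith
    moreover have "dist ((real j * \<rho>) *\<^sub>R x) z < 2 * \<rho>"
    proof -
      have z: "z = norm z *\<^sub>R sgn z" by (cases "z = 0") (auto simp: sgn_div_norm)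
      have "(real j * \<rho>) *\<^sub>R x - z = (real j * \<rho> - norm z) *\<^sub>R x + norm z *\<^sub>R (x - sgn z)"
        by (subst (1) z) (simp add: algebra_simps)
      then have "norm ((real j * \<rho>) *\<^sub>R x - z) \<le> norm ((real j * \<rho> - norm z) *\<^sub>R x) + norm (norm z *\<^sub>R (x - sgn z))"
        by (metis norm_triangle_ineq)
      also have "\<dots> \<le> \<bar>real j * \<rho> - norm z\<bar> + 1 * norm (x - sgn z)"
        using x that by (intro add_mono) (auto intro!: mult_left_le_one_le)
      also have "\<dots> < \<rho> + \<rho>" using j1 that by (auto simp: dist_norm)
      finally show ?thesis by (simp add: dist_norm)
    qed
    ultimately show ?thesis by auto
  qed
  have "emeasure S3 (ball x \<rho>) = (\<integral>\<^sup>+z. indicator (ball x \<rho>) z \<partial>S3)" by simp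
  also have "\<dots> = (\<integral>\<^sup>+z. 4 * indicator (ball 0 1) z * indicator (ball x \<rho>) (sgn z) \<partial>lborel)"
    by (rule nn_integral_S3) measurable
  also have "\<dots> \<le> (\<integral>\<^sup>+z. 4 * indicator ?U z \<partial>lborel)"
    using sub by (intro nn_integral_mono) (auto simp: indicator_def)
  also have "\<dots> = 4 * emeasure lborel ?U"
    by (rule nn_integral_cmult_indicator) auto
  also have "\<dots> \<le> 4 * (\<Sum>j\<le>n. emeasure lborel (ball ((real j * \<rho>) *\<^sub>R x) (2 * \<rho>)))"
    by (intro mult_left_mono emeasure_subadditive_finite) auto
  also have "\<dots> = 4 * (\<Sum>j\<le>n. ennreal (pi\<^sup>2 / 2 * (2 * \<rho>) ^ 4))"
    using \<rho> by (simp add: emeasure_ball_R4)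
  also have "\<dots> = ennreal (4 * (real (Suc n) * (pi\<^sup>2 / 2 * (2 * \<rho>) ^ 4)))"
  proof -
    have "(\<Sum>j\<le>n. ennreal (pi\<^sup>2 / 2 * (2 * \<rho>) ^ 4)) = ennreal (\<Sum>j\<le>n. pi\<^sup>2 / 2 * (2 * \<rho>) ^ 4)"
      by (rule sum_ennreal) simp
    also have "(\<Sum>j\<le>n. pi\<^sup>2 / 2 * (2 * \<rho>) ^ 4) = real (Suc n) * (pi\<^sup>2 / 2 * (2 * \<rho>) ^ 4)" by simp
    finally have *: "(\<Sum>j\<le>n. ennreal (pi\<^sup>2 / 2 * (2 * \<rho>) ^ 4)) = ennreal (real (Suc n) * (pi\<^sup>2 / 2 * (2 * \<rho>) ^ 4))" .
    have "4 * ennreal a = ennreal (4 * a)" for a by (simp add: ennreal_mult')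
    then show ?thesis by (simp only: *)
  qed
  also have "\<dots> \<le> ennreal (96 * pi\<^sup>2 * \<rho> ^ 3)"
  proof (rule ennreal_leI)
    have "real n \<le> 1 / \<rho> + 1" unfolding n_def using \<rho> by (simp add: of_nat_nat)
    then have "real (Suc n) * \<rho> \<le> 3" using \<rho> True by (simp add: field_simps)
    then have "(real (Suc n) * \<rho>) * (32 * pi\<^sup>2 * \<rho> ^ 3) \<le> 3 * (32 * pi\<^sup>2 * \<rho> ^ 3)"
      using \<rho> by (intro mult_right_mono) auto
    then show "4 * (real (Suc n) * (pi\<^sup>2 / 2 * (2 * \<rho>) ^ 4)) \<le> 96 * pi\<^sup>2 * \<rho> ^ 3"
      by (simp add: algebra_simps eval_nat_numeral)
  qed
  finally show ?thesis .
qed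

text \<open>A ball about an arbitrary centre either misses the sphere or lies in a ball of twice the
  radius about a point of the sphere; doubling costs the factor 8.\<close>

lemma emeasure_S3_ball:
  assumes \<rho>: "0 < \<rho>"
  shows "emeasure S3 (ball y \<rho>) \<le> ennreal (768 * pi\<^sup>2 * \<rho> ^ 3)"
proof (cases "\<exists>x\<in>ball y \<rho>. norm x = 1")
  case True
  then obtain x where x: "x \<in> ball y \<rho>" "norm x = 1" by auto
  have "ball y \<rho> \<subseteq> ball x (2 * \<rho>)"
  proof
    fix z assume "z \<in> ball y \<rho>"
    then show "z \<in> ball x (2 * \<rho>)" using x dist_triangle[of x z y] by (auto simp: dist_commute)
  qed
  then have "emeasure S3 (ball y \<rho>) \<le> emeasure S3 (ball x (2 * \<rho>))"
    by (intro emeasure_mono) auto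
  also have "\<dots> \<le> ennreal (96 * pi\<^sup>2 * (2 * \<rho>) ^ 3)"
    using x \<rho> by (intro emeasure_S3_ball_sphere) auto
  finally show ?thesis by (simp add: algebra_simps)
next
  case False
  have "AE x in S3. x \<notin> ball y \<rho>"
    using AE_S3 False by (auto elim!: eventually_mono)
  then have "emeasure S3 (ball y \<rho>) = 0"
    by (subst (asm) AE_iff_measurable[where N="ball y \<rho>"]) auto
  then show ?thesis by simp
qed

lemma dyadic_shell:
  fixes d \<rho> :: real
  assumes "0 < d" "d < \<rho>"
  obtains j :: nat where "\<rho> / 2 ^ Suc j \<le> d" "d < \<rho> / 2 ^ j"
proof -
  have "\<exists>n::nat. \<rho> / 2 ^ n \<le> d"
  proof -
    obtain n where "(1/2::real) ^ n < d / \<rho>"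
      using real_arch_pow_inv[of "d / \<rho>" "1/2"] assms by auto
    then have "\<rho> / 2 ^ n \<le> d" using assms by (simp add: field_simps power_divide)
    then show ?thesis ..
  qed
  define n where "n = (LEAST n::nat. \<rho> / 2 ^ n \<le> d)"
  have n: "\<rho> / 2 ^ n \<le> d" unfolding n_def by (rule LeastI_ex) fact
  have "n \<noteq> 0" using n assms by (intro notI) auto
  then obtain j where j: "n = Suc j" by (cases n) auto
  have "\<not> \<rho> / 2 ^ j \<le> d" by (rule not_less_Least) (simp add: j n_def[symmetric])
  with n j show ?thesis by (intro that[of j]) auto
qed

text \<open>Dyadic shells: on the shell of radius about \<open>\<rho> / 2^j\<close> the kernel is at
  most \<open>2^(j+1) / \<rho>\<close> and the measure at most
  \<open>768 * pi^2 * \<rho>^3 / 8^j\<close>. The products form a geometric series with first term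
  \<open>1536 * pi^2 * \<rho>^2\<close> and ratio 1/4, hence 2048.\<close>

lemma nn_integral_S3_inverse_norm_ball:
  assumes \<rho>: "0 < \<rho>"
  shows "(\<integral>\<^sup>+x. ennreal (1 / norm (x - y)) * indicator (ball y \<rho>) x \<partial>S3) \<le> ennreal (2048 * pi\<^sup>2 * \<rho>\<^sup>2)"
proof -
  let ?t = "\<lambda>j x. ennreal (2 ^ Suc j / \<rho>) * indicator (ball y (\<rho> / 2 ^ j)) x"
  have "(\<integral>\<^sup>+x. ennreal (1 / norm (x - y)) * indicator (ball y \<rho>) x \<partial>S3) \<le> (\<integral>\<^sup>+x. (\<Sum>j. ?t j x) \<partial>S3)"
  proof (rule nn_integral_mono)
    fix x
    show "ennreal (1 / norm (x - y)) * indicator (ball y \<rho>) x \<le> (\<Sum>j. ?t j x)"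
    \<comment> \<open>At \<open>x = y\<close> the left-hand side is 0, because
      \<open>1 / 0 = 0\<close>.\<close>
    proof (cases "x \<noteq> y \<and> x \<in> ball y \<rho>")
      case True
      then have "0 < norm (x - y)" "norm (x - y) < \<rho>" by (auto simp: dist_norm norm_minus_commute)
      then obtain j where j: "\<rho> / 2 ^ Suc j \<le> norm (x - y)" "norm (x - y) < \<rho> / 2 ^ j"
        by (rule dyadic_shell)
      have "1 / norm (x - y) \<le> 2 ^ Suc j / \<rho>"
        using j \<rho> True by (simp add: field_simps)
      then have "ennreal (1 / norm (x - y)) * indicator (ball y \<rho>) x \<le> ?t j x"
        using True j by (auto simp: dist_norm norm_minus_commute intro!: ennreal_leI)
      also have "\<dots> \<le> (\<Sum>j. ?t j x)"
      proof -
        define f where "f = (\<lambda>j. ?t j x)"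
        have "sum f {j} \<le> suminf f" by (rule sum_le_suminf) auto
        then show ?thesis by (simp add: f_def[symmetric] del: power_Suc) (simp add: f_def)
      qed
      finally show ?thesis .
    qed auto
  qed
  also have "\<dots> = (\<Sum>j. \<integral>\<^sup>+x. ?t j x \<partial>S3)" by (rule nn_integral_suminf) measurable
  also have "\<dots> = (\<Sum>j. ennreal (2 ^ Suc j / \<rho>) * emeasure S3 (ball y (\<rho> / 2 ^ j)))"
    by (simp add: nn_integral_cmult_indicator del: power_Suc)
  also have "\<dots> \<le> (\<Sum>j. ennreal (1536 * pi\<^sup>2 * \<rho>\<^sup>2 * (1/4) ^ j))"
  proof (rule suminf_le)
    fix j
    have "ennreal (2 ^ Suc j / \<rho>) * emeasure S3 (ball y (\<rho> / 2 ^ j))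
      \<le> ennreal (2 ^ Suc j / \<rho>) * ennreal (768 * pi\<^sup>2 * (\<rho> / 2 ^ j) ^ 3)"
      using \<rho> by (intro mult_left_mono emeasure_S3_ball) auto
    also have "\<dots> = ennreal (2 ^ Suc j / \<rho> * (768 * pi\<^sup>2 * (\<rho> / 2 ^ j) ^ 3))"
      using \<rho> by (intro ennreal_mult[symmetric]) auto
    also have "2 ^ Suc j / \<rho> * (768 * pi\<^sup>2 * (\<rho> / 2 ^ j) ^ 3) = 1536 * pi\<^sup>2 * \<rho>\<^sup>2 * (1/4) ^ j"
    proof -
      have "(4::real) ^ j = 2 ^ j * 2 ^ j" by (simp flip: power_mult_distrib)
      then show ?thesis using \<rho> by (simp add: power_divide eval_nat_numeral)
    qed
    finally show "ennreal (2 ^ Suc j / \<rho>) * emeasure S3 (ball y (\<rho> / 2 ^ j)) \<le> ennreal (1536 * pi\<^sup>2 * \<rho>\<^sup>2 * (1/4) ^ j)" .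
  qed auto
  also have "\<dots> = ennreal (1536 * pi\<^sup>2 * \<rho>\<^sup>2 * (4 / 3))"
  proof (rule suminf_ennreal_eq)
    have "(\<lambda>j. (1/4::real) ^ j) sums (1 / (1 - 1/4))" by (rule geometric_sums) simp
    then show "(\<lambda>j. 1536 * pi\<^sup>2 * \<rho>\<^sup>2 * (1/4) ^ j) sums (1536 * pi\<^sup>2 * \<rho>\<^sup>2 * (4 / 3))"
      by (intro sums_mult) simp
  qed simp
  finally show ?thesis by (simp add: mult.assoc)
qed

text \<open>The radial integral of \<open>r^(2 * n + 3)\<close> over the unit interval splits off.
  After normalization these weights approximate the surface measure by volume integrals, which is
  how boundary terms arise in Green's formula.\<close>

lemma nn_integral_ball_power_sgn:
  assumes [measurable]: "h \<in> borel_measurable borel"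
  shows "(\<integral>\<^sup>+x. indicator (ball 0 1) x * (ennreal ((x \<bullet> x) ^ n) * h (sgn (x::R4))) \<partial>lborel)
     = ennreal (1 / (2 * real n + 4)) * (\<integral>\<^sup>+\<omega>. h \<omega> \<partial>S3)"
proof -
  have "(\<integral>\<^sup>+x. indicator (ball 0 1) x * (ennreal ((x \<bullet> x) ^ n) * h (sgn (x::R4))) \<partial>lborel)
    = (\<integral>\<^sup>+r. ennreal (r ^ 3) * indicator {0<..} r * (\<integral>\<^sup>+\<omega>. indicator (ball 0 1) (r *\<^sub>R \<omega>) * (ennreal ((r *\<^sub>R \<omega> \<bullet> r *\<^sub>R \<omega>) ^ n) * h (sgn (r *\<^sub>R \<omega>))) \<partial>S3) \<partial>lborel)"
    by (rule nn_integral_polar) measurable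
  also have "\<dots> = (\<integral>\<^sup>+r. (\<integral>\<^sup>+\<omega>. h \<omega> \<partial>S3) * (ennreal (r ^ (2 * n + 3)) * indicator {0..1} r) \<partial>lborel)"
  proof (rule nn_integral_cong_AE)
    have "AE r in lborel. (r::real) \<noteq> 0" "AE r in lborel. (r::real) \<noteq> 1"
      by (rule AE_lborel_singleton)+
    then show "AE r in lborel. ennreal (r ^ 3) * indicator {0<..} r * (\<integral>\<^sup>+\<omega>. indicator (ball 0 1) (r *\<^sub>R \<omega>) * (ennreal ((r *\<^sub>R \<omega> \<bullet> r *\<^sub>R \<omega>) ^ n) * h (sgn (r *\<^sub>R \<omega>))) \<partial>S3)
      = (\<integral>\<^sup>+\<omega>. h \<omega> \<partial>S3) * (ennreal (r ^ (2 * n + 3)) * indicator {0..1} r)"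
    proof eventually_elim
      case (elim r)
      show ?case
      proof (cases "r > 0")
        case True
        have "(\<integral>\<^sup>+\<omega>. indicator (ball 0 1) (r *\<^sub>R \<omega>) * (ennreal ((r *\<^sub>R \<omega> \<bullet> r *\<^sub>R \<omega>) ^ n) * h (sgn (r *\<^sub>R \<omega>))) \<partial>S3)
          = (\<integral>\<^sup>+\<omega>. (ennreal (r ^ (2 * n)) * indicator {..<1} r) * h \<omega> \<partial>S3)"
        proof (rule nn_integral_cong_AE)
          show "AE \<omega> in S3. indicator (ball 0 1) (r *\<^sub>R \<omega>) * (ennreal ((r *\<^sub>R \<omega> \<bullet> r *\<^sub>R \<omega>) ^ n) * h (sgn (r *\<^sub>R \<omega>)))
             = (ennreal (r ^ (2 * n)) * indicator {..<1} r) * h \<omega>"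
            using AE_S3
          proof eventually_elim
            case (elim \<omega>)
            have "r *\<^sub>R \<omega> \<bullet> r *\<^sub>R \<omega> = r\<^sup>2" using elim by (simp add: dot_square_norm power2_eq_square)
            moreover have "sgn (r *\<^sub>R \<omega>) = \<omega>" using elim True by (simp add: sgn_div_norm)
            moreover have "r *\<^sub>R \<omega> \<in> ball 0 1 \<longleftrightarrow> r < 1" using elim True by simp
            ultimately show ?case by (simp add: indicator_def power_mult)
          qed
        qed
        also have "\<dots> = (ennreal (r ^ (2 * n)) * indicator {..<1} r) * (\<integral>\<^sup>+\<omega>. h \<omega> \<partial>S3)"
          by (rule nn_integral_cmult) measurable
        moreover have "ennreal (r ^ (2 * n + 3)) = ennreal (r ^ 3) * ennreal (r ^ (2 * n))"
        proof -
          have "r ^ (2 * n + 3) = r ^ 3 * r ^ (2 * n)" by (simp only: power_add mult.commute)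
          then show ?thesis using True by (simp only:) (rule ennreal_mult, auto)
        qed
        ultimately show ?thesis using True elim
          by (simp add: indicator_def mult_ac)
      qed (use elim in \<open>auto simp: indicator_def\<close>)
    qed
  qed
  also have "\<dots> = (\<integral>\<^sup>+\<omega>. h \<omega> \<partial>S3) * (\<integral>\<^sup>+r. ennreal (r ^ (2 * n + 3)) * indicator {0..1} r \<partial>lborel)"
    by (rule nn_integral_cmult) measurable
  also have "(\<integral>\<^sup>+r. ennreal (r ^ (2 * n + 3)) * indicator {0..1} r \<partial>lborel)
      = ennreal (1 ^ (2 * n + 4) / (2 * real n + 4) - 0 ^ (2 * n + 4) / (2 * real n + 4))"
  proof -
    have D: "((\<lambda>r::real. r ^ (2 * n + 4) / (2 * real n + 4)) has_real_derivative r ^ (2 * n + 3)) (at r)" for r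
      using DERIV_cdivide[OF DERIV_pow[of "2 * n + 4" r], of "2 * real n + 4"]
      by (rule DERIV_cong) (simp add: field_simps)
    show ?thesis
      by (rule nn_integral_FTC_Icc[where F="\<lambda>r. r ^ (2 * n + 4) / (2 * real n + 4)", OF _ D]) auto
  qed
  finally show ?thesis by (simp add: mult.commute[of "integral\<^sup>N S3 h"] power_0_left)
qed

section \<open>Green's formula on the ball\<close>

lemma integrable_ball_continuous:
  assumes "continuous_on (cball 0 1) (k :: R4 \<Rightarrow> real)"
  shows "integrable lborel (\<lambda>x. indicator (ball 0 1) x * k x)"
proof -
  have "set_integrable lborel (cball 0 1) k"
    unfolding set_integrable_def by (rule borel_integrable_compact) (use assms in auto)
  then have "set_integrable lborel (ball 0 1) k"
    by (rule set_integrable_subset) auto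
  then show ?thesis by (simp add: set_integrable_def)
qed

lemma integral_ball_continuous:
  assumes "continuous_on (cball 0 1) (k :: R4 \<Rightarrow> real)"
  shows "integral (ball 0 1) k = (LINT x|lborel. indicator (ball 0 1) x * k x)"
proof -
  have "set_integrable lborel (ball 0 1) k"
    using integrable_ball_continuous[OF assms] by (simp add: set_integrable_def)
  from set_borel_integral_eq_integral(2)[OF this] show ?thesis
    by (simp add: set_lebesgue_integral_def)
qed

lemma continuous_on_cball_bound:
  assumes "continuous_on (cball 0 1) (k :: R4 \<Rightarrow> real)"
  obtains C where "C \<ge> 0" "\<And>x. x \<in> cball 0 1 \<Longrightarrow> \<bar>k x\<bar> \<le> C"
proof -
  have "compact (k ` cball 0 1)" by (intro compact_continuous_image assms) auto
  then obtain B where B: "\<And>x. x \<in> cball 0 1 \<Longrightarrow> \<bar>k x\<bar> \<le> B"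
    using compact_imp_bounded bounded_iff by (metis imageI real_norm_def)
  then show ?thesis by (intro that[of "\<bar>B\<bar>"]) force+
qed

lemma AE_lborel_not_sphere: "AE x in (lborel :: R4 measure). norm x \<noteq> 1"
proof -
  have "sphere (0::R4) 1 \<in> null_sets lborel"
    using negligible_sphere[of "0::R4" 1] by (simp add: negligible_iff_null_sets null_sets_completion_iff)
  then show ?thesis using AE_not_in by fastforce
qed

text \<open>The zero extension of \<open>g\<close> is Lipschitz in direction \<open>e\<close>, so the claim is translation invariance
  of the Lebesgue integral, differentiated under the integral sign.\<close>
lemma integral_ball_directional_derivative_eq_0:
  fixes g g' :: "R4 \<Rightarrow> real"
  assumes e: "norm e = 1"
    and cg: "continuous_on (cball 0 1) g" and cg': "continuous_on (cball 0 1) g'"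
    and der: "\<And>x. x \<in> cball 0 1 \<Longrightarrow> ((\<lambda>t. g (x + t *\<^sub>R e)) has_real_derivative g' x) (at 0)"
    and zero: "\<And>x. x \<in> sphere 0 1 \<Longrightarrow> g x = 0"
  shows "(LINT x|lborel. indicator (ball 0 1) x * g' x) = 0"
proof -
  obtain C where C: "C \<ge> 0" "\<And>x. x \<in> cball 0 1 \<Longrightarrow> \<bar>g' x\<bar> \<le> C"
    using continuous_on_cball_bound[OF cg'] by metis
  have lip: "\<bar>g (x + t *\<^sub>R e) - g x\<bar> \<le> C * \<bar>t\<bar>" if "x \<in> cball 0 1" "x + t *\<^sub>R e \<in> cball 0 1" for x t
  proof -
    have seg: "x + s *\<^sub>R e \<in> cball 0 1" if s: "s \<in> closed_segment 0 t" for s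
    proof -
      obtain v where v: "0 \<le> v" "v \<le> 1" "s = v * t" using s by (auto simp: in_segment)
      have "x + s *\<^sub>R e = (1 - v) *\<^sub>R x + v *\<^sub>R (x + t *\<^sub>R e)"
        by (simp add: v algebra_simps)
      then show ?thesis
        using convexD_alt[OF convex_cball \<open>x \<in> cball 0 1\<close> \<open>x + t *\<^sub>R e \<in> cball 0 1\<close> v(1,2)] by simp
    qed
    have "norm (g (x + t *\<^sub>R e) - g (x + 0 *\<^sub>R e)) \<le> C * norm (t - 0)"
    proof (rule field_differentiable_bound[where S="closed_segment 0 t" and f="\<lambda>s. g (x + s *\<^sub>R e)" and f'="\<lambda>s. g' (x + s *\<^sub>R e)"])
      fix s assume s: "s \<in> closed_segment 0 t"
      have "((\<lambda>r. g (x + (r + s) *\<^sub>R e)) has_real_derivative g' (x + s *\<^sub>R e)) (at 0)"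
        using der[OF seg[OF s]] by (simp add: algebra_simps)
      then have "((\<lambda>r. g (x + r *\<^sub>R e)) has_real_derivative g' (x + s *\<^sub>R e)) (at (0 + s))"
        by (subst DERIV_shift)
      then show "((\<lambda>r. g (x + r *\<^sub>R e)) has_real_derivative g' (x + s *\<^sub>R e)) (at s within closed_segment 0 t)"
        by (simp add: has_field_derivative_at_within)
      show "norm (g' (x + s *\<^sub>R e)) \<le> C" using C(2)[OF seg[OF s]] by simp
    qed auto
    then show ?thesis by simp
  qed
  define G where "G = (\<lambda>x. indicator (cball 0 1) x * g x)"
  \<comment> \<open>A step that leaves the ball crosses the sphere, where \<open>g\<close> is 0, so
    \<open>g x\<close> itself is bounded by \<open>C\<close> times the step. This gives the
    Lipschitz bound for the zero extension.\<close>
  have exit: "\<bar>g x\<bar> \<le> C * \<bar>t\<bar>" if "x \<in> cball 0 1" "x + t *\<^sub>R e \<notin> cball 0 1" for x t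
  proof -
    have "closed_segment x (x + t *\<^sub>R e) \<inter> frontier (cball 0 1) \<noteq> {}"
      using that by (intro connected_Int_frontier) auto
    then obtain z where z: "z \<in> closed_segment x (x + t *\<^sub>R e)" "z \<in> sphere 0 1"
      by (auto simp: frontier_cball)
    then obtain v where v: "0 \<le> v" "v \<le> 1" "z = (1 - v) *\<^sub>R x + v *\<^sub>R (x + t *\<^sub>R e)"
      by (auto simp: in_segment)
    then have zz: "z = x + (v * t) *\<^sub>R e" by (simp add: algebra_simps)
    have "\<bar>g z - g x\<bar> \<le> C * \<bar>v * t\<bar>" unfolding zz
      using z that zz by (intro lip) auto
    also have "\<dots> \<le> C * \<bar>t\<bar>" using v C(1) by (intro mult_left_mono) (auto simp: abs_mult mult_left_le_one_le)
    finally show ?thesis using zero[OF z(2)] by simp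
  qed
  have Glip: "\<bar>G (x + t *\<^sub>R e) - G x\<bar> \<le> C * \<bar>t\<bar>" for x t
  proof -
    consider "x \<in> cball 0 1" "x + t *\<^sub>R e \<in> cball 0 1" | "x \<in> cball 0 1" "x + t *\<^sub>R e \<notin> cball 0 1"
      | "x \<notin> cball 0 1" "x + t *\<^sub>R e \<in> cball 0 1" | "x \<notin> cball 0 1" "x + t *\<^sub>R e \<notin> cball 0 1" by blast
    then show ?thesis
    proof cases
      case 1 then show ?thesis using lip[of x t] by (simp add: G_def)
    next
      case 2 then show ?thesis using exit[of x t] by (simp add: G_def)
    next
      case 3 then show ?thesis using exit[of "x + t *\<^sub>R e" "-t"] by (simp add: G_def)
    next
      case 4 then show ?thesis using C(1) by (simp add: G_def)
    qed
  qed
  have Gint: "integrable lborel G"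
    using borel_integrable_compact[OF compact_cball cg] by (simp add: G_def)
  then have Gm [measurable]: "G \<in> borel_measurable borel" by auto
  define h where "h = (\<lambda>n::nat. 1 / real (Suc n))"
  have h: "h n > 0" "h n \<le> 1" for n by (auto simp: h_def field_simps)
  have h0: "h \<longlonglongrightarrow> 0" unfolding h_def by (rule LIMSEQ_Suc[OF lim_1_over_n])
  have trans: "integrable lborel (\<lambda>x. G (x + c))" "(LINT x|lborel. G (x + c)) = (LINT x|lborel. G x)" for c
  proof -
    have "integrable (distr lborel borel ((+) c)) G" using Gint by (simp add: lborel_distr_plus)
    then show "integrable lborel (\<lambda>x. G (x + c))"
      by (subst (asm) integrable_distr_eq) (auto simp: add.commute)
    have "(LINT x|lborel. G x) = (LINT x|distr lborel borel ((+) c). G x)" by (simp add: lborel_distr_plus)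
    also have "\<dots> = (LINT x|lborel. G (x + c))"
      by (subst integral_distr) (auto simp: add.commute)
    finally show "(LINT x|lborel. G (x + c)) = (LINT x|lborel. G x)" ..
  qed
  have "(\<lambda>n. LINT x|lborel. (G (x + h n *\<^sub>R e) - G x) / h n) \<longlonglongrightarrow> (LINT x|lborel. indicator (ball 0 1) x * g' x)"
  proof (rule integral_dominated_convergence)
    show "integrable lborel (\<lambda>x::R4. C * indicator (cball 0 2) x)"
      by (intro integrable_mult_right integrable_real_indicator) (auto intro: emeasure_lborel_cball_finite[unfolded infinity_ennreal_def])
    show "(\<lambda>x. indicator (ball 0 1) x * g' x) \<in> borel_measurable lborel"
      using integrable_ball_continuous[OF cg'] by auto
    show "(\<lambda>x. (G (x + h n *\<^sub>R e) - G x) / h n) \<in> borel_measurable lborel" for n by measurable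
    show "AE x in lborel. norm ((G (x + h n *\<^sub>R e) - G x) / h n) \<le> C * indicator (cball 0 2) x" for n
    proof (rule AE_I2)
      fix x
      show "norm ((G (x + h n *\<^sub>R e) - G x) / h n) \<le> C * indicator (cball 0 2) x"
      proof (cases "x \<in> cball 0 2")
        case True
        then show ?thesis using Glip[of x "h n"] h[of n] by (simp add: field_simps)
      next
        case False
        have "norm x \<le> norm (x + h n *\<^sub>R e) + norm (h n *\<^sub>R e)"
          using norm_triangle_ineq4[of "x + h n *\<^sub>R e" "h n *\<^sub>R e"] by simp
        then have "norm (x + h n *\<^sub>R e) > 1" using False e h[of n] by simp
        then show ?thesis using False by (simp add: G_def)
      qed
    qed
    show "AE x in lborel. (\<lambda>n. (G (x + h n *\<^sub>R e) - G x) / h n) \<longlonglongrightarrow> indicator (ball 0 1) x * g' x"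
      using AE_lborel_not_sphere
    proof eventually_elim
      case (elim x)
      have lx: "(\<lambda>n. x + h n *\<^sub>R e) \<longlonglongrightarrow> x"
        using tendsto_add[OF tendsto_const tendsto_scaleR[OF h0 tendsto_const], of x e] by simp
      consider "x \<in> ball 0 1" | "x \<in> - cball 0 1" using elim by force
      then show ?case
      proof cases
        case 1
        have ev: "eventually (\<lambda>n. x + h n *\<^sub>R e \<in> ball 0 1) sequentially"
          by (rule topological_tendstoD[OF lx open_ball 1])
        have "((\<lambda>t. (g (x + (0 + t) *\<^sub>R e) - g (x + 0 *\<^sub>R e)) / t) \<longlongrightarrow> g' x) (at 0)"
          using der[of x] 1 by (auto simp: DERIV_def)
        moreover have "filterlim h (at 0) sequentially"
          using h0 h(1) by (auto simp: filterlim_at intro!: always_eventually) (metis less_irrefl)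
        ultimately have "(\<lambda>n. (g (x + (0 + h n) *\<^sub>R e) - g (x + 0 *\<^sub>R e)) / h n) \<longlonglongrightarrow> g' x"
          by (rule filterlim_compose)
        then have "(\<lambda>n. (g (x + h n *\<^sub>R e) - g x) / h n) \<longlonglongrightarrow> g' x" by simp
        moreover have "eventually (\<lambda>n. (g (x + h n *\<^sub>R e) - g x) / h n = (G (x + h n *\<^sub>R e) - G x) / h n) sequentially"
          using ev by eventually_elim (use 1 in \<open>auto simp: G_def indicator_def\<close>)
        ultimately have "(\<lambda>n. (G (x + h n *\<^sub>R e) - G x) / h n) \<longlonglongrightarrow> g' x"
          by (rule Lim_transform_eventually)
        then show ?thesis using 1 by simp
      next
        case 2
        have "eventually (\<lambda>n. x + h n *\<^sub>R e \<in> - cball 0 1) sequentially"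
          by (rule topological_tendstoD[OF lx _ 2]) auto
        then have "eventually (\<lambda>n. 0 = (G (x + h n *\<^sub>R e) - G x) / h n) sequentially"
          by eventually_elim (use 2 in \<open>auto simp: G_def indicator_def\<close>)
        then have "(\<lambda>n. (G (x + h n *\<^sub>R e) - G x) / h n) \<longlonglongrightarrow> 0"
          by (rule Lim_transform_eventually[OF tendsto_const])
        then show ?thesis using 2 by (auto simp: indicator_def)
      qed
    qed
  qed
  moreover have "(\<lambda>n. LINT x|lborel. (G (x + h n *\<^sub>R e) - G x) / h n) = (\<lambda>n. 0)"
    using trans Gint by (simp add: Bochner_Integration.integral_diff)
  ultimately have "(\<lambda>n. 0::real) \<longlonglongrightarrow> (LINT x|lborel. indicator (ball 0 1) x * g' x)" by (simp only:)
  then show ?thesis by (simp add: LIMSEQ_const_iff)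
qed

lemma integral_ball_power_sgn:
  assumes [measurable]: "h \<in> borel_measurable (borel :: R4 measure)"
  shows "(LINT x|lborel. indicator (ball 0 1) x * ((x \<bullet> x) ^ n * h (sgn x))) = (LINT x|S3. h x) / (2 * real n + 4)"
    (is "?L = _")
proof -
  let ?d = "\<lambda>x::R4. indicator (ball 0 1) x * (x \<bullet> x) ^ n"
  have "distr (density lborel (\<lambda>x. ennreal (?d x))) borel sgn = density S3 (\<lambda>_. ennreal (1 / (2 * real n + 4)))"
  proof (rule measure_eqI)
    fix A assume "A \<in> sets (distr (density lborel (\<lambda>x. ennreal (?d x))) borel (sgn :: R4 \<Rightarrow> R4))"
    then have [measurable]: "A \<in> sets borel" by simp
    have "emeasure (distr (density lborel (\<lambda>x. ennreal (?d x))) borel (sgn :: R4 \<Rightarrow> R4)) A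
       = (\<integral>\<^sup>+x. indicator A x \<partial>distr (density lborel (\<lambda>x. ennreal (?d x))) borel (sgn :: R4 \<Rightarrow> R4))"
      by simp
    also have "\<dots> = (\<integral>\<^sup>+x. indicator A (sgn x) \<partial>density lborel (\<lambda>x. ennreal (?d x)))"
      by (rule nn_integral_distr) measurable
    also have "\<dots> = (\<integral>\<^sup>+x. ennreal (?d x) * indicator A (sgn x) \<partial>lborel)"
      by (rule nn_integral_density) measurable
    also have "\<dots> = (\<integral>\<^sup>+x. indicator (ball 0 1) x * (ennreal ((x \<bullet> x) ^ n) * indicator A (sgn x)) \<partial>lborel)"
      by (intro nn_integral_cong) (auto simp: indicator_def)
    also have "\<dots> = ennreal (1 / (2 * real n + 4)) * (\<integral>\<^sup>+\<omega>. indicator A \<omega> \<partial>S3)"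
      by (rule nn_integral_ball_power_sgn) measurable
    also have "\<dots> = emeasure (density S3 (\<lambda>_. ennreal (1 / (2 * real n + 4)))) A"
      by (simp add: emeasure_density nn_integral_cmult_indicator)
    finally show "emeasure (distr (density lborel (\<lambda>x. ennreal (?d x))) borel sgn) A = emeasure (density S3 (\<lambda>_. ennreal (1 / (2 * real n + 4)))) A" .
  qed simp
  note eq = this
  have "?L = (LINT x|lborel. ?d x *\<^sub>R h (sgn x))" by (simp add: mult.assoc)
  also have "\<dots> = (LINT x|density lborel (\<lambda>x. ennreal (?d x)). h (sgn x))"
  proof (rule integral_density[symmetric])
    show "AE x in lborel. 0 \<le> ?d x" by (simp add: zero_le_power)
  qed measurable
  also have "\<dots> = (LINT x|distr (density lborel (\<lambda>x. ennreal (?d x))) borel sgn. h x)"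
    by (rule integral_distr[symmetric]) measurable
  also have "\<dots> = (LINT x|S3. (1 / (2 * real n + 4)) *\<^sub>R h x)"
    unfolding eq by (rule integral_density) auto
  finally show ?thesis by simp
qed

text \<open>The weight \<open>2 * (n + 1) * |x|^(2 * n)\<close> concentrates on the sphere: its mass
  tends to \<open>2 * pi^2\<close>, while its integral against \<open>1 - |x|^2\<close> is
  \<open>O(1 / n)\<close>. The gradient of \<open>1 - |x|^(2 * n + 2)\<close> is minus this weight
  times \<open>x\<close>, which is why exactly this weight is needed for a cutoff argument.\<close>

lemma boundary_limit:
  assumes H: "continuous_on (cball 0 1) (H :: R4 \<Rightarrow> real)"
  shows "(\<lambda>n. LINT x|lborel. indicator (ball 0 1) x * (2 * real (Suc n) * (x \<bullet> x) ^ n * H x))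
    \<longlonglongrightarrow> (LINT x|S3. indicator (sphere 0 1) x * H x)" (is "?J \<longlonglongrightarrow> ?I")
proof -
  let ?h = "\<lambda>x. indicator (sphere 0 1) x * H x"
  have hm [measurable]: "?h \<in> borel_measurable borel"
    by (rule integral_S3_indicator(3)) (rule continuous_on_subset[OF H], auto)
  obtain C where C: "C \<ge> 0" "\<And>x. x \<in> cball 0 1 \<Longrightarrow> \<bar>H x\<bar> \<le> C"
    using continuous_on_cball_bound[OF H] by metis
  have hC: "\<bar>?h x\<bar> \<le> C" for x using C by (auto simp: indicator_def)
  define w where "w = (\<lambda>n (x::R4). indicator (ball 0 1) x * (2 * real (Suc n) * (x \<bullet> x) ^ n))"
  have wint: "integrable lborel (\<lambda>x. w n x * k x)" if "continuous_on (cball 0 1) k" for n k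
    using integrable_ball_continuous[of "\<lambda>x. 2 * real (Suc n) * (x \<bullet> x) ^ n * k x"] that
    by (simp add: w_def mult.assoc continuous_intros)
  have wm [measurable]: "w n \<in> borel_measurable borel" for n
    using wint[of "\<lambda>_. 1" n] by auto
  have w0: "w n x \<ge> 0" for n x by (auto simp: w_def indicator_def)
  have hint: "integrable lborel (\<lambda>x. w n x * ?h (sgn x))" for n
  proof (rule Bochner_Integration.integrable_bound)
    show "integrable lborel (\<lambda>x. w n x * C)" by (rule wint) auto
    show "(\<lambda>x. w n x * ?h (sgn x)) \<in> borel_measurable lborel" by measurable
    show "AE x in lborel. norm (w n x * ?h (sgn x)) \<le> norm (w n x * C)"
      using hC C(1) w0 by (intro AE_I2) (simp add: abs_mult mult_left_mono)
  qed
  have A: "(LINT x|lborel. w n x * k (sgn x)) = real (Suc n) / (real n + 2) * (LINT x|S3. k x)"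
    if [measurable]: "k \<in> borel_measurable borel" for k n
  proof -
    have "(LINT x|lborel. w n x * k (sgn x)) = (LINT x|lborel. 2 * real (Suc n) * (indicator (ball 0 1) x * ((x \<bullet> x) ^ n * k (sgn x))))"
      by (simp add: w_def mult_ac)
    also have "\<dots> = 2 * real (Suc n) * ((LINT x|S3. k x) / (2 * real n + 4))"
      by (subst integral_mult_right_zero) (simp add: integral_ball_power_sgn)
    finally show ?thesis by (simp add: field_simps)
  qed
  have w1: "(LINT x|lborel. w n x) = real (Suc n) / (real n + 2) * (2 * pi\<^sup>2)" for n
    using A[of "\<lambda>_. 1" n] by (simp add: measure_S3_UNIV)
  \<comment> \<open>Multiplication by \<open>x \<bullet> x\<close> turns the weight of index
    \<open>n\<close> into \<open>(n + 1) / (n + 2)\<close> times the next one, so both integrals are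
    instances of \<open>w1\<close>.\<close>
  have w2: "(LINT x|lborel. w n x * (1 - x \<bullet> x)) = real (Suc n) / ((real n + 2) * (real n + 3)) * (2 * pi\<^sup>2)" for n
  proof -
    have "(LINT x|lborel. w n x * (1 - x \<bullet> x)) = (LINT x|lborel. w n x * 1 - real (Suc n) / real (Suc (Suc n)) * (w (Suc n) x * 1))"
    proof -
      have "real (Suc n) / real (Suc (Suc n)) * (2 * real (Suc (Suc n)) * q) = 2 * real (Suc n) * q" for q
        by (simp del: of_nat_Suc)
      then have "w n x * (1 - x \<bullet> x) = w n x * 1 - real (Suc n) / real (Suc (Suc n)) * (w (Suc n) x * 1)" for x
        by (simp add: w_def indicator_def right_diff_distrib mult.assoc mult.commute[of "x \<bullet> x"] del: of_nat_Suc)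
      then show ?thesis by simp
    qed
    also have "\<dots> = (LINT x|lborel. w n x * 1) - (LINT x|lborel. real (Suc n) / real (Suc (Suc n)) * (w (Suc n) x * 1))"
      by (intro Bochner_Integration.integral_diff integrable_mult_right wint) auto
    also have "\<dots> = real (Suc n) / (real n + 2) * (2 * pi\<^sup>2) - real (Suc n) / real (Suc (Suc n)) * (real (Suc (Suc n)) / (real n + 3) * (2 * pi\<^sup>2))"
      by (subst integral_mult_right_zero) (simp add: w1 add_ac)
    also have "\<dots> = real (Suc n) / ((real n + 2) * (real n + 3)) * (2 * pi\<^sup>2)"
      by (simp add: divide_simps) (simp add: algebra_simps)
    finally show ?thesis .
  qed
  have J: "?J n = real (Suc n) / (real n + 2) * ?I + (LINT x|lborel. w n x * (H x - ?h (sgn x)))" for n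
  proof -
    have "?J n = (LINT x|lborel. w n x * H x)" by (simp add: w_def mult.assoc)
    also have "\<dots> = (LINT x|lborel. w n x * ?h (sgn x)) + (LINT x|lborel. w n x * (H x - ?h (sgn x)))"
      unfolding right_diff_distrib
      by (subst Bochner_Integration.integral_diff[OF wint[OF H] hint]) simp
    finally show ?thesis by (simp only: A[OF hm])
  qed
  have "(\<lambda>n. LINT x|lborel. w n x * (H x - ?h (sgn x))) \<longlonglongrightarrow> 0"
  proof (rule LIMSEQ_I)
    fix r :: real assume r: "r > 0"
    define \<eta> where "\<eta> = r / (8 * pi\<^sup>2)"
    have \<eta>: "\<eta> > 0" using r by (simp add: \<eta>_def)
    have "uniformly_continuous_on (cball 0 1) H"
      by (rule compact_uniformly_continuous[OF H]) auto
    then obtain \<delta>' where \<delta>': "\<delta>' > 0" "\<And>x y. x \<in> cball 0 1 \<Longrightarrow> y \<in> cball 0 1 \<Longrightarrow> dist y x < \<delta>' \<Longrightarrow> dist (H y) (H x) < \<eta>"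
      unfolding uniformly_continuous_on_def using \<eta> by metis
    \<comment> \<open>The cap at 1 gives \<open>2 * C \<le> K\<close> below. This settles the
      origin, where \<open>sgn\<close> is 0 and \<open>H\<close> is compared with 0.\<close>
    define \<delta> where "\<delta> = min \<delta>' 1"
    have \<delta>: "0 < \<delta>" "\<delta> \<le> 1" "\<delta> \<le> \<delta>'" using \<delta>'(1) by (auto simp: \<delta>_def)
    \<comment> \<open>The slope for which the crude bound \<open>2 * C\<close> lies below
      \<open>K * (1 - x \<bullet> x)\<close> as soon as
      \<open>1 - norm x \<ge> \<delta>\<close>.\<close>
    define K where "K = 2 * C / \<delta>"
    have K: "K \<ge> 0" "2 * C \<le> K" using C(1) \<delta> by (auto simp: K_def field_simps mult_left_le)
    have pt: "\<bar>H x - ?h (sgn x)\<bar> \<le> \<eta> + K * (1 - x \<bullet> x)" if x: "x \<in> ball 0 1" for x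
    proof (cases "x = 0")
      case True
      then show ?thesis using C(2)[of 0] K \<eta> C(1) by simp
    next
      case False
      have xx: "x \<bullet> x = (norm x)\<^sup>2" by (simp add: dot_square_norm)
      have nx: "norm x < 1" "0 < norm x" using x False by auto
      have q: "1 - norm x \<le> 1 - x \<bullet> x" unfolding xx using nx by (simp add: power2_eq_square mult_left_le)
      have s: "sgn x \<in> sphere 0 1" using False by (simp add: norm_sgn)
      then have hs: "?h (sgn x) = H (sgn x)" by simp
      have ds: "dist x (sgn x) = 1 - norm x"
      proof -
        have "x - sgn x = - ((1 - norm x) *\<^sub>R sgn x)" using False by (simp add: sgn_div_norm algebra_simps)
        then show ?thesis using nx False by (simp add: dist_norm norm_sgn)
      qed
      show ?thesis
      proof (cases "1 - norm x < \<delta>")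
        case True
        then have "dist (H x) (H (sgn x)) < \<eta>"
          using x s \<delta> ds by (intro \<delta>'(2)) auto
        moreover have "K * (1 - x \<bullet> x) \<ge> 0" using K q nx by simp
        ultimately show ?thesis unfolding hs by (simp add: dist_real_def)
      next
        case False
        have "\<bar>H x - H (sgn x)\<bar> \<le> \<bar>H x\<bar> + \<bar>H (sgn x)\<bar>" by (rule abs_triangle_ineq4)
        also have "\<dots> \<le> 2 * C" using C(2)[of x] C(2)[of "sgn x"] x s by auto
        also have "\<dots> = K * \<delta>" using \<delta> by (simp add: K_def)
        also have "\<dots> \<le> K * (1 - x \<bullet> x)" using K False q by (intro mult_left_mono) auto
        finally show ?thesis unfolding hs using \<eta> by simp
      qed
    qed
    have bd: "\<bar>LINT x|lborel. w n x * (H x - ?h (sgn x))\<bar> \<le> \<eta> * (2 * pi\<^sup>2) + K * (2 * pi\<^sup>2) / (real n + 2)" for n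
    proof -
      have "\<bar>LINT x|lborel. w n x * (H x - ?h (sgn x))\<bar> \<le> (LINT x|lborel. \<bar>w n x * (H x - ?h (sgn x))\<bar>)"
        by (rule integral_abs_bound)
      also have "\<dots> \<le> (LINT x|lborel. \<eta> * (w n x * 1) + K * (w n x * (1 - x \<bullet> x)))"
      proof (rule integral_mono)
        show "integrable lborel (\<lambda>x. \<bar>w n x * (H x - ?h (sgn x))\<bar>)"
          unfolding right_diff_distrib by (intro integrable_abs Bochner_Integration.integrable_diff wint H hint)
        show "integrable lborel (\<lambda>x. \<eta> * (w n x * 1) + K * (w n x * (1 - x \<bullet> x)))"
          by (intro Bochner_Integration.integrable_add integrable_mult_right wint continuous_intros)
        fix x :: R4
        show "\<bar>w n x * (H x - ?h (sgn x))\<bar> \<le> \<eta> * (w n x * 1) + K * (w n x * (1 - x \<bullet> x))"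
        proof (cases "x \<in> ball 0 1")
          case True
          have "\<bar>w n x * (H x - ?h (sgn x))\<bar> = w n x * \<bar>H x - ?h (sgn x)\<bar>" using w0 by (simp add: abs_mult)
          also have "\<dots> \<le> w n x * (\<eta> + K * (1 - x \<bullet> x))" by (rule mult_left_mono[OF pt[OF True] w0])
          finally show ?thesis by (simp add: algebra_simps)
        qed (simp add: w_def)
      qed
      also have "\<dots> = \<eta> * (LINT x|lborel. w n x) + K * (LINT x|lborel. w n x * (1 - x \<bullet> x))"
        using wint[of "\<lambda>_. 1" n]
        by (subst Bochner_Integration.integral_add) (auto intro!: integrable_mult_right wint continuous_intros)
      also have "\<dots> \<le> \<eta> * (2 * pi\<^sup>2) + K * (2 * pi\<^sup>2) / (real n + 2)"
      proof (rule add_mono)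
        have "real (Suc n) / (real n + 2) * (2 * pi\<^sup>2) \<le> 1 * (2 * pi\<^sup>2)"
          by (intro mult_right_mono) auto
        then show "\<eta> * (LINT x|lborel. w n x) \<le> \<eta> * (2 * pi\<^sup>2)"
          unfolding w1 using \<eta> by (intro mult_left_mono) auto
        have "real (Suc n) / ((real n + 2) * (real n + 3)) \<le> 1 / (real n + 2)"
          by (simp add: divide_simps)
        then have "real (Suc n) / ((real n + 2) * (real n + 3)) * (2 * pi\<^sup>2) \<le> 1 / (real n + 2) * (2 * pi\<^sup>2)"
          by (intro mult_right_mono) auto
        then have "K * (real (Suc n) / ((real n + 2) * (real n + 3)) * (2 * pi\<^sup>2)) \<le> K * (1 / (real n + 2) * (2 * pi\<^sup>2))"
          using K by (intro mult_left_mono)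
        then show "K * (LINT x|lborel. w n x * (1 - x \<bullet> x)) \<le> K * (2 * pi\<^sup>2) / (real n + 2)"
          unfolding w2 by simp
      qed
      finally show ?thesis .
    qed
    have "(\<lambda>n. K * (2 * pi\<^sup>2) / (real n + 2)) \<longlonglongrightarrow> 0" by real_asymp
    then have "eventually (\<lambda>n. K * (2 * pi\<^sup>2) / (real n + 2) < r / 2) sequentially"
      using r by (intro order_tendstoD) auto
    then obtain N where N: "\<And>n. n \<ge> N \<Longrightarrow> K * (2 * pi\<^sup>2) / (real n + 2) < r / 2"
      by (auto simp: eventually_sequentially)
    have "\<eta> * (2 * pi\<^sup>2) < r / 2" using r by (simp add: \<eta>_def)
    then show "\<exists>N. \<forall>n\<ge>N. norm ((LINT x|lborel. w n x * (H x - ?h (sgn x))) - 0) < r"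
      using bd N by (intro exI[of _ N]) (smt (verit) real_norm_def field_sum_of_halves)
  qed
  moreover have "(\<lambda>n. real (Suc n) / (real n + 2)) \<longlonglongrightarrow> 1" by real_asymp
  then have "(\<lambda>n. real (Suc n) / (real n + 2) * ?I) \<longlonglongrightarrow> 1 * ?I" by (intro tendsto_mult tendsto_const)
  ultimately have "(\<lambda>n. real (Suc n) / (real n + 2) * ?I + (LINT x|lborel. w n x * (H x - ?h (sgn x)))) \<longlonglongrightarrow> 1 * ?I + 0"
    by (intro tendsto_add)
  then show ?thesis unfolding J by simp
qed

text \<open>The field \<open>w grad u - u grad w\<close> times the cutoff
  \<open>1 - |x|^(2 * n + 2)\<close> vanishes on the sphere, so the axis derivatives of its
  components integrate to 0. This trades the divergence for the weighted integral of
  \<open>boundary_limit\<close>, and \<open>n\<close> tends to infinity. Derivatives are separate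
  parameters so that both the iterated \<open>pds\<close> and explicit kernels fit.\<close>

lemma green_ball:
  fixes u w :: "R4 \<Rightarrow> real" and Du Dw D2u D2w :: "4 \<Rightarrow> R4 \<Rightarrow> real"
  assumes cu: "continuous_on (cball 0 1) u" "\<And>i. continuous_on (cball 0 1) (Du i)" "\<And>i. continuous_on (cball 0 1) (D2u i)"
    and cw: "continuous_on (cball 0 1) w" "\<And>i. continuous_on (cball 0 1) (Dw i)" "\<And>i. continuous_on (cball 0 1) (D2w i)"
    and du: "\<And>i x. x \<in> cball 0 1 \<Longrightarrow> ((\<lambda>t. u (x + t *\<^sub>R axis i 1)) has_real_derivative Du i x) (at 0)"
            "\<And>i x. x \<in> cball 0 1 \<Longrightarrow> ((\<lambda>t. Du i (x + t *\<^sub>R axis i 1)) has_real_derivative D2u i x) (at 0)"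
    and dw: "\<And>i x. x \<in> cball 0 1 \<Longrightarrow> ((\<lambda>t. w (x + t *\<^sub>R axis i 1)) has_real_derivative Dw i x) (at 0)"
            "\<And>i x. x \<in> cball 0 1 \<Longrightarrow> ((\<lambda>t. Dw i (x + t *\<^sub>R axis i 1)) has_real_derivative D2w i x) (at 0)"
  shows "(LINT x|lborel. indicator (ball 0 1) x * (w x * (\<Sum>i\<in>UNIV. D2u i x) - u x * (\<Sum>i\<in>UNIV. D2w i x)))
    = (LINT x|S3. indicator (sphere 0 1) x * (w x * (\<Sum>i\<in>UNIV. x $ i * Du i x) - u x * (\<Sum>i\<in>UNIV. x $ i * Dw i x)))"
proof -
  define F where "F = (\<lambda>i x. w x * Du i x - u x * Dw i x)"
  define F' where "F' = (\<lambda>i x. w x * D2u i x - u x * D2w i x)"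
  have cF: "continuous_on (cball 0 1) (F i)" "continuous_on (cball 0 1) (F' i)" for i
    unfolding F_def F'_def by (intro continuous_intros cu cw)+
  have dF: "((\<lambda>t. F i (x + t *\<^sub>R axis i 1)) has_real_derivative F' i x) (at 0)" if "x \<in> cball 0 1" for i x
    unfolding F_def F'_def using that
    by (auto intro!: derivative_eq_intros du dw)
  define D where "D = (\<lambda>x. \<Sum>i\<in>UNIV. F' i x)"
  define H where "H = (\<lambda>x. \<Sum>i\<in>UNIV. x $ i * F i x)"
  have cD: "continuous_on (cball 0 1) D" unfolding D_def by (intro continuous_intros cF)
  have cH: "continuous_on (cball 0 1) H" unfolding H_def by (intro continuous_intros cF)
  have eq: "(LINT x|lborel. indicator (ball 0 1) x * ((1 - (x \<bullet> x) ^ Suc n) * D x))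
     = (LINT x|lborel. indicator (ball 0 1) x * (2 * real (Suc n) * (x \<bullet> x) ^ n * H x))" for n
  proof -
    define g' where "g' = (\<lambda>i x. (1 - (x \<bullet> x) ^ Suc n) * F' i x - 2 * real (Suc n) * (x \<bullet> x) ^ n * (x $ i * F i x))"
    have cg': "continuous_on (cball 0 1) (g' i)" for i
      unfolding g'_def by (intro continuous_intros cF)
    have "(LINT x|lborel. indicator (ball 0 1) x * g' i x) = 0" for i
    proof (rule integral_ball_directional_derivative_eq_0[where e="axis i 1" and g="\<lambda>x. (1 - (x \<bullet> x) ^ Suc n) * F i x"])
      show "continuous_on (cball 0 1) (\<lambda>x. (1 - (x \<bullet> x) ^ Suc n) * F i x)"
        by (intro continuous_intros cF)
      show "(1 - (x \<bullet> x) ^ Suc n) * F i x = 0" if "x \<in> sphere 0 1" for x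
        using that by (simp add: dot_square_norm)
      fix x :: R4 assume x: "x \<in> cball 0 1"
      have q: "(x + t *\<^sub>R axis i 1) \<bullet> (x + t *\<^sub>R axis i 1) = x \<bullet> x + 2 * t * x $ i + t * t" for t
        by (simp add: inner_axis inner_axis' algebra_simps inner_commute inner_axis_axis)
      show "((\<lambda>t. (1 - ((x + t *\<^sub>R axis i 1) \<bullet> (x + t *\<^sub>R axis i 1)) ^ Suc n) * F i (x + t *\<^sub>R axis i 1)) has_real_derivative g' i x) (at 0)"
        unfolding q g'_def
        by (rule derivative_eq_intros dF[OF x] refl | simp)+
    qed (use cg' in auto)
    then have "0 = (\<Sum>i\<in>UNIV. LINT x|lborel. indicator (ball 0 1) x * g' i x)" by simp
    also have "\<dots> = (LINT x|lborel. (\<Sum>i\<in>UNIV. indicator (ball 0 1) x * g' i x))"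
      by (rule Bochner_Integration.integral_sum[symmetric]) (rule integrable_ball_continuous[OF cg'])
    also have "\<dots> = (LINT x|lborel. indicator (ball 0 1) x * ((1 - (x \<bullet> x) ^ Suc n) * D x) - indicator (ball 0 1) x * (2 * real (Suc n) * (x \<bullet> x) ^ n * H x))"
      unfolding g'_def D_def H_def
      by (simp add: sum_distrib_left sum_subtractf right_diff_distrib)
    also have "\<dots> = (LINT x|lborel. indicator (ball 0 1) x * ((1 - (x \<bullet> x) ^ Suc n) * D x)) - (LINT x|lborel. indicator (ball 0 1) x * (2 * real (Suc n) * (x \<bullet> x) ^ n * H x))"
      by (intro Bochner_Integration.integral_diff integrable_ball_continuous continuous_intros cD cH)
    finally show ?thesis by simp
  qed
  have "(\<lambda>n. LINT x|lborel. indicator (ball 0 1) x * ((1 - (x \<bullet> x) ^ Suc n) * D x))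
      \<longlonglongrightarrow> (LINT x|lborel. indicator (ball 0 1) x * D x)"
  proof (rule integral_dominated_convergence)
    show "integrable lborel (\<lambda>x. \<bar>indicator (ball 0 1) x * D x\<bar>)"
      by (intro integrable_abs integrable_ball_continuous cD)
    show "(\<lambda>x. indicator (ball 0 1) x * D x) \<in> borel_measurable lborel"
      using integrable_ball_continuous[OF cD] by auto
    show "(\<lambda>x. indicator (ball 0 1) x * ((1 - (x \<bullet> x) ^ Suc n) * D x)) \<in> borel_measurable lborel" for n
      by (intro borel_measurable_integrable integrable_ball_continuous continuous_intros cD)
    have lt: "x \<bullet> x < 1" "0 \<le> x \<bullet> x" if "x \<in> ball 0 1" for x :: R4
      using that by (auto simp: dot_square_norm abs_square_less_1)
    show "AE x in lborel. norm (indicator (ball 0 1) x * ((1 - (x \<bullet> x) ^ Suc n) * D x)) \<le> \<bar>indicator (ball 0 1) x * D x\<bar>" for n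
    proof (rule AE_I2)
      fix x :: R4
      show "norm (indicator (ball 0 1) x * ((1 - (x \<bullet> x) ^ Suc n) * D x)) \<le> \<bar>indicator (ball 0 1) x * D x\<bar>"
      proof (cases "x \<in> ball 0 1")
        case True
        have "(x \<bullet> x) ^ Suc n \<le> 1" using lt[OF True] by (intro power_le_one) auto
        moreover have "0 \<le> (x \<bullet> x) ^ Suc n" using lt[OF True] by (intro zero_le_power)
        ultimately show ?thesis using True by (simp add: abs_mult mult_left_le_one_le del: power_Suc)
      qed simp
    qed
    show "AE x in lborel. (\<lambda>n. indicator (ball 0 1) x * ((1 - (x \<bullet> x) ^ Suc n) * D x)) \<longlonglongrightarrow> indicator (ball 0 1) x * D x"
    proof (rule AE_I2)
      fix x :: R4
      show "(\<lambda>n. indicator (ball 0 1) x * ((1 - (x \<bullet> x) ^ Suc n) * D x)) \<longlonglongrightarrow> indicator (ball 0 1) x * D x"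
      proof (cases "x \<in> ball 0 1")
        case True
        have "(\<lambda>n. (x \<bullet> x) ^ Suc n) \<longlonglongrightarrow> 0"
          using lt[OF True] by (intro LIMSEQ_Suc LIMSEQ_realpow_zero) auto
        then have "(\<lambda>n. indicator (ball 0 1) x * ((1 - (x \<bullet> x) ^ Suc n) * D x)) \<longlonglongrightarrow> indicator (ball 0 1) x * ((1 - 0) * D x)"
          by (intro tendsto_intros)
        then show ?thesis by simp
      qed simp
    qed
  qed
  then have "(LINT x|lborel. indicator (ball 0 1) x * D x) = (LINT x|S3. indicator (sphere 0 1) x * H x)"
    unfolding eq using boundary_limit[OF cH] by (rule LIMSEQ_unique)
  then show ?thesis
    unfolding D_def H_def F_def F'_def
    by (simp add: sum_distrib_left sum_subtractf algebra_simps)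
qed

section \<open>Representation of the boundary values\<close>

lemma DERIV_integral_S3:
  fixes \<phi> \<phi>' :: "real \<Rightarrow> R4 \<Rightarrow> real"
  assumes t0: "a < t0" "t0 < b"
    and int: "\<And>t. a < t \<Longrightarrow> t < b \<Longrightarrow> integrable S3 (\<phi> t)"
    and m': "\<phi>' t0 \<in> borel_measurable S3"
    and der: "\<And>t y. a < t \<Longrightarrow> t < b \<Longrightarrow> ((\<lambda>t. \<phi> t y) has_real_derivative \<phi>' t y) (at t)"
    and bd: "\<And>t y. a < t \<Longrightarrow> t < b \<Longrightarrow> \<bar>\<phi>' t y\<bar> \<le> C"
  shows "((\<lambda>t. LINT y|S3. \<phi> t y) has_real_derivative (LINT y|S3. \<phi>' t0 y)) (at t0)"
  unfolding DERIV_def tendsto_at_iff_sequentially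
proof (intro allI impI, unfold comp_def)
  fix X :: "nat \<Rightarrow> real" assume X: "\<forall>i. X i \<in> UNIV - {0}" "X \<longlonglongrightarrow> 0"
  have "(\<lambda>n. t0 + X n) \<longlonglongrightarrow> t0 + 0" by (intro tendsto_intros X)
  then have "(\<lambda>n. t0 + X n) \<longlonglongrightarrow> t0" by simp
  then have "eventually (\<lambda>n. t0 + X n \<in> {a<..<b}) sequentially"
    by (rule topological_tendstoD) (use t0 in auto)
  then obtain N where N: "\<And>n. n \<ge> N \<Longrightarrow> a < t0 + X n \<and> t0 + X n < b"
    by (auto simp: eventually_sequentially)
  have "(\<lambda>n. LINT y|S3. (\<phi> (t0 + X (n + N)) y - \<phi> t0 y) / X (n + N)) \<longlonglongrightarrow> (LINT y|S3. \<phi>' t0 y)"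
  proof (rule integral_dominated_convergence[where w="\<lambda>_. C"])
    show "(\<lambda>y. (\<phi> (t0 + X (n + N)) y - \<phi> t0 y) / X (n + N)) \<in> borel_measurable S3" for n
      using int[of t0] int[of "t0 + X (n + N)"] N[of "n + N"] t0
      by (intro borel_measurable_divide borel_measurable_diff borel_measurable_integrable) auto
    show "AE y in S3. (\<lambda>n. (\<phi> (t0 + X (n + N)) y - \<phi> t0 y) / X (n + N)) \<longlonglongrightarrow> \<phi>' t0 y"
    proof (rule AE_I2)
      fix y
      have "((\<lambda>h. (\<phi> (t0 + h) y - \<phi> t0 y) / h) \<longlongrightarrow> \<phi>' t0 y) (at 0)"
        using der[OF t0, of y] by (simp add: DERIV_def)
      then have "(\<lambda>n. (\<phi> (t0 + X n) y - \<phi> t0 y) / X n) \<longlonglongrightarrow> \<phi>' t0 y"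
        using X by (auto simp: tendsto_at_iff_sequentially comp_def)
      then show "(\<lambda>n. (\<phi> (t0 + X (n + N)) y - \<phi> t0 y) / X (n + N)) \<longlonglongrightarrow> \<phi>' t0 y"
        by (rule LIMSEQ_ignore_initial_segment)
    qed
    show "AE y in S3. norm ((\<phi> (t0 + X (n + N)) y - \<phi> t0 y) / X (n + N)) \<le> C" for n
    proof (rule AE_I2)
      fix y
      have "norm (\<phi> (t0 + X (n + N)) y - \<phi> t0 y) \<le> C * norm (t0 + X (n + N) - t0)"
        by (rule field_differentiable_bound[where S="{a<..<b}" and f'="\<lambda>t. \<phi>' t y"])
           (use N[of "n + N"] t0 der bd in \<open>auto intro: has_field_derivative_at_within\<close>)
      moreover have "X (n + N) \<noteq> 0" using X by auto
      ultimately show "norm ((\<phi> (t0 + X (n + N)) y - \<phi> t0 y) / X (n + N)) \<le> C"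
        by (simp add: field_simps)
    qed
  qed (use m' in auto)
  moreover have "(LINT y|S3. (\<phi> (t0 + X (n + N)) y - \<phi> t0 y) / X (n + N))
     = ((LINT y|S3. \<phi> (t0 + X (n + N)) y) - (LINT y|S3. \<phi> t0 y)) / X (n + N)" for n
    using int[of t0] int[of "t0 + X (n + N)"] N[of "n + N"] t0
    by (simp add: Bochner_Integration.integral_diff)
  ultimately have "(\<lambda>n. ((LINT y|S3. \<phi> (t0 + X (n + N)) y) - (LINT y|S3. \<phi> t0 y)) / X (n + N)) \<longlonglongrightarrow> (LINT y|S3. \<phi>' t0 y)"
    by (simp only:)
  then show "(\<lambda>n. ((LINT y|S3. \<phi> (t0 + X n) y) - (LINT y|S3. \<phi> t0 y)) / X n) \<longlonglongrightarrow> (LINT y|S3. \<phi>' t0 y)"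
    by (rule LIMSEQ_offset)
qed

text \<open>\<open>sqd x \<tau> y = |x - \<tau> y|\<^sup>2\<close>; its reciprocal is harmonic in \<open>y\<close>, and for \<open>|x| = 1\<close> its pole \<open>x / \<tau>\<close> lies
  outside the closed ball when \<open>\<tau> < 1\<close>.\<close>
definition sqd :: "R4 \<Rightarrow> real \<Rightarrow> R4 \<Rightarrow> real" where
  "sqd x \<tau> y = (x - \<tau> *\<^sub>R y) \<bullet> (x - \<tau> *\<^sub>R y)"

lemma sqd_norm: "sqd x \<tau> y = (norm (x - \<tau> *\<^sub>R y))\<^sup>2"
  by (simp add: sqd_def dot_square_norm)

lemma sqd_expand: "norm x = 1 \<Longrightarrow> sqd x \<tau> y = 1 - 2 * \<tau> * (x \<bullet> y) + \<tau>\<^sup>2 * (y \<bullet> y)"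
  using dot_square_norm[of x]
  by (simp add: sqd_def inner_diff_left inner_diff_right inner_commute power2_eq_square algebra_simps)

lemma norm_pole_ge:
  assumes "norm x = 1" "norm y \<le> 1" "\<bar>\<tau>\<bar> \<le> 1"
  shows "1 - \<bar>\<tau>\<bar> \<le> norm (x - \<tau> *\<^sub>R y)"
proof -
  have "norm x - norm (\<tau> *\<^sub>R y) \<le> norm (x - \<tau> *\<^sub>R y)" by (rule norm_triangle_ineq2)
  moreover have "norm (\<tau> *\<^sub>R y) \<le> \<bar>\<tau>\<bar>" using assms by (simp add: mult_left_le)
  ultimately show ?thesis using assms by simp
qed

text \<open>\<open>x - y\<close> and \<open>x - \<tau> y\<close> differ by a vector of length at
  most \<open>1 - \<tau>\<close>, which \<open>norm_pole_ge\<close> bounds by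
  \<open>|x - \<tau> y|\<close> itself. Powers of \<open>1 / |x - y|\<close> thus dominate the
  kernels uniformly up to \<open>\<tau> = 1\<close>.\<close>

lemma norm_diff_le_pole:
  assumes "norm x = 1" "norm y \<le> 1" "0 \<le> \<tau>" "\<tau> \<le> 1"
  shows "norm (x - y) \<le> 2 * norm (x - \<tau> *\<^sub>R y)"
proof -
  have "x - y = (x - \<tau> *\<^sub>R y) + (- (1 - \<tau>)) *\<^sub>R y" by (simp add: algebra_simps)
  then have "norm (x - y) \<le> norm (x - \<tau> *\<^sub>R y) + norm ((- (1 - \<tau>)) *\<^sub>R y)"
    by (metis norm_triangle_ineq)
  also have "norm ((- (1 - \<tau>)) *\<^sub>R y) \<le> 1 - \<tau>" using assms by (simp add: mult_left_le)
  also have "1 - \<tau> \<le> norm (x - \<tau> *\<^sub>R y)" using norm_pole_ge[of x y \<tau>] assms by simp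
  finally show ?thesis by simp
qed

lemma sqd_ge:
  assumes "norm x = 1" "norm y \<le> 1" "\<bar>\<tau>\<bar> \<le> 1"
  shows "(1 - \<bar>\<tau>\<bar>)\<^sup>2 \<le> sqd x \<tau> y"
  unfolding sqd_norm using norm_pole_ge[OF assms] assms by (intro power_mono) auto

lemma sqd_pos:
  assumes "norm x = 1" "norm y \<le> 1" "\<bar>\<tau>\<bar> < 1"
  shows "0 < sqd x \<tau> y"
proof -
  have "0 < (1 - \<bar>\<tau>\<bar>)\<^sup>2" using assms by simp
  also have "\<dots> \<le> sqd x \<tau> y" using assms by (intro sqd_ge) auto
  finally show ?thesis .
qed

lemma continuous_on_sqd [continuous_intros]: "continuous_on S (sqd x \<tau>)"
  unfolding sqd_def by (intro continuous_intros)

lemma sum_R4_inner: "(\<Sum>i\<in>UNIV. x $ i * y $ i) = x \<bullet> (y :: R4)"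
  by (simp add: inner_vec_def)

section \<open>Green's identity under the Neumann condition\<close>

locale neumann =
  fixes u :: "R4 \<Rightarrow> real"
  assumes smooth: "smooth_closed_ball u"
    and radial: "\<And>x. x \<in> sphere 0 1 \<Longrightarrow> radial_deriv u x = 0"
begin

lemma continuous_pds: "continuous_on (cball 0 1) (pds is u)"
  using smooth unfolding smooth_closed_ball_def smooth_on_def
  by (meson continuous_on_subset)

lemma DERIV_pds: "x \<in> cball 0 1 \<Longrightarrow> ((\<lambda>t. pds is u (x + t *\<^sub>R axis i 1)) has_real_derivative pds (i # is) u x) (at 0)"
  using smooth unfolding smooth_closed_ball_def smooth_on_def by blast

lemma continuous_u: "continuous_on (cball 0 1) u"
  using continuous_pds[of "[]"] by simp

lemma continuous_laplacian: "continuous_on (cball 0 1) (laplacian u)"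
  unfolding laplacian_def by (intro continuous_intros continuous_pds)

lemma neumann_sum: "x \<in> sphere 0 1 \<Longrightarrow> (\<Sum>i\<in>UNIV. x $ i * pds [i] u x) = 0"
  using radial[of x] by (simp add: radial_deriv_def grad_def inner_vec_def mult.commute)

text \<open>Against a harmonic \<open>w\<close> the volume term with \<open>u\<close> drops out, and
  \<open>neumann_sum\<close> removes the boundary term with \<open>w\<close>; what remains pairs the
  Laplacian of \<open>u\<close> with the boundary values of \<open>u\<close>.\<close>

lemma green_neumann:
  assumes cw: "continuous_on (cball 0 1) w" "\<And>i. continuous_on (cball 0 1) (Dw i)" "\<And>i. continuous_on (cball 0 1) (D2w i)"
    and dw: "\<And>i x. x \<in> cball 0 1 \<Longrightarrow> ((\<lambda>t. w (x + t *\<^sub>R axis i 1)) has_real_derivative Dw i x) (at 0)"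
            "\<And>i x. x \<in> cball 0 1 \<Longrightarrow> ((\<lambda>t. Dw i (x + t *\<^sub>R axis i 1)) has_real_derivative D2w i x) (at 0)"
    and harm: "\<And>x. x \<in> cball 0 1 \<Longrightarrow> (\<Sum>i\<in>UNIV. D2w i x) = 0"
  shows "(LINT x|lborel. indicator (ball 0 1) x * (w x * laplacian u x))
     = - (LINT x|S3. indicator (sphere 0 1) x * (u x * (\<Sum>i\<in>UNIV. x $ i * Dw i x)))"
proof -
  have "(LINT x|lborel. indicator (ball 0 1) x * (w x * laplacian u x))
    = (LINT x|lborel. indicator (ball 0 1) x * (w x * (\<Sum>i\<in>UNIV. pds [i, i] u x) - u x * (\<Sum>i\<in>UNIV. D2w i x)))"
    by (intro Bochner_Integration.integral_cong) (auto simp: indicator_def laplacian_def harm)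
  also have "\<dots> = (LINT x|S3. indicator (sphere 0 1) x * (w x * (\<Sum>i\<in>UNIV. x $ i * pds [i] u x) - u x * (\<Sum>i\<in>UNIV. x $ i * Dw i x)))"
    using DERIV_pds[of _ "[]"] DERIV_pds[of _ "[_]"]
    by (intro green_ball continuous_pds continuous_u cw dw) auto
  also have "\<dots> = (LINT x|S3. - (indicator (sphere 0 1) x * (u x * (\<Sum>i\<in>UNIV. x $ i * Dw i x))))"
    using neumann_sum by (intro Bochner_Integration.integral_cong) (auto simp: indicator_def)
  finally show ?thesis by simp
qed

text \<open>The compatibility condition of the Neumann problem, from the test function 1. It allows
  a constant to be subtracted from the kernel in \<open>M'_bound\<close>.\<close>

lemma integral_laplacian: "(LINT x|lborel. indicator (ball 0 1) x * laplacian u x) = 0"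
  using green_neumann[of "\<lambda>_. 1" "\<lambda>_ _. 0" "\<lambda>_ _. 0"] by simp

end

section \<open>The potential with a moving pole\<close>

locale neumann_pole = neumann +
  fixes x :: R4
  assumes x: "norm x = 1"
begin

text \<open>For unit vectors \<open>|x - \<tau> y| = |\<tau> x - y|\<close>, so for
  \<open>|\<tau>| < 1\<close> this is, up to a constant factor, the Newtonian single layer potential
  of \<open>u\<close> at the interior point \<open>\<tau> x\<close>; \<open>M 0\<close> is the
  integral of \<open>u\<close>.\<close>

definition M :: "real \<Rightarrow> real" where
  "M \<tau> = (LINT y|S3. indicator (sphere 0 1) y * (u y / sqd x \<tau> y))"

definition M' :: "real \<Rightarrow> real" where
  "M' \<tau> = (LINT y|S3. indicator (sphere 0 1) y * (u y * (2 * (x \<bullet> y) - 2 * \<tau>) / (sqd x \<tau> y)\<^sup>2))"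

text \<open>The kernel is a function of \<open>\<tau> y\<close>, so its radial derivative in
  \<open>y\<close> on the sphere is \<tau> times its derivative in \<tau>. The surviving boundary
  term of \<open>green_neumann\<close> is therefore \<open>\<tau> * M'\<close>.\<close>

lemma green_pole:
  assumes \<tau>: "\<bar>\<tau>\<bar> < 1"
  shows "(LINT y|lborel. indicator (ball 0 1) y * (laplacian u y / sqd x \<tau> y)) = - \<tau> * M' \<tau>"
proof -
  define N where "N = sqd x \<tau>"
  define DN where "DN = (\<lambda>i y. 2 * \<tau> * (\<tau> * (y :: R4) $ i - x $ i))"
  define w where "w = (\<lambda>y. 1 / N y)"
  define Dw where "Dw = (\<lambda>i y. - DN i y / (N y)\<^sup>2)"
  define D2w where "D2w = (\<lambda>i y. - 2 * \<tau>\<^sup>2 / (N y)\<^sup>2 + 2 * (DN i y)\<^sup>2 / (N y) ^ 3)"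
  have N0: "N y \<noteq> 0" if "y \<in> cball 0 1" for y
    using sqd_pos[OF x _ \<tau>, of y] that by (simp add: N_def)
  have cN: "continuous_on (cball 0 1) N" unfolding N_def by (intro continuous_intros)
  have cDN: "continuous_on (cball 0 1) (DN i)" for i unfolding DN_def by (intro continuous_intros)
  have dN: "((\<lambda>t. N (y + t *\<^sub>R axis i 1)) has_real_derivative DN i y) (at 0)" for i y
  proof -
    have "N (y + t *\<^sub>R axis i 1) = N y + t * DN i y + \<tau>\<^sup>2 * t\<^sup>2" for t
      unfolding N_def DN_def sqd_expand[OF x]
      by (simp add: inner_add_left inner_add_right inner_axis inner_axis' inner_commute power2_eq_square algebra_simps)
    then show ?thesis by (auto intro!: derivative_eq_intros)
  qed
  have dDN: "((\<lambda>t. DN i (y + t *\<^sub>R axis i 1)) has_real_derivative 2 * \<tau>\<^sup>2) (at 0)" for i y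
    unfolding DN_def by (auto intro!: derivative_eq_intros simp: power2_eq_square)
  have "(LINT y|lborel. indicator (ball 0 1) y * (w y * laplacian u y))
     = - (LINT y|S3. indicator (sphere 0 1) y * (u y * (\<Sum>i\<in>UNIV. y $ i * Dw i y)))"
  proof (rule green_neumann)
    show "continuous_on (cball 0 1) w" unfolding w_def
      by (intro continuous_intros cN) (use N0 in auto)
    show "continuous_on (cball 0 1) (Dw i)" for i unfolding Dw_def
      by (intro continuous_intros cN cDN) (use N0 in auto)
    show "continuous_on (cball 0 1) (D2w i)" for i unfolding D2w_def
      by (intro continuous_intros cN cDN) (use N0 in auto)
    fix i y assume y: "y \<in> cball (0::R4) 1"
    show "((\<lambda>t. w (y + t *\<^sub>R axis i 1)) has_real_derivative Dw i y) (at 0)"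
      unfolding w_def Dw_def using N0[OF y]
      by (auto intro!: derivative_eq_intros dN simp: power2_eq_square)
    show "((\<lambda>t. Dw i (y + t *\<^sub>R axis i 1)) has_real_derivative D2w i y) (at 0)"
      unfolding Dw_def D2w_def using N0[OF y]
      by (auto intro!: derivative_eq_intros dN dDN simp: field_simps power2_eq_square power3_eq_cube)
  next
    fix y assume y: "y \<in> cball (0::R4) 1"
    \<comment> \<open>Dimension four enters here: the Laplacian \<open>8 * \<tau>^2\<close> of
      \<open>N\<close> equals \<open>2 * |grad N|^2 / N\<close>, and the two contributions to the
      Laplacian of \<open>1 / N\<close> cancel.\<close>
    have "(\<Sum>i\<in>UNIV. (DN i y)\<^sup>2) = 4 * \<tau>\<^sup>2 * (\<Sum>i\<in>UNIV. (x - \<tau> *\<^sub>R y) $ i * (x - \<tau> *\<^sub>R y) $ i)"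
      unfolding DN_def sum_distrib_left by (intro sum.cong) (auto simp: power2_eq_square algebra_simps)
    also have "\<dots> = 4 * \<tau>\<^sup>2 * N y" by (simp only: sum_R4_inner N_def sqd_def)
    finally have "(\<Sum>i\<in>UNIV. (DN i y)\<^sup>2) = 4 * \<tau>\<^sup>2 * N y" .
    then have "(\<Sum>i\<in>UNIV. D2w i y) = - 8 * \<tau>\<^sup>2 / (N y)\<^sup>2 + 2 * (4 * \<tau>\<^sup>2 * N y) / (N y) ^ 3"
      unfolding D2w_def by (simp add: sum.distrib sum_subtractf sum_divide_distrib[symmetric] sum_distrib_left[symmetric])
    then show "(\<Sum>i\<in>UNIV. D2w i y) = 0"
      using N0[OF y] by (simp add: field_simps power2_eq_square power3_eq_cube)
  qed
  also have "(LINT y|S3. indicator (sphere 0 1) y * (u y * (\<Sum>i\<in>UNIV. y $ i * Dw i y)))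
     = (LINT y|S3. \<tau> * (indicator (sphere 0 1) y * (u y * (2 * (x \<bullet> y) - 2 * \<tau>) / (sqd x \<tau> y)\<^sup>2)))"
  proof (rule Bochner_Integration.integral_cong)
    fix y :: R4
    show "indicator (sphere 0 1) y * (u y * (\<Sum>i\<in>UNIV. y $ i * Dw i y))
      = \<tau> * (indicator (sphere 0 1) y * (u y * (2 * (x \<bullet> y) - 2 * \<tau>) / (sqd x \<tau> y)\<^sup>2))"
    proof (cases "y \<in> sphere 0 1")
      case True
      then have yy: "y \<bullet> y = 1" by (simp add: dot_square_norm)
      have "(\<Sum>i\<in>UNIV. y $ i * Dw i y) = (\<Sum>i\<in>UNIV. (- 2 * \<tau>\<^sup>2 / (N y)\<^sup>2) * (y $ i * y $ i) + (2 * \<tau> / (N y)\<^sup>2) * (x $ i * y $ i))"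
        unfolding Dw_def DN_def
        by (intro sum.cong) (auto simp: add_divide_distrib[symmetric] power2_eq_square algebra_simps diff_divide_distrib)
      also have "\<dots> = (- 2 * \<tau>\<^sup>2 / (N y)\<^sup>2) * (y \<bullet> y) + (2 * \<tau> / (N y)\<^sup>2) * (x \<bullet> y)"
        by (simp only: sum.distrib sum_distrib_left[symmetric] sum_R4_inner)
      also have "\<dots> = \<tau> * (2 * (x \<bullet> y) - 2 * \<tau>) / (N y)\<^sup>2"
        by (simp add: yy add_divide_distrib[symmetric] power2_eq_square algebra_simps diff_divide_distrib)
      finally show ?thesis using True by (simp add: N_def)
    qed simp
  qed simp
  also have "\<dots> = \<tau> * M' \<tau>" unfolding M'_def by (rule integral_mult_right_zero)
  finally show ?thesis by (simp add: w_def N_def)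
qed

lemma sphere_kernel_continuous:
  assumes "\<bar>\<tau>\<bar> < 1"
  shows "continuous_on (sphere 0 1) (\<lambda>y. u y / sqd x \<tau> y)"
    and "continuous_on (sphere 0 1) (\<lambda>y. u y * (2 * (x \<bullet> y) - 2 * \<tau>) / (sqd x \<tau> y)\<^sup>2)"
proof -
  have "continuous_on (sphere 0 1) u" by (rule continuous_on_subset[OF continuous_u]) auto
  moreover have "sqd x \<tau> y \<noteq> 0" if "y \<in> sphere 0 1" for y
    using sqd_pos[OF x _ assms, of y] that by auto
  ultimately show "continuous_on (sphere 0 1) (\<lambda>y. u y / sqd x \<tau> y)"
    and "continuous_on (sphere 0 1) (\<lambda>y. u y * (2 * (x \<bullet> y) - 2 * \<tau>) / (sqd x \<tau> y)\<^sup>2)"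
    by (auto intro!: continuous_intros)
qed

lemma DERIV_M:
  assumes \<tau>: "\<bar>\<tau>\<bar> < 1"
  shows "(M has_real_derivative M' \<tau>) (at \<tau>)"
proof -
  obtain C where C: "C \<ge> 0" "\<And>y. y \<in> cball 0 1 \<Longrightarrow> \<bar>u y\<bar> \<le> C"
    using continuous_on_cball_bound[OF continuous_u] by metis
  \<comment> \<open>Room between \<open>|\<tau>|\<close> and 1 keeps the denominators away from 0,
    which makes the derivative bound uniform near \<tau>.\<close>
  obtain s where s: "\<bar>\<tau>\<bar> < s" "s < 1" using dense[OF \<tau>] by auto
  let ?\<phi> = "\<lambda>t y. indicator (sphere 0 1) y * (u y / sqd x t y)"
  let ?\<phi>' = "\<lambda>t y. indicator (sphere 0 1) y * (u y * (2 * (x \<bullet> y) - 2 * t) / (sqd x t y)\<^sup>2)"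
  have "((\<lambda>t. LINT y|S3. ?\<phi> t y) has_real_derivative (LINT y|S3. ?\<phi>' \<tau> y)) (at \<tau>)"
  proof (rule DERIV_integral_S3[where a="-s" and b=s and C="C * 4 / (1 - s) ^ 4"])
    show "- s < \<tau>" "\<tau> < s" using s by auto
    show "?\<phi>' \<tau> \<in> borel_measurable S3"
      using integral_S3_indicator(3)[OF sphere_kernel_continuous(2)[OF \<tau>]] by simp
    fix t assume t: "- s < t" "t < s"
    then have t1: "\<bar>t\<bar> < 1" using s by auto
    show "integrable S3 (?\<phi> t)"
      using integral_S3_indicator(1)[OF sphere_kernel_continuous(1)[OF t1]] by simp
    fix y
    show "((\<lambda>t. ?\<phi> t y) has_real_derivative ?\<phi>' t y) (at t)"
    proof (cases "y \<in> sphere 0 1")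
      case True
      then have yy: "y \<bullet> y = 1" by (simp add: dot_square_norm)
      have n0: "1 - 2 * t * (x \<bullet> y) + t\<^sup>2 \<noteq> 0"
        using sqd_pos[OF x _ t1, of y] True by (simp add: sqd_expand[OF x] yy)
      show ?thesis unfolding sqd_expand[OF x] using True n0
        by (auto intro!: derivative_eq_intros simp: yy power2_eq_square algebra_simps)
    qed simp
    show "\<bar>?\<phi>' t y\<bar> \<le> C * 4 / (1 - s) ^ 4"
    proof (cases "y \<in> sphere 0 1")
      case True
      have "(1 - s)\<^sup>2 \<le> (1 - \<bar>t\<bar>)\<^sup>2" using t s by (intro power_mono) auto
      also have "\<dots> \<le> sqd x t y" using True t1 by (intro sqd_ge x) auto
      finally have "((1 - s)\<^sup>2)\<^sup>2 \<le> (sqd x t y)\<^sup>2" by (intro power_mono) auto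
      then have q: "(1 - s) ^ 4 \<le> (sqd x t y)\<^sup>2" by simp
      have "\<bar>x \<bullet> y\<bar> \<le> 1" using Cauchy_Schwarz_ineq2[of x y] x True by simp
      then have "\<bar>2 * (x \<bullet> y) - 2 * t\<bar> \<le> 4" using t1 by linarith
      then have "\<bar>u y * (2 * (x \<bullet> y) - 2 * t)\<bar> \<le> C * 4"
        unfolding abs_mult using C(2)[of y] True C(1) by (intro mult_mono) auto
      then have "\<bar>u y * (2 * (x \<bullet> y) - 2 * t)\<bar> / (sqd x t y)\<^sup>2 \<le> C * 4 / (1 - s) ^ 4"
        using q s C(1) by (intro frac_le) auto
      then show ?thesis using True by simp
    qed (use C(1) s in auto)
  qed
  then show ?thesis by (simp add: M_def[abs_def] M'_def)
qed

text \<open>Of the four powers of \<open>|x - \<tau> y|\<close>, one is spent on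
  \<open>1 - \<tau>\<close> and three on \<open>|x - y| / 2\<close>: the cube of
  \<open>1 / |x - y|\<close> is integrable over the ball, the fourth power is not.\<close>

lemma pole_kernel_sq_bound:
  assumes "0 \<le> \<tau>" "\<tau> < 1" "norm y \<le> 1" "y \<noteq> x"
  shows "1 / (sqd x \<tau> y)\<^sup>2 \<le> 8 / (1 - \<tau>) * (1 / norm (y - x) ^ 3)"
proof -
  define d where "d = norm (x - \<tau> *\<^sub>R y)"
  have d1: "1 - \<tau> \<le> d" using norm_pole_ge[of x y \<tau>] x assms by (simp add: d_def)
  have d2: "norm (y - x) / 2 \<le> d" using norm_diff_le_pole[of x y \<tau>] x assms by (simp add: d_def norm_minus_commute)
  have "(1 - \<tau>) * (norm (y - x) / 2) ^ 3 \<le> d * d ^ 3"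
    using d1 d2 assms by (intro mult_mono power_mono) auto
  also have "\<dots> = (sqd x \<tau> y)\<^sup>2" by (simp add: sqd_norm d_def eval_nat_numeral)
  finally have "1 / (sqd x \<tau> y)\<^sup>2 \<le> 1 / ((1 - \<tau>) * (norm (y - x) / 2) ^ 3)"
    using assms sqd_pos[OF x, of y \<tau>] by (intro divide_left_mono mult_pos_pos) auto
  then show ?thesis by (simp add: power_divide)
qed

lemma integral_cube_ball:
  shows "integrable lborel (\<lambda>y. indicator (ball 0 1) y * (1 / norm (y - x) ^ 3))"
    and "(LINT y|lborel. indicator (ball 0 1) y * (1 / norm (y - x) ^ 3)) \<le> 4 * pi\<^sup>2"
proof -
  have "(\<integral>\<^sup>+y. ennreal (indicator (ball 0 1) y * (1 / norm (y - x) ^ 3)) \<partial>lborel)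
    \<le> (\<integral>\<^sup>+y. ennreal (1 / norm (y - x) ^ 3) * indicator (ball x 2) y \<partial>lborel)"
  proof (rule nn_integral_mono)
    fix y
    have "y \<in> ball x 2" if "y \<in> ball 0 1"
      using norm_triangle_ineq4[of x y] x that by (simp add: dist_norm)
    then show "ennreal (indicator (ball 0 1) y * (1 / norm (y - x) ^ 3)) \<le> ennreal (1 / norm (y - x) ^ 3) * indicator (ball x 2) y"
      by (auto simp: indicator_def)
  qed
  also have "\<dots> = ennreal (4 * pi\<^sup>2)" by (subst nn_integral_norm_cube_ball) auto
  finally have le: "(\<integral>\<^sup>+y. ennreal (indicator (ball 0 1) y * (1 / norm (y - x) ^ 3)) \<partial>lborel) \<le> ennreal (4 * pi\<^sup>2)" .
  show i: "integrable lborel (\<lambda>y. indicator (ball 0 1) y * (1 / norm (y - x) ^ 3))"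
  proof (rule integrableI_nonneg)
    show "(\<integral>\<^sup>+y. ennreal (indicator (ball 0 1) y * (1 / norm (y - x) ^ 3)) \<partial>lborel) < \<infinity>"
      using le by (rule order_le_less_trans) simp
    show "AE y in lborel. 0 \<le> indicator (ball 0 1) y * (1 / norm (y - x) ^ 3)" by simp
  qed measurable
  have "ennreal (LINT y|lborel. indicator (ball 0 1) y * (1 / norm (y - x) ^ 3)) = (\<integral>\<^sup>+y. ennreal (indicator (ball 0 1) y * (1 / norm (y - x) ^ 3)) \<partial>lborel)"
    by (rule nn_integral_eq_integral[symmetric, OF i]) auto
  then have "ennreal (LINT y|lborel. indicator (ball 0 1) y * (1 / norm (y - x) ^ 3)) \<le> ennreal (4 * pi\<^sup>2)"
    using le by (simp only:)
  then show "(LINT y|lborel. indicator (ball 0 1) y * (1 / norm (y - x) ^ 3)) \<le> 4 * pi\<^sup>2"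
    by (rule iffD1[OF ennreal_le_iff, rotated]) simp
qed

text \<open>The square norm of the kernel over the ball is of order
  \<open>(1 - \<tau>)^(-1/2)\<close>, a singularity integrable up to \<open>\<tau> = 1\<close>, so
  the total growth of \<open>M\<close> will be \<open>O(b)\<close>. Cauchy-Schwarz is used as a
  weighted arithmetic-geometric inequality, and the positive bound \<open>b\<close> replaces the
  norm of the Laplacian because it occurs in the weight, which is divided by.\<close>

lemma M'_bound:
  assumes \<tau>: "0 < \<tau>" "\<tau> < 1" and b: "0 < b" "(LINT y|lborel. indicator (ball 0 1) y * (laplacian u y)\<^sup>2) \<le> b\<^sup>2"
  shows "\<bar>M' \<tau>\<bar> \<le> 50 * pi\<^sup>2 * b / sqrt (1 - \<tau>)"
proof -
  have \<tau>1: "\<bar>\<tau>\<bar> < 1" using \<tau> by auto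
  have s0: "sqd x \<tau> y > 0" if "y \<in> cball 0 1" for y using sqd_pos[OF x _ \<tau>1] that by auto
  have cq: "continuous_on (cball 0 1) (\<lambda>y. k y / sqd x \<tau> y)" if "continuous_on (cball 0 1) k" for k
    using that s0 by (intro continuous_intros) force+
  \<comment> \<open>This weight makes both halves of the arithmetic-geometric inequality multiples
    of \<open>b / sqrt (1 - \<tau>)\<close>.\<close>
  define l where "l = b * sqrt (1 - \<tau>)"
  have l: "l > 0" using b \<tau> by (simp add: l_def)
  let ?I = "\<lambda>k. LINT y|lborel. indicator (ball 0 1) y * k y"
  \<comment> \<open>Subtracting the vanishing integral of the Laplacian replaces
    \<open>1 / N\<close> by \<open>(1 - N) / N\<close>, at most \<open>3 * \<tau> / N\<close> in
    absolute value. The factor \<tau> gained here cancels the one on the left, so the bound does not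
    degenerate near \<open>\<tau> = 0\<close>.\<close>
  have "- \<tau> * M' \<tau> = ?I (\<lambda>y. laplacian u y / sqd x \<tau> y) - ?I (\<lambda>y. laplacian u y)"
    using green_pole[OF \<tau>1] integral_laplacian by simp
  also have "\<dots> = (LINT y|lborel. indicator (ball 0 1) y * (laplacian u y / sqd x \<tau> y) - indicator (ball 0 1) y * laplacian u y)"
    by (intro Bochner_Integration.integral_diff[symmetric] integrable_ball_continuous cq continuous_laplacian)
  finally have "\<bar>\<tau> * M' \<tau>\<bar> = \<bar>LINT y|lborel. indicator (ball 0 1) y * (laplacian u y / sqd x \<tau> y) - indicator (ball 0 1) y * laplacian u y\<bar>"
    by simp
  also have "\<dots> \<le> (LINT y|lborel. \<bar>indicator (ball 0 1) y * (laplacian u y / sqd x \<tau> y) - indicator (ball 0 1) y * laplacian u y\<bar>)"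
    by (rule integral_abs_bound)
  also have "\<dots> \<le> (LINT y|lborel. (3 * \<tau>) * (4 * l / (1 - \<tau>) * (indicator (ball 0 1) y * (1 / norm (y - x) ^ 3)) + 1 / (2 * l) * (indicator (ball 0 1) y * (laplacian u y)\<^sup>2)))"
  proof (rule integral_mono)
    show "integrable lborel (\<lambda>y. \<bar>indicator (ball 0 1) y * (laplacian u y / sqd x \<tau> y) - indicator (ball 0 1) y * laplacian u y\<bar>)"
      by (intro integrable_abs Bochner_Integration.integrable_diff integrable_ball_continuous cq continuous_laplacian)
    show "integrable lborel (\<lambda>y. (3 * \<tau>) * (4 * l / (1 - \<tau>) * (indicator (ball 0 1) y * (1 / norm (y - x) ^ 3)) + 1 / (2 * l) * (indicator (ball 0 1) y * (laplacian u y)\<^sup>2)))"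
      by (intro integrable_mult_right Bochner_Integration.integrable_add integral_cube_ball integrable_ball_continuous continuous_intros continuous_laplacian)
    fix y :: R4
    show "\<bar>indicator (ball 0 1) y * (laplacian u y / sqd x \<tau> y) - indicator (ball 0 1) y * laplacian u y\<bar>
      \<le> (3 * \<tau>) * (4 * l / (1 - \<tau>) * (indicator (ball 0 1) y * (1 / norm (y - x) ^ 3)) + 1 / (2 * l) * (indicator (ball 0 1) y * (laplacian u y)\<^sup>2))"
    proof (cases "y \<in> ball 0 1")
      case True
      then have y: "norm y \<le> 1" "y \<noteq> x" using x by auto
      define N where "N = sqd x \<tau> y"
      have N: "N > 0" using s0 True by (simp add: N_def)
      have "\<bar>x \<bullet> y\<bar> \<le> 1" using Cauchy_Schwarz_ineq2[of x y] x y by simp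
      moreover have "0 \<le> y \<bullet> y" "y \<bullet> y \<le> 1" using y by (auto simp: dot_square_norm power_le_one)
      then have "0 \<le> \<tau> * (y \<bullet> y)" "\<tau> * (y \<bullet> y) \<le> 1" using \<tau> by (auto intro: mult_le_one)
      ultimately have "\<bar>2 * (x \<bullet> y) - \<tau> * (y \<bullet> y)\<bar> \<le> 3" by linarith
      then have "\<tau> * \<bar>2 * (x \<bullet> y) - \<tau> * (y \<bullet> y)\<bar> \<le> \<tau> * 3" using \<tau> by (intro mult_left_mono) auto
      moreover have "1 - N = \<tau> * (2 * (x \<bullet> y) - \<tau> * (y \<bullet> y))"
        by (simp add: N_def sqd_expand[OF x] power2_eq_square algebra_simps)
      ultimately have 1: "\<bar>1 - N\<bar> \<le> 3 * \<tau>" using \<tau> by (simp add: abs_mult)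
      define g where "g = \<bar>laplacian u y\<bar>"
      have "laplacian u y / N - laplacian u y = laplacian u y * (1 - N) * (1 / N)"
        using N by (simp add: field_simps)
      then have "\<bar>laplacian u y / N - laplacian u y\<bar> = g * \<bar>1 - N\<bar> * (1 / N)"
        using N by (simp add: g_def abs_mult)
      also have "\<dots> \<le> g * (3 * \<tau>) * (1 / N)"
        using N 1 by (intro mult_right_mono mult_left_mono) (auto simp: g_def)
      also have "\<dots> = 3 * \<tau> * (g * (1 / N))" by simp
      also have "\<dots> \<le> 3 * \<tau> * (l / 2 * (1 / N\<^sup>2) + 1 / (2 * l) * g\<^sup>2)"
      proof (rule mult_left_mono)
        have "0 \<le> (l * (1 / N) - g)\<^sup>2 / (2 * l)" using l by simp
        also have "\<dots> = l / 2 * (1 / N\<^sup>2) + 1 / (2 * l) * g\<^sup>2 - g * (1 / N)"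
          using l N by (simp add: field_simps power2_eq_square)
        finally show "g * (1 / N) \<le> l / 2 * (1 / N\<^sup>2) + 1 / (2 * l) * g\<^sup>2" by simp
      qed (use \<tau> in auto)
      also have "\<dots> \<le> 3 * \<tau> * (l / 2 * (8 / (1 - \<tau>) * (1 / norm (y - x) ^ 3)) + 1 / (2 * l) * g\<^sup>2)"
        using pole_kernel_sq_bound[of \<tau> y] y \<tau> l unfolding N_def
        by (intro mult_left_mono add_mono) auto
      finally show ?thesis using True by (simp add: N_def g_def)
    qed simp
  qed
  also have "\<dots> = (3 * \<tau>) * (4 * l / (1 - \<tau>) * (LINT y|lborel. indicator (ball 0 1) y * (1 / norm (y - x) ^ 3)) + 1 / (2 * l) * ?I (\<lambda>y. (laplacian u y)\<^sup>2))"
    unfolding integral_mult_right_zero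
    by (subst Bochner_Integration.integral_add)
       (auto simp only: integral_mult_right_zero intro!: integrable_mult_right integral_cube_ball integrable_ball_continuous continuous_intros continuous_laplacian)
  also have "\<dots> \<le> (3 * \<tau>) * (4 * l / (1 - \<tau>) * (4 * pi\<^sup>2) + 1 / (2 * l) * b\<^sup>2)"
    using \<tau> l b integral_cube_ball(2) by (intro mult_left_mono add_mono) auto
  also have "4 * l / (1 - \<tau>) * (4 * pi\<^sup>2) + 1 / (2 * l) * b\<^sup>2 = (16 * pi\<^sup>2 + 1/2) * b / sqrt (1 - \<tau>)"
  proof -
    define r where "r = sqrt (1 - \<tau>)"
    have r: "r > 0" "l = b * r" "1 - \<tau> = r * r" using \<tau> by (auto simp: r_def l_def)
    define q where "q = b / r"
    have A: "4 * l / (1 - \<tau>) * (4 * pi\<^sup>2) = 16 * pi\<^sup>2 * q" unfolding r(2,3) q_def using r(1) by simp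
    have B: "1 / (2 * l) * b\<^sup>2 = 1 / 2 * q"
      unfolding r(2) q_def using r(1) b by (simp add: power2_eq_square)
    have "(16 * pi\<^sup>2 + 1/2) * b / sqrt (1 - \<tau>) = (16 * pi\<^sup>2 + 1/2) * q"
      by (simp add: q_def r_def)
    then show ?thesis unfolding A B by (simp only: distrib_right)
  qed
  finally have "\<tau> * \<bar>M' \<tau>\<bar> \<le> \<tau> * (3 * ((16 * pi\<^sup>2 + 1/2) * b / sqrt (1 - \<tau>)))"
    using \<tau> by (simp add: abs_mult mult_ac)
  then have "\<bar>M' \<tau>\<bar> \<le> 3 * ((16 * pi\<^sup>2 + 1/2) * b / sqrt (1 - \<tau>))"
    using \<tau> by (simp only: mult_le_cancel_left_pos)
  also have "\<dots> \<le> 50 * pi\<^sup>2 * b / sqrt (1 - \<tau>)"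
  proof -
    have "1 \<le> pi\<^sup>2" using pi_ge_two by (intro one_le_power) linarith
    then have "3 * (16 * pi\<^sup>2 + 1/2) \<le> 50 * pi\<^sup>2" by simp
    then have "3 * (16 * pi\<^sup>2 + 1/2) * (b / sqrt (1 - \<tau>)) \<le> 50 * pi\<^sup>2 * (b / sqrt (1 - \<tau>))"
      using b \<tau> by (intro mult_right_mono) auto
    then show ?thesis by (simp only: mult.assoc times_divide_eq_right)
  qed
  finally show ?thesis .
qed

text \<open>\<open>100 * pi^2 * b * sqrt (1 - t)\<close> has as derivative minus the bound on
  \<open>M'\<close>, so adding it to \<open>M\<close> gives a nonincreasing function.\<close>

lemma M_bound:
  assumes \<tau>: "0 < \<tau>" "\<tau> < 1" and b: "0 < b" "(LINT y|lborel. indicator (ball 0 1) y * (laplacian u y)\<^sup>2) \<le> b\<^sup>2"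
  shows "M \<tau> \<le> M 0 + 100 * pi\<^sup>2 * b"
proof -
  define c where "c = 100 * pi\<^sup>2 * b"
  have c: "c \<ge> 0" using b by (simp add: c_def)
  let ?F = "\<lambda>t. M t + c * sqrt (1 - t)"
  have "?F \<tau> \<le> ?F 0"
  proof (rule DERIV_nonpos_imp_decreasing_open[where f="?F"])
    show "0 \<le> \<tau>" using \<tau> by simp
    fix t assume t: "0 < t" "t < \<tau>"
    then have t1: "0 < t" "t < 1" "\<bar>t\<bar> < 1" using \<tau> by auto
    have "(?F has_real_derivative M' t + c * (- 1 / (2 * sqrt (1 - t)))) (at t)"
      using t1 by (auto intro!: derivative_eq_intros DERIV_M simp: field_simps)
    moreover have "M' t + c * (- 1 / (2 * sqrt (1 - t))) \<le> 0"
    proof -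
      have "c * (- 1 / (2 * sqrt (1 - t))) = - (50 * pi\<^sup>2 * b / sqrt (1 - t))" by (simp add: c_def)
      then show ?thesis using M'_bound[OF t1(1,2) b] by linarith
    qed
    ultimately show "\<exists>y. DERIV ?F t :> y \<and> y \<le> 0" by blast
  next
    have "continuous_on {0..\<tau>} M"
      by (rule DERIV_continuous_on[where D=M'], rule has_field_derivative_at_within, rule DERIV_M) (use \<tau> in auto)
    then show "continuous_on {0..\<tau>} ?F" by (intro continuous_intros)
  qed
  moreover have "0 \<le> c * sqrt (1 - \<tau>)" using c \<tau> by simp
  ultimately have "M \<tau> \<le> M 0 + c" by simp
  then show ?thesis by (simp add: c_def)
qed

text \<open>On \<open>|y| = 1\<close> the \<tau>-derivative of
  \<open>\<tau> / |x - \<tau> y|^2\<close> is \<open>(1 - \<tau>^2) / |x - \<tau> y|^4\<close>,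
  which is \<open>2 * pi^2\<close> times the Poisson kernel of the ball at
  \<open>\<tau> x\<close>.\<close>

lemma M_plus_derivative:
  assumes \<tau>: "\<bar>\<tau>\<bar> < 1"
  shows "M \<tau> + \<tau> * M' \<tau> = (LINT y|S3. indicator (sphere 0 1) y * (u y * ((1 - \<tau>\<^sup>2) / (sqd x \<tau> y)\<^sup>2)))"
proof -
  have "M \<tau> + \<tau> * M' \<tau> = (LINT y|S3. indicator (sphere 0 1) y * (u y / sqd x \<tau> y)
     + \<tau> * (indicator (sphere 0 1) y * (u y * (2 * (x \<bullet> y) - 2 * \<tau>) / (sqd x \<tau> y)\<^sup>2)))"
    unfolding M_def M'_def integral_mult_right_zero[symmetric]
    by (intro Bochner_Integration.integral_add[symmetric] integrable_mult_right integral_S3_indicator sphere_kernel_continuous \<tau>)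
  also have "\<dots> = (LINT y|S3. indicator (sphere 0 1) y * (u y * ((1 - \<tau>\<^sup>2) / (sqd x \<tau> y)\<^sup>2)))"
  proof (rule Bochner_Integration.integral_cong)
    fix y :: R4
    show "indicator (sphere 0 1) y * (u y / sqd x \<tau> y)
        + \<tau> * (indicator (sphere 0 1) y * (u y * (2 * (x \<bullet> y) - 2 * \<tau>) / (sqd x \<tau> y)\<^sup>2))
      = indicator (sphere 0 1) y * (u y * ((1 - \<tau>\<^sup>2) / (sqd x \<tau> y)\<^sup>2))"
    proof (cases "y \<in> sphere 0 1")
      case True
      then have yy: "y \<bullet> y = 1" by (simp add: dot_square_norm)
      define N where "N = sqd x \<tau> y"
      have N0: "N \<noteq> 0" using sqd_pos[OF x _ \<tau>, of y] True by (simp add: N_def)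
      have "N + \<tau> * (2 * (x \<bullet> y) - 2 * \<tau>) = 1 - \<tau>\<^sup>2"
        by (simp add: N_def sqd_expand[OF x] yy power2_eq_square algebra_simps)
      moreover have "u y / N + \<tau> * (u y * (2 * (x \<bullet> y) - 2 * \<tau>) / N\<^sup>2) = u y * ((N + \<tau> * (2 * (x \<bullet> y) - 2 * \<tau>)) / N\<^sup>2)"
        using N0 by (simp add: field_simps power2_eq_square)
      ultimately show ?thesis using True by (simp add: N_def)
    qed simp
  qed simp
  finally show ?thesis .
qed

end

section \<open>The mass of the Poisson kernel\<close>

lemma pds_one: "pds is (\<lambda>_. 1) = (\<lambda>_. if is = [] then 1 else 0)"
  by (induction "is") (auto simp: pd_def)

lemma neumann_one: "neumann (\<lambda>_. 1)"
proof
  show "smooth_closed_ball (\<lambda>_. 1)"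
    unfolding smooth_closed_ball_def smooth_on_def pds_one
    by (intro exI[of _ UNIV]) auto
  show "radial_deriv (\<lambda>_. 1) x = 0" for x
    by (simp add: radial_deriv_def grad_def pd_def inner_vec_def)
qed

text \<open>The function 1 satisfies the Neumann condition and has zero Laplacian, so its
  \<open>M'\<close> vanishes by \<open>green_pole\<close> and its \<open>M\<close> keeps the value
  at 0, the area of the sphere. This replaces an explicit integration of the kernel.\<close>

lemma poisson_total:
  assumes x: "norm x = 1" and \<tau>: "0 < \<tau>" "\<tau> < 1"
  shows "(LINT y|S3. indicator (sphere 0 1) y * ((1 - \<tau>\<^sup>2) / (sqd x \<tau> y)\<^sup>2)) = 2 * pi\<^sup>2"
proof -
  interpret one: neumann "\<lambda>_. 1" by (rule neumann_one)
  interpret one: neumann_pole "\<lambda>_. 1" x by unfold_locales (rule x)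
  have lap: "laplacian (\<lambda>_. 1) = (\<lambda>_. 0)" by (simp add: laplacian_def pds_one fun_eq_iff del: pds.simps)
  have M'0: "one.M' t = 0" if "0 < t" "t < 1" for t
    using one.green_pole[of t] that by (simp add: lap)
  have "one.M \<tau> = one.M 0"
  proof (rule DERIV_isconst_end[where f=one.M])
    show "continuous_on {0..\<tau>} one.M"
      by (rule DERIV_continuous_on[where D=one.M'], rule has_field_derivative_at_within, rule one.DERIV_M) (use \<tau> in auto)
    show "(one.M has_real_derivative 0) (at t)" if "0 < t" "t < \<tau>" for t
      using one.DERIV_M[of t] M'0[of t] that \<tau> by simp
  qed (use \<tau> in auto)
  also have "\<dots> = (LINT y|S3. 1)"
    unfolding one.M_def
    by (rule integral_cong_AE) (use AE_S3 in \<open>auto simp: sqd_def x dot_square_norm elim!: eventually_mono\<close>)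
  also have "\<dots> = 2 * pi\<^sup>2" by (simp add: measure_S3_UNIV)
  finally show ?thesis using one.M_plus_derivative[of \<tau>] M'0[of \<tau>] \<tau> by simp
qed

section \<open>Passage to the boundary\<close>

context neumann_pole
begin

text \<open>The Poisson kernel is an approximate identity: within \<delta> of \<open>x\<close> the
  values of \<open>u\<close> exceed \<open>u x - \<eta>\<close>, and farther away the kernel is at
  most \<open>16 * (1 - \<tau>^2) / \<delta>^4\<close>. The bound is one-sided because
  \<open>u x\<close> is to be estimated from above.\<close>

lemma poisson_lower_bound:
  assumes "\<eta> > 0"
  obtains K where "\<And>\<tau>. 0 < \<tau> \<Longrightarrow> \<tau> < 1 \<Longrightarrow> 2 * pi\<^sup>2 * (u x - \<eta>) - K * (1 - \<tau>\<^sup>2) \<le> M \<tau> + \<tau> * M' \<tau>"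
proof -
  obtain C where C: "C \<ge> 0" "\<And>y. y \<in> cball 0 1 \<Longrightarrow> \<bar>u y\<bar> \<le> C"
    using continuous_on_cball_bound[OF continuous_u] by metis
  obtain \<delta> where \<delta>: "\<delta> > 0" "\<And>y. y \<in> cball 0 1 \<Longrightarrow> dist y x < \<delta> \<Longrightarrow> dist (u y) (u x) < \<eta>"
    using continuous_u x assms unfolding continuous_on_iff by (metis mem_cball_0 order_refl)
  define K where "K = 2 * C * (16 / \<delta> ^ 4)"
  have K: "K \<ge> 0" using C by (simp add: K_def)
  have "2 * pi\<^sup>2 * (u x - \<eta>) - (K * (2 * pi\<^sup>2)) * (1 - \<tau>\<^sup>2) \<le> M \<tau> + \<tau> * M' \<tau>" if \<tau>: "0 < \<tau>" "\<tau> < 1" for \<tau>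
  proof -
    have \<tau>1: "\<bar>\<tau>\<bar> < 1" using \<tau> by simp
    have t2: "0 \<le> 1 - \<tau>\<^sup>2" using \<tau> by (simp add: power_le_one)
    let ?P = "\<lambda>y. (1 - \<tau>\<^sup>2) / (sqd x \<tau> y)\<^sup>2"
    have s0: "sqd x \<tau> y \<noteq> 0" if "y \<in> sphere 0 1" for y using sqd_pos[OF x _ \<tau>1, of y] that by auto
    have cu: "continuous_on (sphere 0 1) u" by (rule continuous_on_subset[OF continuous_u]) auto
    have cP: "continuous_on (sphere 0 1) ?P" by (intro continuous_intros) (use s0 in auto)
    have "2 * pi\<^sup>2 * (u x - \<eta>) - (K * (2 * pi\<^sup>2)) * (1 - \<tau>\<^sup>2)
      = (LINT y|S3. (u x - \<eta>) * (indicator (sphere 0 1) y * ?P y)) - (LINT y|S3. K * (1 - \<tau>\<^sup>2))"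
      unfolding integral_mult_right_zero poisson_total[OF x \<tau>] by (simp add: measure_S3_UNIV)
    also have "\<dots> = (LINT y|S3. (u x - \<eta>) * (indicator (sphere 0 1) y * ?P y) - K * (1 - \<tau>\<^sup>2))"
      by (intro Bochner_Integration.integral_diff[symmetric] integrable_mult_right integral_S3_indicator cP S3.integrable_const)
    also have "\<dots> \<le> (LINT y|S3. indicator (sphere 0 1) y * (u y * ?P y))"
    proof (rule integral_mono)
      show "integrable S3 (\<lambda>y. (u x - \<eta>) * (indicator (sphere 0 1) y * ?P y) - K * (1 - \<tau>\<^sup>2))"
        by (intro Bochner_Integration.integrable_diff integrable_mult_right integral_S3_indicator cP S3.integrable_const)
      show "integrable S3 (\<lambda>y. indicator (sphere 0 1) y * (u y * ?P y))"
        by (intro integral_S3_indicator continuous_on_mult cP cu)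
      fix y :: R4
      show "(u x - \<eta>) * (indicator (sphere 0 1) y * ?P y) - K * (1 - \<tau>\<^sup>2) \<le> indicator (sphere 0 1) y * (u y * ?P y)"
      proof (cases "y \<in> sphere 0 1")
        case True
        have P0: "?P y \<ge> 0" using t2 by simp
        have "(u x - \<eta>) * ?P y - K * (1 - \<tau>\<^sup>2) \<le> u y * ?P y"
        proof (cases "dist y x < \<delta>")
          case True
          then have "\<bar>u y - u x\<bar> < \<eta>" using \<delta>(2)[of y] \<open>y \<in> sphere 0 1\<close> by (simp add: dist_real_def)
          then have "(u x - \<eta>) * ?P y \<le> u y * ?P y" using P0 by (intro mult_right_mono) auto
          moreover have "0 \<le> K * (1 - \<tau>\<^sup>2)" using K t2 by simp
          ultimately show ?thesis by linarith
        next
          case False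
          then have "\<delta> \<le> norm (x - y)" by (simp add: dist_norm norm_minus_commute)
          also have "\<dots> \<le> 2 * norm (x - \<tau> *\<^sub>R y)" using \<tau> \<open>y \<in> sphere 0 1\<close> by (intro norm_diff_le_pole x) auto
          finally have "(\<delta> / 2) ^ 4 \<le> norm (x - \<tau> *\<^sub>R y) ^ 4" using \<delta> by (intro power_mono) auto
          also have "\<dots> = (sqd x \<tau> y)\<^sup>2" by (simp add: sqd_norm)
          finally have "?P y \<le> (1 - \<tau>\<^sup>2) / (\<delta> / 2) ^ 4"
            using t2 \<delta> by (intro divide_left_mono mult_pos_pos) (use s0[OF \<open>y \<in> sphere 0 1\<close>] in auto)
          then have "2 * C * ?P y \<le> 2 * C * ((1 - \<tau>\<^sup>2) / (\<delta> / 2) ^ 4)"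
            using C by (intro mult_left_mono) auto
          also have "\<dots> = K * (1 - \<tau>\<^sup>2)" by (simp add: K_def power_divide)
          finally have q: "2 * C * ?P y \<le> K * (1 - \<tau>\<^sup>2)" .
          have "u x - \<eta> - 2 * C \<le> u y" using C(2)[of x] C(2)[of y] x \<open>y \<in> sphere 0 1\<close> assms by auto
          then have "(u x - \<eta> - 2 * C) * ?P y \<le> u y * ?P y" using P0 by (intro mult_right_mono)
          then show ?thesis using q unfolding left_diff_distrib by linarith
        qed
        then show ?thesis using True by simp
      qed (use K t2 in simp)
    qed
    also have "\<dots> = M \<tau> + \<tau> * M' \<tau>" using M_plus_derivative[OF \<tau>1] by simp
    finally show ?thesis .
  qed
  then show ?thesis by (rule that)
qed

text \<open>By \<open>norm_diff_le_pole\<close> every kernel is dominated by a multiple of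
  \<open>1 / |x - y|^3\<close>; raising the power from 2 to 3 is allowed because
  \<open>|x - y| / 2 \<le> 1\<close>, and \<open>integral_cube_ball\<close> supplies the
  integrability.\<close>

lemma integrable_riesz:
  "integrable lborel (\<lambda>y. indicator (ball 0 1) y * (\<bar>laplacian u y\<bar> / norm (y - x) ^ 2))"
  and riesz_limit: "(\<lambda>n. LINT y|lborel. indicator (ball 0 1) y * (\<bar>laplacian u y\<bar> / sqd x (1 - 1 / (real n + 2)) y))
    \<longlonglongrightarrow> (LINT y|lborel. indicator (ball 0 1) y * (\<bar>laplacian u y\<bar> / norm (y - x) ^ 2))"
proof -
  obtain C where C: "C \<ge> 0" "\<And>y. y \<in> cball 0 1 \<Longrightarrow> \<bar>laplacian u y\<bar> \<le> C"
    using continuous_on_cball_bound[OF continuous_laplacian] by metis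
  define t where "t = (\<lambda>n::nat. 1 - 1 / (real n + 2))"
  have t: "0 \<le> t n" "t n < 1" for n by (auto simp: t_def field_simps)
  have t1: "t \<longlonglongrightarrow> 1" unfolding t_def by real_asymp
  let ?k = "\<lambda>y. indicator (ball 0 1) y * (\<bar>laplacian u y\<bar> / norm (y - x) ^ 2)"
  let ?f = "\<lambda>n y. indicator (ball 0 1) y * (\<bar>laplacian u y\<bar> / sqd x (t n) y)"
  let ?w = "\<lambda>y. 8 * C * (indicator (ball 0 1) y * (1 / norm (y - x) ^ 3))"
  have fi: "integrable lborel (?f n)" for n
    using sqd_pos[OF x, of _ "t n"] t[of n]
    by (intro integrable_ball_continuous continuous_intros continuous_laplacian) force+
  have km: "?k \<in> borel_measurable lborel"
  proof -
    have m: "(\<lambda>y. indicator (ball 0 1) y * \<bar>laplacian u y\<bar>) \<in> borel_measurable lborel"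
      by (intro borel_measurable_integrable integrable_ball_continuous continuous_intros continuous_laplacian)
    have "(\<lambda>y. (indicator (ball 0 1) y * \<bar>laplacian u y\<bar>) / norm (y - x) ^ 2) \<in> borel_measurable lborel"
      by (intro borel_measurable_divide m) measurable
    then show ?thesis by simp
  qed
  have wi: "integrable lborel ?w" by (intro integrable_mult_right integral_cube_ball)
  have lim: "(\<lambda>n. ?f n y) \<longlonglongrightarrow> ?k y" for y
  proof (cases "y \<in> ball 0 1")
    case True
    then have "norm (y - x) \<noteq> 0" using x by auto
    moreover have "(\<lambda>n. sqd x (t n) y) \<longlonglongrightarrow> sqd x 1 y"
      unfolding sqd_def by (intro tendsto_intros t1)
    moreover have "sqd x 1 y = norm (y - x) ^ 2" by (simp add: sqd_norm norm_minus_commute)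
    ultimately show ?thesis by (intro tendsto_intros) auto
  qed simp
  have bd: "norm (?f n y) \<le> ?w y" for n y
  proof (cases "y \<in> ball 0 1")
    case True
    define d where "d = norm (x - t n *\<^sub>R y)"
    have y: "norm y \<le> 1" "y \<noteq> x" using True x by auto
    have d2: "norm (y - x) / 2 \<le> d" using norm_diff_le_pole[OF x y(1), of "t n"] t[of n] by (simp add: d_def norm_minus_commute)
    have le2: "norm (y - x) / 2 \<le> 1" using norm_triangle_ineq4[of y x] x y by simp
    have "(norm (y - x) / 2) ^ 3 = (norm (y - x) / 2) * (norm (y - x) / 2)\<^sup>2" by (simp add: eval_nat_numeral)
    also have "\<dots> \<le> 1 * (norm (y - x) / 2)\<^sup>2" using le2 by (intro mult_right_mono) auto
    also have "\<dots> \<le> d\<^sup>2" using d2 by (simp add: power_mono)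
    finally have q: "(norm (y - x) / 2) ^ 3 \<le> sqd x (t n) y" by (simp add: sqd_norm d_def)
    have "\<bar>laplacian u y\<bar> / sqd x (t n) y \<le> C / (norm (y - x) / 2) ^ 3"
      using C(2)[of y] y q C(1) by (intro frac_le) auto
    then show ?thesis using True sqd_pos[OF x y(1), of "t n"] t[of n] by (simp add: power_divide mult.commute)
  qed simp
  show "integrable lborel ?k"
    by (rule integrable_dominated_convergence[where s="?f" and w="?w"])
       (use km wi lim bd fi in \<open>auto intro: borel_measurable_integrable\<close>)
  have "(\<lambda>n. LINT y|lborel. ?f n y) \<longlonglongrightarrow> (LINT y|lborel. ?k y)"
    by (rule integral_dominated_convergence[where w="?w"])
       (use km wi lim bd fi in \<open>auto intro: borel_measurable_integrable\<close>)
  then show "(\<lambda>n. LINT y|lborel. indicator (ball 0 1) y * (\<bar>laplacian u y\<bar> / sqd x (1 - 1 / (real n + 2)) y)) \<longlonglongrightarrow> (LINT y|lborel. ?k y)"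
    by (simp add: t_def)
qed

lemma representation:
  assumes b: "0 < b" "(LINT y|lborel. indicator (ball 0 1) y * (laplacian u y)\<^sup>2) \<le> b\<^sup>2"
  shows "2 * pi\<^sup>2 * u x \<le> sphere_integral u + 100 * pi\<^sup>2 * b
    + (LINT y|lborel. indicator (ball 0 1) y * (\<bar>laplacian u y\<bar> / norm (y - x) ^ 2))" (is "_ \<le> _ + _ + ?I")
proof -
  have cu: "continuous_on (sphere 0 1) u" by (rule continuous_on_subset[OF continuous_u]) auto
  have M0: "M 0 = sphere_integral u"
    by (simp add: M_def integral_S3_indicator(2)[OF cu] sqd_def x dot_square_norm)
  have "2 * pi\<^sup>2 * (u x - \<eta>) \<le> M 0 + 100 * pi\<^sup>2 * b + ?I" if \<eta>: "\<eta> > 0" for \<eta>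
  proof -
    obtain K where K: "\<And>\<tau>. 0 < \<tau> \<Longrightarrow> \<tau> < 1 \<Longrightarrow> 2 * pi\<^sup>2 * (u x - \<eta>) - K * (1 - \<tau>\<^sup>2) \<le> M \<tau> + \<tau> * M' \<tau>"
      using poisson_lower_bound[OF \<eta>] by metis
    \<comment> \<open>The shift by 2 keeps the parameter positive already at \<open>n = 0\<close>,
      as \<open>M_bound\<close> demands.\<close>
    define t where "t = (\<lambda>n::nat. 1 - 1 / (real n + 2))"
    have t: "0 < t n" "t n < 1" for n by (auto simp: t_def field_simps)
    let ?J = "\<lambda>n. LINT y|lborel. indicator (ball 0 1) y * (\<bar>laplacian u y\<bar> / sqd x (t n) y)"
    have le: "2 * pi\<^sup>2 * (u x - \<eta>) - K * (1 - (t n)\<^sup>2) \<le> M 0 + 100 * pi\<^sup>2 * b + ?J n" for n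
    proof -
      have t1: "\<bar>t n\<bar> < 1" using t[of n] by simp
      have "t n * M' (t n) = - (LINT y|lborel. indicator (ball 0 1) y * (laplacian u y / sqd x (t n) y))"
        using green_pole[OF t1] by simp
      also have "\<dots> \<le> \<bar>LINT y|lborel. indicator (ball 0 1) y * (laplacian u y / sqd x (t n) y)\<bar>" by simp
      also have "\<dots> \<le> (LINT y|lborel. \<bar>indicator (ball 0 1) y * (laplacian u y / sqd x (t n) y)\<bar>)"
        by (rule integral_abs_bound)
      also have "\<dots> = ?J n"
        by (intro Bochner_Integration.integral_cong) (auto simp: abs_mult abs_divide sqd_norm indicator_def)
      finally show ?thesis using K[OF t, of n] M_bound[OF t b, of n] by simp
    qed
    have "(\<lambda>n. 2 * pi\<^sup>2 * (u x - \<eta>) - K * (1 - (t n)\<^sup>2)) \<longlonglongrightarrow> 2 * pi\<^sup>2 * (u x - \<eta>)"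
      unfolding t_def by real_asymp
    moreover have "(\<lambda>n. M 0 + 100 * pi\<^sup>2 * b + ?J n) \<longlonglongrightarrow> M 0 + 100 * pi\<^sup>2 * b + ?I"
      unfolding t_def by (intro tendsto_intros riesz_limit)
    ultimately show ?thesis by (rule LIMSEQ_le) (use le in auto)
  qed
  note * = this
  have "2 * pi\<^sup>2 * u x \<le> (M 0 + 100 * pi\<^sup>2 * b + ?I) + e" if "e > 0" for e
    using *[of "e / (2 * pi\<^sup>2)"] that by (simp add: right_diff_distrib)
  then have "2 * pi\<^sup>2 * u x \<le> M 0 + 100 * pi\<^sup>2 * b + ?I" by (rule field_le_epsilon)
  then show ?thesis by (simp add: M0)
qed

end

section \<open>Level sets and exponential integrals\<close>

interpretation S3_lborel: pair_sigma_finite S3 "lborel :: R4 measure" ..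

text \<open>For fixed \<open>y\<close> the variable \<open>x\<close> runs over a three-dimensional
  sphere, where \<open>1 / |x - y|\<close> has integral \<open>O(\<rho>^2)\<close> uniformly in
  \<open>y\<close>. A near-field term that has no pointwise bound is thereby controlled on
  average.\<close>

lemma nn_integral_S3_potential:
  fixes g :: "R4 \<Rightarrow> real"
  assumes [measurable]: "g \<in> borel_measurable borel" and \<rho>: "0 < \<rho>"
  shows "(\<integral>\<^sup>+x. (\<integral>\<^sup>+y. ennreal (g y) * (ennreal (1 / norm (x - y)) * indicator {..<\<rho>} (dist y x)) \<partial>lborel) \<partial>S3)
     \<le> ennreal (2048 * pi\<^sup>2 * \<rho>\<^sup>2) * (\<integral>\<^sup>+y. ennreal (g y) \<partial>lborel)"
proof -
  have "(\<integral>\<^sup>+x. (\<integral>\<^sup>+y. ennreal (g y) * (ennreal (1 / norm (x - y)) * indicator {..<\<rho>} (dist y x)) \<partial>lborel) \<partial>S3)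
    = (\<integral>\<^sup>+y. (\<integral>\<^sup>+x. ennreal (g y) * (ennreal (1 / norm (x - y)) * indicator {..<\<rho>} (dist y x)) \<partial>S3) \<partial>lborel)"
    by (rule S3_lborel.Fubini'[symmetric]) measurable
  also have "\<dots> \<le> (\<integral>\<^sup>+y. ennreal (2048 * pi\<^sup>2 * \<rho>\<^sup>2) * ennreal (g y) \<partial>lborel)"
  proof (rule nn_integral_mono)
    fix y :: R4
    have "(\<integral>\<^sup>+x. ennreal (g y) * (ennreal (1 / norm (x - y)) * indicator {..<\<rho>} (dist y x)) \<partial>S3)
      = ennreal (g y) * (\<integral>\<^sup>+x. ennreal (1 / norm (x - y)) * indicator {..<\<rho>} (dist y x) \<partial>S3)"
      by (rule nn_integral_cmult) measurable
    also have "(\<integral>\<^sup>+x. ennreal (1 / norm (x - y)) * indicator {..<\<rho>} (dist y x) \<partial>S3)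
      = (\<integral>\<^sup>+x. ennreal (1 / norm (x - y)) * indicator (ball y \<rho>) x \<partial>S3)"
      by (intro nn_integral_cong) (auto simp: indicator_def)
    also have "ennreal (g y) * \<dots> \<le> ennreal (g y) * ennreal (2048 * pi\<^sup>2 * \<rho>\<^sup>2)"
      by (intro mult_left_mono nn_integral_S3_inverse_norm_ball \<rho>) auto
    finally show "(\<integral>\<^sup>+x. ennreal (g y) * (ennreal (1 / norm (x - y)) * indicator {..<\<rho>} (dist y x)) \<partial>S3)
      \<le> ennreal (2048 * pi\<^sup>2 * \<rho>\<^sup>2) * ennreal (g y)" by (simp add: mult.commute)
  qed
  also have "\<dots> = ennreal (2048 * pi\<^sup>2 * \<rho>\<^sup>2) * (\<integral>\<^sup>+y. ennreal (g y) \<partial>lborel)"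
    by (rule nn_integral_cmult) measurable
  finally show ?thesis .
qed

text \<open>Beyond distance \<rho> the whole kernel is paired against \<open>g\<close>, which yields
  the logarithm. Within \<rho> it is factored as \<open>|x - y|^(-3/2)\<close> times
  \<open>|x - y|^(-1/2)\<close>: the square of the first factor is integrable in \<open>y\<close>,
  while the square of the second stays with \<open>g^2\<close> until it is integrated in
  \<open>x\<close>. The weights \<open>l\<close> and \<open>k\<close> of the two
  arithmetic-geometric inequalities are left free for \<open>level_set_bound\<close>.\<close>

lemma riesz_split:
  fixes g :: "R4 \<Rightarrow> real"
  assumes gm [measurable]: "g \<in> borel_measurable borel" and g0: "\<And>y. g y \<ge> 0" and gB: "\<And>y. y \<notin> ball 0 1 \<Longrightarrow> g y = 0"
    and b: "(\<integral>\<^sup>+y. ennreal ((g y)\<^sup>2) \<partial>lborel) \<le> ennreal (b\<^sup>2)"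
    and x: "norm x = 1" and r: "r \<le> 1" and \<rho>: "0 < \<rho>" and l: "0 < l" and k: "0 < k"
  shows "(\<integral>\<^sup>+y. ennreal (g y / norm (y - x) ^ 2) * indicator (ball x r) y \<partial>lborel)
    \<le> ennreal ((l * pi\<^sup>2 * ln (max 1 \<rho> / \<rho>) + b\<^sup>2 / l) / 2 + k * pi\<^sup>2 * \<rho>)
      + ennreal (1 / (2 * k)) * (\<integral>\<^sup>+y. ennreal ((g y)\<^sup>2) * (ennreal (1 / norm (x - y)) * indicator {..<\<rho>} (dist y x)) \<partial>lborel)"
proof -
  \<comment> \<open>\<rho> may exceed 1, since the sphere has area \<open>2 * pi^2\<close>. The
    outer region is then empty, as \<open>r \<le> 1\<close>, and the logarithm is 0.\<close>
  define R where "R = max 1 \<rho>"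
  have R: "\<rho> \<le> R" "1 \<le> R" by (auto simp: R_def)
  let ?a = "\<lambda>y. ennreal (l / 2) * (indicator (ball 0 1) y * (ennreal (1 / norm (y - x) ^ 4) * indicator {\<rho>..R} (norm (y - x))))"
  let ?b = "\<lambda>y. ennreal (1 / (2 * l)) * ennreal ((g y)\<^sup>2)"
  let ?c = "\<lambda>y. ennreal (k / 2) * (ennreal (1 / norm (y - x) ^ 3) * indicator (ball x \<rho>) y)"
  let ?d = "\<lambda>y. ennreal (1 / (2 * k)) * (ennreal ((g y)\<^sup>2) * (ennreal (1 / norm (x - y)) * indicator {..<\<rho>} (dist y x)))"
  have amgm: "p * q \<le> s / 2 * p\<^sup>2 + 1 / (2 * s) * q\<^sup>2" if "s > 0" for p q s :: real
  proof -
    have "0 \<le> (s * p - q)\<^sup>2 / (2 * s)" using that by simp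
    also have "\<dots> = s / 2 * p\<^sup>2 + 1 / (2 * s) * q\<^sup>2 - p * q"
      using that by (simp add: field_simps power2_eq_square)
    finally show ?thesis by simp
  qed
  have "(\<integral>\<^sup>+y. ennreal (g y / norm (y - x) ^ 2) * indicator (ball x r) y \<partial>lborel) \<le> (\<integral>\<^sup>+y. ?a y + ?b y + (?c y + ?d y) \<partial>lborel)"
  proof (rule nn_integral_mono)
    fix y :: R4
    define n where "n = norm (y - x)"
    consider "y \<notin> ball x r \<or> y \<notin> ball 0 1" | "y \<in> ball x r" "y \<in> ball 0 1" "n < \<rho>" | "y \<in> ball x r" "y \<in> ball 0 1" "n \<ge> \<rho>" by linarith
    then show "ennreal (g y / norm (y - x) ^ 2) * indicator (ball x r) y \<le> ?a y + ?b y + (?c y + ?d y)"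
    proof cases
      case 1
      then show ?thesis using gB[of y] by auto
    next
      case 2
      have n0: "n > 0" using 2 x by (auto simp: n_def)
      have s: "sqrt (1 / n ^ 3) * (g y * sqrt (1 / n)) = g y / n ^ 2"
      proof -
        have "sqrt (1 / n ^ 3) * sqrt (1 / n) = sqrt ((1 / n ^ 2)\<^sup>2)"
          by (subst real_sqrt_mult[symmetric]) (simp add: eval_nat_numeral)
        also have "\<dots> = 1 / n ^ 2" by simp
        finally show ?thesis by (metis mult.left_commute times_divide_eq_right mult.right_neutral)
      qed
      have "g y / n ^ 2 \<le> k / 2 * (sqrt (1 / n ^ 3))\<^sup>2 + 1 / (2 * k) * (g y * sqrt (1 / n))\<^sup>2"
        using amgm[OF k, of "sqrt (1 / n ^ 3)" "g y * sqrt (1 / n)"] by (simp only: s)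
      also have "\<dots> = k / 2 * (1 / n ^ 3) + 1 / (2 * k) * ((g y)\<^sup>2 * (1 / n))"
        using n0 by (simp add: power_mult_distrib)
      finally have "ennreal (g y / n ^ 2) \<le> ennreal (k / 2 * (1 / n ^ 3) + 1 / (2 * k) * ((g y)\<^sup>2 * (1 / n)))"
        by (rule ennreal_leI)
      also have "\<dots> = ennreal (k / 2) * ennreal (1 / n ^ 3) + ennreal (1 / (2 * k)) * (ennreal ((g y)\<^sup>2) * ennreal (1 / n))"
        using k n0 by (subst ennreal_plus) (auto simp flip: ennreal_mult)
      also have "\<dots> = ?c y + ?d y"
        using 2 by (simp add: n_def dist_norm norm_minus_commute)
      also have "\<dots> \<le> ?a y + ?b y + (?c y + ?d y)" by simp
      finally show ?thesis using 2 by (simp add: n_def)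
    next
      case 3
      have n0: "n > 0" using 3 x by (auto simp: n_def)
      have nR: "n \<le> R" using 3 r R by (auto simp: n_def dist_norm norm_minus_commute)
      have "g y / n ^ 2 = (1 / n ^ 2) * g y" by simp
      also have "\<dots> \<le> l / 2 * (1 / n ^ 2)\<^sup>2 + 1 / (2 * l) * (g y)\<^sup>2" by (rule amgm[OF l])
      also have "(1 / n ^ 2)\<^sup>2 = 1 / n ^ 4" by (simp add: power_divide)
      finally have "ennreal (g y / n ^ 2) \<le> ennreal (l / 2 * (1 / n ^ 4) + 1 / (2 * l) * (g y)\<^sup>2)"
        by (rule ennreal_leI)
      also have "\<dots> = ennreal (l / 2) * ennreal (1 / n ^ 4) + ennreal (1 / (2 * l)) * ennreal ((g y)\<^sup>2)"
        using l n0 by (subst ennreal_plus) (auto simp flip: ennreal_mult)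
      also have "\<dots> = ?a y + ?b y"
        using 3 nR by (simp add: n_def)
      also have "\<dots> \<le> ?a y + ?b y + (?c y + ?d y)" by simp
      finally show ?thesis using 3 by (simp add: n_def)
    qed
  qed
  also have "\<dots> = (\<integral>\<^sup>+y. ?a y \<partial>lborel) + (\<integral>\<^sup>+y. ?b y \<partial>lborel) + ((\<integral>\<^sup>+y. ?c y \<partial>lborel) + (\<integral>\<^sup>+y. ?d y \<partial>lborel))"
    by (simp add: nn_integral_add)
  also have "\<dots> \<le> ennreal (l / 2 * (pi\<^sup>2 * ln (R / \<rho>))) + ennreal (1 / (2 * l) * b\<^sup>2)
     + (ennreal (k / 2 * (2 * pi\<^sup>2 * \<rho>)) + (\<integral>\<^sup>+y. ?d y \<partial>lborel))"
  proof (intro add_mono order_refl)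
    have "(\<integral>\<^sup>+y. ?a y \<partial>lborel) = ennreal (l / 2) * (\<integral>\<^sup>+y. indicator (ball 0 1) y * (ennreal (1 / norm (y - x) ^ 4) * indicator {\<rho>..R} (norm (y - x))) \<partial>lborel)"
      by (rule nn_integral_cmult) measurable
    also have "\<dots> \<le> ennreal (l / 2) * ennreal (pi\<^sup>2 * ln (R / \<rho>))"
      by (intro mult_left_mono nn_integral_half_annulus x \<rho> R) auto
    also have "\<dots> = ennreal (l / 2 * (pi\<^sup>2 * ln (R / \<rho>)))"
      using l R \<rho> by (intro ennreal_mult[symmetric]) auto
    finally show "(\<integral>\<^sup>+y. ?a y \<partial>lborel) \<le> ennreal (l / 2 * (pi\<^sup>2 * ln (R / \<rho>)))" .
    have "(\<integral>\<^sup>+y. ?b y \<partial>lborel) = ennreal (1 / (2 * l)) * (\<integral>\<^sup>+y. ennreal ((g y)\<^sup>2) \<partial>lborel)"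
      by (rule nn_integral_cmult) measurable
    also have "\<dots> \<le> ennreal (1 / (2 * l)) * ennreal (b\<^sup>2)" by (intro mult_left_mono b) auto
    also have "\<dots> = ennreal (1 / (2 * l) * b\<^sup>2)" using l by (intro ennreal_mult[symmetric]) auto
    finally show "(\<integral>\<^sup>+y. ?b y \<partial>lborel) \<le> ennreal (1 / (2 * l) * b\<^sup>2)" .
    have "(\<integral>\<^sup>+y. ?c y \<partial>lborel) = ennreal (k / 2) * (\<integral>\<^sup>+y. ennreal (1 / norm (y - x) ^ 3) * indicator (ball x \<rho>) y \<partial>lborel)"
      by (rule nn_integral_cmult) measurable
    also have "\<dots> = ennreal (k / 2) * ennreal (2 * pi\<^sup>2 * \<rho>)" by (simp only: nn_integral_norm_cube_ball[OF \<rho>])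
    also have "\<dots> = ennreal (k / 2 * (2 * pi\<^sup>2 * \<rho>))" using k \<rho> by (intro ennreal_mult[symmetric]) auto
    finally show "(\<integral>\<^sup>+y. ?c y \<partial>lborel) \<le> ennreal (k / 2 * (2 * pi\<^sup>2 * \<rho>))" by simp
  qed
  also have "\<dots> = ennreal ((l * pi\<^sup>2 * ln (R / \<rho>) + b\<^sup>2 / l) / 2 + k * pi\<^sup>2 * \<rho>) + (\<integral>\<^sup>+y. ?d y \<partial>lborel)"
  proof -
    have "0 \<le> ln (R / \<rho>)" using R \<rho> by simp
    then have "ennreal (l / 2 * (pi\<^sup>2 * ln (R / \<rho>))) + ennreal (1 / (2 * l) * b\<^sup>2) + ennreal (k / 2 * (2 * pi\<^sup>2 * \<rho>))
       = ennreal (l / 2 * (pi\<^sup>2 * ln (R / \<rho>)) + 1 / (2 * l) * b\<^sup>2 + k / 2 * (2 * pi\<^sup>2 * \<rho>))"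
      using l k \<rho> by (simp add: ennreal_plus[symmetric] del: ennreal_plus)
    also have "l / 2 * (pi\<^sup>2 * ln (R / \<rho>)) + 1 / (2 * l) * b\<^sup>2 + k / 2 * (2 * pi\<^sup>2 * \<rho>)
       = (l * pi\<^sup>2 * ln (R / \<rho>) + b\<^sup>2 / l) / 2 + k * pi\<^sup>2 * \<rho>"
      by (simp add: add_divide_distrib mult_ac)
    finally show ?thesis by (simp only: add.assoc[symmetric])
  qed
  also have "(\<integral>\<^sup>+y. ?d y \<partial>lborel) = ennreal (1 / (2 * k)) * (\<integral>\<^sup>+y. ennreal ((g y)\<^sup>2) * (ennreal (1 / norm (x - y)) * indicator {..<\<rho>} (dist y x)) \<partial>lborel)"
    by (rule nn_integral_cmult) measurable
  finally show ?thesis by (simp only: R_def)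
qed

text \<open>Splitting the potential at the radius \<open>\<rho>\<close> with \<open>\<rho>\<^sup>3 = S3 E\<close>: the outer part is bounded pointwise
  by the sharp logarithm, and the inner part has mean \<open>O(b)\<close> over \<open>E\<close>.\<close>
lemma level_set_bound:
  fixes g :: "R4 \<Rightarrow> real"
  assumes gm [measurable]: "g \<in> borel_measurable borel" and g0: "\<And>y. g y \<ge> 0" and gB: "\<And>y. y \<notin> ball 0 1 \<Longrightarrow> g y = 0"
    and b: "0 < b" "(\<integral>\<^sup>+y. ennreal ((g y)\<^sup>2) \<partial>lborel) \<le> ennreal (b\<^sup>2)"
    and E [measurable]: "E \<in> sets borel" "E \<subseteq> sphere 0 1" and r: "r \<le> 1" and T: "0 < T"
    and pot: "\<And>x. x \<in> E \<Longrightarrow> ennreal (2 * pi\<^sup>2 * (T + 513 * b)) \<le> (\<integral>\<^sup>+y. ennreal (g y / norm (y - x) ^ 2) * indicator (ball x r) y \<partial>lborel)"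
  shows "measure S3 E \<le> exp (- (12 * pi\<^sup>2 * T\<^sup>2 / b\<^sup>2))"
proof (cases "measure S3 E = 0")
  case False
  define m where "m = measure S3 E"
  have m: "m > 0" using False by (simp add: m_def zero_less_measure_iff)
  have em: "emeasure S3 E = ennreal m" by (simp add: m_def S3.emeasure_eq_measure)
  define \<rho> where "\<rho> = root 3 m"
  have \<rho>: "\<rho> > 0" "\<rho> ^ 3 = m" using m by (auto simp: \<rho>_def)
  define L where "L = ln (max 1 \<rho> / \<rho>)"
  have L0: "L \<ge> 0" using \<rho> by (simp add: L_def)
  \<comment> \<open>The minimizer of \<open>l * pi^2 * L + b^2 / l\<close> in the borderline case
    \<open>4 * pi^2 * T^2 = b^2 * L\<close>; no constant is lost at leading order.\<close>
  define l where "l = b\<^sup>2 / (2 * pi\<^sup>2 * T)"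
  \<comment> \<open>This weight makes both near-field terms of order \<open>b\<close>, independently
    of \<rho>.\<close>
  define k where "k = b / \<rho>"
  have lk: "l > 0" "k > 0" using b T \<rho> by (auto simp: l_def k_def)
  define c where "c = (l * pi\<^sup>2 * L + b\<^sup>2 / l) / 2 + k * pi\<^sup>2 * \<rho>"
  have c0: "c \<ge> 0" using lk L0 \<rho> by (simp add: c_def)
  let ?V = "\<lambda>x. \<integral>\<^sup>+y. ennreal ((g y)\<^sup>2) * (ennreal (1 / norm (x - y)) * indicator {..<\<rho>} (dist y x)) \<partial>lborel"
  have [measurable]: "?V \<in> borel_measurable borel" by measurable
  have "ennreal (2 * pi\<^sup>2 * (T + 513 * b)) * ennreal m = (\<integral>\<^sup>+x. ennreal (2 * pi\<^sup>2 * (T + 513 * b)) * indicator E x \<partial>S3)"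
    by (subst nn_integral_cmult_indicator) (auto simp: em)
  also have "\<dots> \<le> (\<integral>\<^sup>+x. ennreal c * indicator E x + ennreal (1 / (2 * k)) * ?V x \<partial>S3)"
  proof (rule nn_integral_mono)
    fix x :: R4
    show "ennreal (2 * pi\<^sup>2 * (T + 513 * b)) * indicator E x \<le> ennreal c * indicator E x + ennreal (1 / (2 * k)) * ?V x"
    proof (cases "x \<in> E")
      case True
      then have "norm x = 1" using E(2) by auto
      have "ennreal (2 * pi\<^sup>2 * (T + 513 * b)) \<le> ennreal c + ennreal (1 / (2 * k)) * ?V x"
        unfolding c_def L_def
        by (rule order_trans[OF pot[OF True]], rule riesz_split)
           (use g0 gB b \<open>norm x = 1\<close> r \<rho>(1) lk in auto)
      then show ?thesis using True by simp
    qed simp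
  qed
  also have "\<dots> = (\<integral>\<^sup>+x. ennreal c * indicator E x \<partial>S3) + (\<integral>\<^sup>+x. ennreal (1 / (2 * k)) * ?V x \<partial>S3)"
    by (rule nn_integral_add) measurable
  also have "(\<integral>\<^sup>+x. ennreal c * indicator E x \<partial>S3) = ennreal c * ennreal m"
    by (subst nn_integral_cmult_indicator) (auto simp: em)
  also have "(\<integral>\<^sup>+x. ennreal (1 / (2 * k)) * ?V x \<partial>S3) = ennreal (1 / (2 * k)) * (\<integral>\<^sup>+x. ?V x \<partial>S3)"
    by (rule nn_integral_cmult) measurable
  also have "(\<integral>\<^sup>+x. ?V x \<partial>S3) \<le> ennreal (2048 * pi\<^sup>2 * \<rho>\<^sup>2) * (\<integral>\<^sup>+y. ennreal ((g y)\<^sup>2) \<partial>lborel)"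
    by (rule nn_integral_S3_potential[OF _ \<rho>(1)]) measurable
  also have "\<dots> \<le> ennreal (2048 * pi\<^sup>2 * \<rho>\<^sup>2) * ennreal (b\<^sup>2)"
    by (intro mult_left_mono b) auto
  finally have "ennreal (2 * pi\<^sup>2 * (T + 513 * b)) * ennreal m \<le> ennreal c * ennreal m + ennreal (1 / (2 * k)) * (ennreal (2048 * pi\<^sup>2 * \<rho>\<^sup>2) * ennreal (b\<^sup>2))"
    by (simp add: mult_left_mono add_left_mono)
  also have "\<dots> = ennreal (c * m + 1 / (2 * k) * (2048 * pi\<^sup>2 * \<rho>\<^sup>2 * b\<^sup>2))"
  proof -
    have "ennreal c * ennreal m + ennreal (1 / (2 * k)) * (ennreal P * ennreal Q) = ennreal (c * m + 1 / (2 * k) * (P * Q))"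
      if "P \<ge> 0" "Q \<ge> 0" for P Q
      using c0 m lk that by (subst ennreal_plus) (auto simp flip: ennreal_mult)
    then show ?thesis by simp
  qed
  also have "ennreal (2 * pi\<^sup>2 * (T + 513 * b)) * ennreal m = ennreal (2 * pi\<^sup>2 * (T + 513 * b) * m)"
    using T b m by (intro ennreal_mult[symmetric]) auto
  finally have "2 * pi\<^sup>2 * (T + 513 * b) * m \<le> c * m + 1 / (2 * k) * (2048 * pi\<^sup>2 * \<rho>\<^sup>2 * b\<^sup>2)"
    by (rule iffD1[OF ennreal_le_iff, rotated]) (use c0 m lk in auto)
  \<comment> \<open>Together with the \<open>pi^2 * b\<close> contained in \<open>c\<close>, the
    near field costs \<open>1025 * pi^2 * b\<close> per unit of measure, just below the
    \<open>1026 * pi^2 * b\<close> that the summand \<open>513 * b\<close> of the threshold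
    provides.\<close>
  also have "1 / (2 * k) * (2048 * pi\<^sup>2 * \<rho>\<^sup>2 * b\<^sup>2) = 1024 * pi\<^sup>2 * b * m"
    unfolding k_def \<rho>(2)[symmetric] using b \<rho> by (simp add: eval_nat_numeral)
  finally have "(2 * pi\<^sup>2 * (T + 513 * b)) * m \<le> (c + 1024 * pi\<^sup>2 * b) * m" by (simp add: algebra_simps)
  then have "2 * pi\<^sup>2 * (T + 513 * b) \<le> c + 1024 * pi\<^sup>2 * b" using m by simp
  then have "2 * (pi\<^sup>2 * T) + 1026 * (pi\<^sup>2 * b) \<le> c + 1024 * (pi\<^sup>2 * b)" by (simp add: algebra_simps)
  moreover have "c = (l * pi\<^sup>2 * L + 2 * (pi\<^sup>2 * T)) / 2 + pi\<^sup>2 * b"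
  proof -
    have "k * pi\<^sup>2 * \<rho> = pi\<^sup>2 * b" using \<rho> by (simp add: k_def)
    moreover have "b\<^sup>2 / l = 2 * (pi\<^sup>2 * T)" using b T by (simp add: l_def)
    ultimately show ?thesis by (simp only: c_def)
  qed
  moreover have "0 \<le> pi\<^sup>2 * b" using b by simp
  moreover have "p \<le> X / 2" if "2 * p + 1026 * q \<le> c + 1024 * q" "c = (X + 2 * p) / 2 + q" "0 \<le> q" for p q X :: real
    using that by argo
  ultimately have "pi\<^sup>2 * T \<le> l * pi\<^sup>2 * L / 2" by blast
  also have "\<dots> = pi\<^sup>2 * (b\<^sup>2 * L / (4 * pi\<^sup>2 * T))" using T by (simp add: l_def)
  finally have "T \<le> b\<^sup>2 * L / (4 * pi\<^sup>2 * T)" by (simp only: mult_le_cancel_left_pos zero_less_power pi_gt_zero)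
  then have "4 * pi\<^sup>2 * T\<^sup>2 \<le> b\<^sup>2 * L"
    using T by (simp add: pos_le_divide_eq power2_eq_square mult_ac)
  then have *: "4 * pi\<^sup>2 * T\<^sup>2 / b\<^sup>2 \<le> L" using b by (simp add: pos_divide_le_eq mult.commute)
  moreover have "0 < 4 * pi\<^sup>2 * T\<^sup>2 / b\<^sup>2" using T b by simp
  \<comment> \<open>Positivity excludes \<open>\<rho> \<ge> 1\<close>, so \<open>L\<close> is
    \<open>- ln \<rho>\<close>, a third of \<open>- ln m\<close>; this turns the 4 into 12.\<close>
  ultimately have "L > 0" by linarith
  then have "\<rho> < 1" using \<rho> by (auto simp: L_def max_def split: if_splits)
  then have "L = - ln \<rho>" using \<rho> by (simp add: L_def ln_div)
  moreover have "ln m = 3 * ln \<rho>" using ln_realpow[of \<rho> 3] \<rho>(2) by simp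
  ultimately have "ln m \<le> - (12 * pi\<^sup>2 * T\<^sup>2 / b\<^sup>2)" using * by simp
  then have "exp (ln m) \<le> exp (- (12 * pi\<^sup>2 * T\<^sup>2 / b\<^sup>2))" by (simp only: exp_le_cancel_iff)
  then show ?thesis unfolding exp_ln[OF m] by (simp only: m_def)
qed simp

text \<open>Sum over integer levels. Completing the square with the slightly larger slope
  \<open>3 * (1 + \<eta>)\<close> leaves a factor \<open>exp (- 3 * \<eta> * N)\<close>, so the
  levels form a geometric series instead of a Gaussian sum, at the price of
  \<open>(1 + \<eta>)^2\<close> in the exponent.\<close>

lemma exp_integral_bound:
  fixes h :: "R4 \<Rightarrow> real"
  assumes hm [measurable]: "h \<in> borel_measurable borel" and \<Omega> [measurable]: "\<Omega> \<in> sets borel"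
    and b: "0 < b" and \<eta>: "0 < \<eta>"
    and lev: "\<And>t. 0 < t \<Longrightarrow> measure S3 {x\<in>\<Omega>. t \<le> h x} \<le> exp (- (12 * pi\<^sup>2 * t\<^sup>2 / b\<^sup>2))"
  shows "(\<integral>\<^sup>+x. ennreal (exp (3 * h x)) * indicator \<Omega> x \<partial>S3)
     \<le> ennreal ((2 * pi\<^sup>2 * exp 3 + exp 3 / (1 - exp (- 3 * \<eta>))) * exp ((1 + \<eta>)\<^sup>2 * (3 / (16 * pi\<^sup>2)) * b\<^sup>2))"
proof -
  define X where "X = exp ((1 + \<eta>)\<^sup>2 * (3 / (16 * pi\<^sup>2)) * b\<^sup>2)"
  have X: "X \<ge> 1" by (simp add: X_def)
  let ?E = "\<lambda>n::nat. {x\<in>\<Omega>. real (Suc n) \<le> h x}"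
  let ?t = "\<lambda>n x. ennreal (exp 3 * exp (3 * real (Suc n))) * indicator (?E n) x"
  have "(\<integral>\<^sup>+x. ennreal (exp (3 * h x)) * indicator \<Omega> x \<partial>S3) \<le> (\<integral>\<^sup>+x. ennreal (exp 3) + (\<Sum>n. ?t n x) \<partial>S3)"
  proof (rule nn_integral_mono)
    fix x
    show "ennreal (exp (3 * h x)) * indicator \<Omega> x \<le> ennreal (exp 3) + (\<Sum>n. ?t n x)"
    proof (cases "x \<in> \<Omega>")
      case True
      show ?thesis
      proof (cases "h x < 1")
        case h1: True
        have "ennreal (exp (3 * h x)) \<le> ennreal (exp 3)" using h1 by (intro ennreal_leI) simp
        also have "\<dots> \<le> ennreal (exp 3) + (\<Sum>n. ?t n x)" by simp
        finally show ?thesis using True by simp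
      next
        case h1: False
        \<comment> \<open>Levels start at 1, since \<open>lev\<close> requires positive heights;
          values of \<open>h\<close> below 1 are absorbed by the summand
          \<open>exp 3\<close>.\<close>
        define n where "n = nat (\<lfloor>h x\<rfloor> - 1)"
        have n: "real (Suc n) = of_int \<lfloor>h x\<rfloor>" using h1 by (simp add: n_def)
        then have n1: "real (Suc n) \<le> h x" "h x \<le> real (Suc n) + 1" by linarith+
        have "exp (3 * h x) \<le> exp (3 + 3 * real (Suc n))" using n1 by simp
        also have "\<dots> = exp 3 * exp (3 * real (Suc n))" by (rule exp_add)
        finally have "ennreal (exp (3 * h x)) \<le> ?t n x" using True n1 by (auto intro!: ennreal_leI)
        also have "\<dots> \<le> (\<Sum>n. ?t n x)"
        proof -
          define f where "f = (\<lambda>n. ?t n x)"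
          have "sum f {n} \<le> suminf f" by (rule sum_le_suminf) auto
          then show ?thesis by (simp add: f_def[symmetric]) (simp add: f_def)
        qed
        also have "\<dots> \<le> ennreal (exp 3) + (\<Sum>n. ?t n x)" by simp
        finally show ?thesis using True by simp
      qed
    qed simp
  qed
  also have "\<dots> = (\<integral>\<^sup>+x. ennreal (exp 3) \<partial>S3) + (\<integral>\<^sup>+x. (\<Sum>n. ?t n x) \<partial>S3)"
    by (rule nn_integral_add) measurable
  also have "(\<integral>\<^sup>+x. (\<Sum>n. ?t n x) \<partial>S3) = (\<Sum>n. \<integral>\<^sup>+x. ?t n x \<partial>S3)"
    by (rule nn_integral_suminf) measurable
  also have "(\<Sum>n. \<integral>\<^sup>+x. ?t n x \<partial>S3) = (\<Sum>n. ennreal (exp 3 * exp (3 * real (Suc n))) * emeasure S3 (?E n))"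
    by (intro suminf_cong nn_integral_cmult_indicator) measurable
  also have "\<dots> \<le> (\<Sum>n. ennreal (exp 3 * X * exp (- 3 * \<eta>) ^ n))"
  proof (rule suminf_le)
    fix n
    define N where "N = real (Suc n)"
    have N: "N > 0" "N \<ge> real n" by (auto simp: N_def)
    have "emeasure S3 (?E n) \<le> ennreal (exp (- (12 * pi\<^sup>2 * N\<^sup>2 / b\<^sup>2)))"
      using lev[OF N(1)] by (simp only: S3.emeasure_eq_measure N_def ennreal_leI)
    then have "ennreal (exp 3 * exp (3 * N)) * emeasure S3 (?E n) \<le> ennreal (exp 3 * exp (3 * N)) * ennreal (exp (- (12 * pi\<^sup>2 * N\<^sup>2 / b\<^sup>2)))"
      by (intro mult_left_mono) auto
    also have "\<dots> = ennreal (exp 3 * exp (3 * N) * exp (- (12 * pi\<^sup>2 * N\<^sup>2 / b\<^sup>2)))"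
      by (rule ennreal_mult[symmetric]) auto
    also have "\<dots> \<le> ennreal (exp 3 * X * exp (- 3 * \<eta>) ^ n)"
    proof (rule ennreal_leI)
      \<comment> \<open>The square vanishes at the maximizer
        \<open>N = (1 + \<eta>) * b^2 / (8 * pi^2)\<close> of
        \<open>3 * (1 + \<eta>) * N - 12 * pi^2 * N^2 / b^2\<close>.\<close>
      have "0 \<le> 12 * pi\<^sup>2 * (N / b - (1 + \<eta>) * b / (8 * pi\<^sup>2))\<^sup>2" by simp
      also have "\<dots> = 12 * pi\<^sup>2 * N\<^sup>2 / b\<^sup>2 - 3 * (1 + \<eta>) * N + (1 + \<eta>)\<^sup>2 * (3 / (16 * pi\<^sup>2)) * b\<^sup>2"
        using b by (simp add: field_simps power2_eq_square)
      finally have "3 * N + - (12 * pi\<^sup>2 * N\<^sup>2 / b\<^sup>2) \<le> (1 + \<eta>)\<^sup>2 * (3 / (16 * pi\<^sup>2)) * b\<^sup>2 + - (3 * \<eta> * N)"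
        by (simp add: algebra_simps)
      also have "\<dots> \<le> (1 + \<eta>)\<^sup>2 * (3 / (16 * pi\<^sup>2)) * b\<^sup>2 + real n * (- 3 * \<eta>)"
        using N \<eta> by (simp add: mult.commute)
      finally have "exp (3 * N + - (12 * pi\<^sup>2 * N\<^sup>2 / b\<^sup>2)) \<le> exp ((1 + \<eta>)\<^sup>2 * (3 / (16 * pi\<^sup>2)) * b\<^sup>2 + real n * (- 3 * \<eta>))"
        by (simp only: exp_le_cancel_iff)
      then have "exp (3 * N) * exp (- (12 * pi\<^sup>2 * N\<^sup>2 / b\<^sup>2)) \<le> X * exp (- 3 * \<eta>) ^ n"
        by (simp only: exp_add X_def exp_of_nat_mult)
      then have "exp 3 * (exp (3 * N) * exp (- (12 * pi\<^sup>2 * N\<^sup>2 / b\<^sup>2))) \<le> exp 3 * (X * exp (- 3 * \<eta>) ^ n)"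
        by (rule mult_left_mono) simp
      then show "exp 3 * exp (3 * N) * exp (- (12 * pi\<^sup>2 * N\<^sup>2 / b\<^sup>2)) \<le> exp 3 * X * exp (- 3 * \<eta>) ^ n"
        by (simp only: mult.assoc)
    qed
    finally show "ennreal (exp 3 * exp (3 * real (Suc n))) * emeasure S3 (?E n) \<le> ennreal (exp 3 * X * exp (- 3 * \<eta>) ^ n)"
      by (simp only: N_def)
  qed auto
  also have "\<dots> = ennreal (exp 3 * X * (1 / (1 - exp (- 3 * \<eta>))))"
  proof (rule suminf_ennreal_eq)
    show "(\<lambda>n. exp 3 * X * exp (- 3 * \<eta>) ^ n) sums (exp 3 * X * (1 / (1 - exp (- 3 * \<eta>))))"
      using \<eta> by (intro sums_mult geometric_sums) simp
  qed (use X in simp)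
  also have "(\<integral>\<^sup>+x. ennreal (exp 3) \<partial>S3) = ennreal (exp 3 * (2 * pi\<^sup>2))"
    by (simp add: emeasure_S3_UNIV ennreal_mult)
  also have "ennreal (exp 3 * (2 * pi\<^sup>2)) + ennreal (exp 3 * X * (1 / (1 - exp (- 3 * \<eta>))))
     = ennreal (exp 3 * (2 * pi\<^sup>2) + exp 3 * X * (1 / (1 - exp (- 3 * \<eta>))))"
    using X \<eta> by (intro ennreal_plus[symmetric]) auto
  also have "\<dots> \<le> ennreal ((2 * pi\<^sup>2 * exp 3 + exp 3 / (1 - exp (- 3 * \<eta>))) * X)"
  proof (rule ennreal_leI)
    have "exp 3 * (2 * pi\<^sup>2) * 1 \<le> exp 3 * (2 * pi\<^sup>2) * X" using X by (intro mult_left_mono) auto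
    then show "exp 3 * (2 * pi\<^sup>2) + exp 3 * X * (1 / (1 - exp (- 3 * \<eta>))) \<le> (2 * pi\<^sup>2 * exp 3 + exp 3 / (1 - exp (- 3 * \<eta>))) * X"
      by (simp add: algebra_simps)
  qed
  finally show ?thesis by (simp only: X_def add_left_mono)
qed


section \<open>Local exponential integrability\<close>

context neumann
begin

text \<open>563 is 50 + 513: \<open>representation\<close> contributes
  \<open>100 * pi^2 * A\<close>, to be divided by \<open>2 * pi^2\<close>, and
  \<open>level_set_bound\<close> asks for 513. Beyond distance \<open>r\<close> the kernel is at
  most \<open>1 / r^2\<close>, and the bound \<open>pi^2 * A\<close> for the integral of
  \<open>|\<Delta>u|\<close> turns this into \<open>1 / (2 * r^2)\<close>. Only the energy near
  \<Omega> enters quadratically; the global \<open>A\<close> enters linearly.\<close>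

lemma local_exp_bound:
  assumes \<eta>: "0 < \<eta>" and r: "0 < r" "r \<le> 1" and a: "0 < a" "a \<le> A"
    and A: "(LINT y|lborel. indicator (ball 0 1) y * (laplacian u y)\<^sup>2) \<le> A\<^sup>2"
    and \<Omega> [measurable]: "\<Omega> \<in> sets borel" "\<Omega> \<subseteq> sphere 0 1"
    and loc: "(LINT y|lborel. indicator (ball 0 1 \<inter> (\<Union>x\<in>\<Omega>. ball x r)) y * (laplacian u y)\<^sup>2) \<le> a\<^sup>2"
  shows "(\<integral>\<^sup>+x. ennreal (exp (3 * (u x - sphere_integral u / (2 * pi\<^sup>2)))) * indicator \<Omega> x \<partial>S3)
     \<le> ennreal ((2 * pi\<^sup>2 * exp 3 + exp 3 / (1 - exp (- 3 * \<eta>))) * exp ((1 + \<eta>)\<^sup>2 * (3 / (16 * pi\<^sup>2)) * a\<^sup>2)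
         * exp (3 * (563 + 1 / (2 * r\<^sup>2)) * A))"
proof -
  define c where "c = 563 + 1 / (2 * r\<^sup>2)"
  define W where "W = ball (0::R4) 1 \<inter> (\<Union>x\<in>\<Omega>. ball x r)"
  have "open W" unfolding W_def by auto
  then have [measurable]: "W \<in> sets borel" by simp
  have A0: "A > 0" using a by simp
  have lm [measurable]: "(\<lambda>y. indicator (ball 0 1) y * laplacian u y) \<in> borel_measurable borel"
    using integrable_ball_continuous[OF continuous_laplacian] by auto
  \<comment> \<open>The inner indicator provides Borel measurability, since continuity of the
    Laplacian is known on the closed ball only.\<close>
  define g where "g = (\<lambda>y. indicator W y * \<bar>indicator (ball 0 1) y * laplacian u y\<bar>)"
  have gm [measurable]: "g \<in> borel_measurable borel" unfolding g_def by measurable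
  have g0: "g y \<ge> 0" and gB: "y \<notin> ball 0 1 \<Longrightarrow> g y = 0" for y by (auto simp: g_def)
  have g2: "(g y)\<^sup>2 = indicator W y * (laplacian u y)\<^sup>2" for y by (auto simp: g_def W_def indicator_def)
  have li: "integrable lborel (\<lambda>y. indicator (ball 0 1) y * (laplacian u y)\<^sup>2)"
    by (intro integrable_ball_continuous continuous_intros continuous_laplacian)
  have g2i: "integrable lborel (\<lambda>y. (g y)\<^sup>2)"
  proof (rule Bochner_Integration.integrable_bound[OF li])
    show "AE y in lborel. norm ((g y)\<^sup>2) \<le> norm (indicator (ball 0 1) y * (laplacian u y)\<^sup>2)"
      by (intro AE_I2) (auto simp: g_def indicator_def)
  qed measurable
  have g2b: "(\<integral>\<^sup>+y. ennreal ((g y)\<^sup>2) \<partial>lborel) \<le> ennreal (a\<^sup>2)"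
    using nn_integral_eq_integral[OF g2i] loc by (simp add: g2 W_def ennreal_leI)
  have cu: "continuous_on (sphere 0 1) u" by (rule continuous_on_subset[OF continuous_u]) auto
  note [measurable] = integral_S3_indicator(3)[OF cu]
  \<comment> \<open>The shift by \<open>c * A\<close> swallows all linear errors: where
    \<open>t \<le> h x\<close>, the local potential is at least
    \<open>2 * pi^2 * (t + 513 * A)\<close>.\<close>
  define h where "h = (\<lambda>x. indicator (sphere 0 1) x * u x - sphere_integral u / (2 * pi\<^sup>2) - c * A)"
  have hm [measurable]: "h \<in> borel_measurable borel" unfolding h_def by measurable
  have L1: "(LINT y|lborel. indicator (ball 0 1) y * \<bar>laplacian u y\<bar>) \<le> pi\<^sup>2 * A"
  proof -
    have i1: "integrable lborel (\<lambda>y. A / 2 * indicator (ball (0::R4) 1) y)"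
      by (intro integrable_mult_right integrable_real_indicator) (auto simp: emeasure_ball_R4)
    have "(LINT y|lborel. indicator (ball 0 1) y * \<bar>laplacian u y\<bar>)
      \<le> (LINT y|lborel. A / 2 * indicator (ball 0 1) y + 1 / (2 * A) * (indicator (ball 0 1) y * (laplacian u y)\<^sup>2))"
    proof (rule integral_mono)
      show "integrable lborel (\<lambda>y. indicator (ball 0 1) y * \<bar>laplacian u y\<bar>)"
        by (intro integrable_ball_continuous continuous_intros continuous_laplacian)
      show "integrable lborel (\<lambda>y. A / 2 * indicator (ball 0 1) y + 1 / (2 * A) * (indicator (ball 0 1) y * (laplacian u y)\<^sup>2))"
        by (intro Bochner_Integration.integrable_add i1 integrable_mult_right li)
      fix y
      have "0 \<le> (A - \<bar>laplacian u y\<bar>)\<^sup>2 / (2 * A)" using A0 by simp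
      also have "\<dots> = A / 2 + 1 / (2 * A) * (laplacian u y)\<^sup>2 - \<bar>laplacian u y\<bar>"
        using A0 by (simp add: power2_diff field_simps power2_eq_square)
      finally show "indicator (ball 0 1) y * \<bar>laplacian u y\<bar> \<le> A / 2 * indicator (ball 0 1) y + 1 / (2 * A) * (indicator (ball 0 1) y * (laplacian u y)\<^sup>2)"
        by (simp add: indicator_def)
    qed
    also have "\<dots> = A / 2 * measure lborel (ball (0::R4) 1) + 1 / (2 * A) * (LINT y|lborel. indicator (ball 0 1) y * (laplacian u y)\<^sup>2)"
      by (subst Bochner_Integration.integral_add[OF i1 integrable_mult_right[OF li]]) simp
    also have "\<dots> \<le> A / 2 * (pi\<^sup>2 / 2) + 1 / (2 * A) * A\<^sup>2"
    proof -
      have "measure lborel (ball (0::R4) 1) = pi\<^sup>2 / 2"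
        by (simp add: measure_def emeasure_ball_R4)
      then show ?thesis using A A0 by (intro add_mono mult_left_mono) auto
    qed
    also have "\<dots> = (pi\<^sup>2 / 4 + 1 / 2) * A" using A0 by (simp add: algebra_simps power2_eq_square)
    also have "\<dots> \<le> pi\<^sup>2 * A"
    proof -
      have "1 \<le> pi\<^sup>2" using pi_ge_two by (intro one_le_power) linarith
      then show ?thesis using A0 by (intro mult_right_mono) auto
    qed
    finally show ?thesis .
  qed
  have lev: "measure S3 {x\<in>\<Omega>. t \<le> h x} \<le> exp (- (12 * pi\<^sup>2 * t\<^sup>2 / a\<^sup>2))" if t: "0 < t" for t
  proof (rule level_set_bound[OF gm g0 gB a(1) g2b _ _ r(2) t])
    show "{x\<in>\<Omega>. t \<le> h x} \<in> sets borel" by measurable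
    show "{x\<in>\<Omega>. t \<le> h x} \<subseteq> sphere 0 1" using \<Omega> by auto
    fix x assume "x \<in> {x\<in>\<Omega>. t \<le> h x}"
    then have x\<Omega>: "x \<in> \<Omega>" and xt: "t \<le> h x" by auto
    then have xs: "norm x = 1" using \<Omega>(2) by auto
    interpret neumann_pole u x by unfold_locales (rule xs)
    let ?k = "\<lambda>y. g y / norm (y - x) ^ 2 * indicator (ball x r) y"
    have ki: "integrable lborel ?k"
    proof (rule Bochner_Integration.integrable_bound[OF integrable_riesz])
      show "AE y in lborel. norm (?k y) \<le> norm (indicator (ball 0 1) y * (\<bar>laplacian u y\<bar> / norm (y - x) ^ 2))"
        by (intro AE_I2) (auto simp: g_def indicator_def)
    qed measurable
    have i1: "integrable lborel (\<lambda>y. 1 / r\<^sup>2 * (indicator (ball 0 1) y * \<bar>laplacian u y\<bar>))"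
      by (intro integrable_mult_right integrable_ball_continuous continuous_intros continuous_laplacian)
    have "(LINT y|lborel. indicator (ball 0 1) y * (\<bar>laplacian u y\<bar> / norm (y - x) ^ 2))
      \<le> (LINT y|lborel. ?k y + 1 / r\<^sup>2 * (indicator (ball 0 1) y * \<bar>laplacian u y\<bar>))"
    proof (rule integral_mono[OF integrable_riesz Bochner_Integration.integrable_add[OF ki i1]])
      fix y
      show "indicator (ball 0 1) y * (\<bar>laplacian u y\<bar> / norm (y - x) ^ 2) \<le> ?k y + 1 / r\<^sup>2 * (indicator (ball 0 1) y * \<bar>laplacian u y\<bar>)"
      proof (cases "y \<in> ball 0 1")
        case True
        show ?thesis
        proof (cases "y \<in> ball x r")
          case yr: True
          then have "y \<in> W" using x\<Omega> True by (auto simp: W_def)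
          then show ?thesis using True yr by (simp add: g_def)
        next
          case False
          then have "r\<^sup>2 \<le> norm (y - x) ^ 2" using r by (intro power_mono) (auto simp: dist_norm norm_minus_commute)
          then have "\<bar>laplacian u y\<bar> / norm (y - x) ^ 2 \<le> \<bar>laplacian u y\<bar> / r\<^sup>2"
            using r by (intro divide_left_mono mult_pos_pos) auto
          then show ?thesis using True False by simp
        qed
      qed (simp add: g0)
    qed
    also have "\<dots> = (LINT y|lborel. ?k y) + 1 / r\<^sup>2 * (LINT y|lborel. indicator (ball 0 1) y * \<bar>laplacian u y\<bar>)"
      by (subst Bochner_Integration.integral_add[OF ki i1]) simp
    also have "\<dots> \<le> (LINT y|lborel. ?k y) + 1 / r\<^sup>2 * (pi\<^sup>2 * A)"
      by (intro add_left_mono mult_left_mono L1) simp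
    finally have I: "(LINT y|lborel. indicator (ball 0 1) y * (\<bar>laplacian u y\<bar> / norm (y - x) ^ 2)) \<le> (LINT y|lborel. ?k y) + 1 / r\<^sup>2 * (pi\<^sup>2 * A)" .
    have "t + c * A \<le> u x - sphere_integral u / (2 * pi\<^sup>2)" using xt xs by (simp add: h_def)
    then have "2 * pi\<^sup>2 * (t + c * A) \<le> 2 * pi\<^sup>2 * (u x - sphere_integral u / (2 * pi\<^sup>2))"
      by (intro mult_left_mono) auto
    also have "\<dots> = 2 * pi\<^sup>2 * u x - sphere_integral u" by (simp add: right_diff_distrib)
    also have "\<dots> \<le> 100 * pi\<^sup>2 * A + ((LINT y|lborel. ?k y) + 1 / r\<^sup>2 * (pi\<^sup>2 * A))"
      using representation[OF A0 A] I by linarith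
    finally have 1: "2 * pi\<^sup>2 * (t + c * A) - 100 * pi\<^sup>2 * A - 1 / r\<^sup>2 * (pi\<^sup>2 * A) \<le> (LINT y|lborel. ?k y)" by simp
    have 2: "2 * pi\<^sup>2 * (t + c * A) - 100 * pi\<^sup>2 * A - 1 / r\<^sup>2 * (pi\<^sup>2 * A) = 2 * pi\<^sup>2 * (t + 513 * A)"
      using r by (simp add: c_def field_simps)
    have "2 * pi\<^sup>2 * (t + 513 * a) \<le> 2 * pi\<^sup>2 * (t + 513 * A)" using a by (intro mult_left_mono) auto
    then have "2 * pi\<^sup>2 * (t + 513 * a) \<le> (LINT y|lborel. ?k y)" using 1 2 by linarith
    then have "ennreal (2 * pi\<^sup>2 * (t + 513 * a)) \<le> ennreal (LINT y|lborel. ?k y)" by (rule ennreal_leI)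
    also have "\<dots> = (\<integral>\<^sup>+y. ennreal (?k y) \<partial>lborel)"
      by (rule nn_integral_eq_integral[symmetric, OF ki]) (simp add: g0)
    also have "\<dots> = (\<integral>\<^sup>+y. ennreal (g y / norm (y - x) ^ 2) * indicator (ball x r) y \<partial>lborel)"
      by (intro nn_integral_cong) (auto simp: indicator_def)
    finally show "ennreal (2 * pi\<^sup>2 * (t + 513 * a)) \<le> (\<integral>\<^sup>+y. ennreal (g y / norm (y - x) ^ 2) * indicator (ball x r) y \<partial>lborel)" .
  qed
  let ?K = "(2 * pi\<^sup>2 * exp 3 + exp 3 / (1 - exp (- 3 * \<eta>))) * exp ((1 + \<eta>)\<^sup>2 * (3 / (16 * pi\<^sup>2)) * a\<^sup>2)"
  have "(\<integral>\<^sup>+x. ennreal (exp (3 * (u x - sphere_integral u / (2 * pi\<^sup>2)))) * indicator \<Omega> x \<partial>S3)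
    = (\<integral>\<^sup>+x. ennreal (exp (3 * c * A)) * (ennreal (exp (3 * h x)) * indicator \<Omega> x) \<partial>S3)"
  proof (rule nn_integral_cong)
    fix x
    show "ennreal (exp (3 * (u x - sphere_integral u / (2 * pi\<^sup>2)))) * indicator \<Omega> x
      = ennreal (exp (3 * c * A)) * (ennreal (exp (3 * h x)) * indicator \<Omega> x)"
    proof (cases "x \<in> \<Omega>")
      case True
      then have "3 * (u x - sphere_integral u / (2 * pi\<^sup>2)) = 3 * c * A + 3 * h x"
        using \<Omega>(2) by (auto simp: h_def indicator_def algebra_simps)
      then have "exp (3 * (u x - sphere_integral u / (2 * pi\<^sup>2))) = exp (3 * c * A) * exp (3 * h x)"
        by (simp only: exp_add)
      then show ?thesis using True by (simp add: ennreal_mult)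
    qed simp
  qed
  also have "\<dots> = ennreal (exp (3 * c * A)) * (\<integral>\<^sup>+x. ennreal (exp (3 * h x)) * indicator \<Omega> x \<partial>S3)"
    by (rule nn_integral_cmult) measurable
  also have "\<dots> \<le> ennreal (exp (3 * c * A)) * ennreal ?K"
    by (intro mult_left_mono exp_integral_bound hm \<Omega> a \<eta> lev) auto
  also have "\<dots> = ennreal (exp (3 * c * A) * ?K)"
    using \<eta> by (intro ennreal_mult[symmetric]) auto
  finally show ?thesis by (simp only: c_def mult.commute)
qed

end

section \<open>Concentration at separated points\<close>

text \<open>Coordinates of index at least \<open>K\<close> are pinned to 0. The set is then a closed
  part of a product of compact sets, and Tychonoff's theorem on the type of all sequences serves for
  \<open>K\<close>-tuples.\<close>

lemma compact_configurations:
  "compact {(x :: nat \<Rightarrow> R4, \<nu> :: nat \<Rightarrow> real). (\<forall>i. x i \<in> (if i < K then sphere 0 1 else {0}))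
     \<and> (\<forall>i. \<nu> i \<in> (if i < K then {0..1} else {0})) \<and> (\<Sum>i<K. \<nu> i) = 1}" (is "compact ?X")
proof -
  have comp: "compact {x :: nat \<Rightarrow> 'a::topological_space. \<forall>i. x i \<in> S i}" if "\<And>i. compact (S i)" for S
  proof -
    have "compactin (product_topology (\<lambda>i. euclidean) UNIV) (Pi\<^sub>E UNIV S)"
      unfolding compactin_PiE using that by (auto simp: compactin_euclidean_iff)
    moreover have "Pi\<^sub>E UNIV S = {x. \<forall>i. x i \<in> S i}" by (auto simp: PiE_def)
    ultimately show ?thesis by (simp add: euclidean_product_topology compactin_euclidean_iff)
  qed
  have 1: "compact {x :: nat \<Rightarrow> R4. \<forall>i. x i \<in> (if i < K then sphere 0 1 else {0})}"
    by (rule comp) auto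
  have 2: "compact {\<nu> :: nat \<Rightarrow> real. \<forall>i. \<nu> i \<in> (if i < K then {0..1} else {0})}"
    by (rule comp) auto
  have "closed {\<nu> :: nat \<Rightarrow> real. (\<Sum>i<K. \<nu> i) = 1}"
    by (intro closed_Collect_eq continuous_intros continuous_on_product_coordinates)
  with 2 have "compact ({\<nu> :: nat \<Rightarrow> real. \<forall>i. \<nu> i \<in> (if i < K then {0..1} else {0})} \<inter> {\<nu>. (\<Sum>i<K. \<nu> i) = 1})"
    by (rule compact_Int_closed)
  with 1 have "compact ({x :: nat \<Rightarrow> R4. \<forall>i. x i \<in> (if i < K then sphere 0 1 else {0})} \<times>
     ({\<nu> :: nat \<Rightarrow> real. \<forall>i. \<nu> i \<in> (if i < K then {0..1} else {0})} \<inter> {\<nu>. (\<Sum>i<K. \<nu> i) = 1}))"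
    by (rule compact_Times)
  also have "\<dots> = ?X" by auto
  finally show ?thesis .
qed

text \<open>Each configuration is detected by some function of \<open>Q\<close> with some margin
  \<open>1 / (n + 1)\<close>, and this is an open condition on the configuration. A finite subcover
  yields finitely many functions and, through the largest \<open>n\<close>, a common margin.\<close>

lemma uniform_nondegeneracy:
  fixes Q :: "(R4 \<Rightarrow> real) set" and K :: nat
  assumes cont: "\<And>p. p \<in> Q \<Longrightarrow> continuous_on UNIV p"
    and nondeg: "\<And>x \<nu>. (\<forall>i<K. x i \<in> sphere 0 1 \<and> 0 \<le> \<nu> i) \<Longrightarrow> (\<Sum>i<K. \<nu> i) = 1 \<Longrightarrow> \<exists>p\<in>Q. (\<Sum>i<K. \<nu> i * p (x i)) \<noteq> (0::real)"
  obtains P e where "finite P" "P \<subseteq> Q" "e > 0"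
    "\<And>x \<nu>. (\<forall>i<K. x i \<in> sphere 0 1 \<and> 0 \<le> \<nu> i) \<Longrightarrow> (\<Sum>i<K. \<nu> i) = 1 \<Longrightarrow> \<exists>p\<in>P. e < \<bar>\<Sum>i<K. \<nu> i * p (x i)\<bar>"
proof -
  let ?X = "{(x :: nat \<Rightarrow> R4, \<nu> :: nat \<Rightarrow> real). (\<forall>i. x i \<in> (if i < K then sphere 0 1 else {0}))
     \<and> (\<forall>i. \<nu> i \<in> (if i < K then {0..1} else {0})) \<and> (\<Sum>i<K. \<nu> i) = 1}"
  define F where "F = (\<lambda>p (z :: (nat \<Rightarrow> R4) \<times> (nat \<Rightarrow> real)). \<bar>\<Sum>i<K. snd z i * p (fst z i)\<bar>)"
  have cF: "continuous_on UNIV (F p)" if "p \<in> Q" for p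
  proof -
    have "continuous_on UNIV (\<lambda>z :: (nat \<Rightarrow> R4) \<times> (nat \<Rightarrow> real). fst z i)" for i
      by (rule continuous_on_compose2[OF continuous_on_product_coordinates[of i]]) (auto intro: continuous_intros)
    moreover have "continuous_on UNIV (\<lambda>z :: (nat \<Rightarrow> R4) \<times> (nat \<Rightarrow> real). snd z i)" for i
      by (rule continuous_on_compose2[OF continuous_on_product_coordinates[of i]]) (auto intro: continuous_intros)
    ultimately show ?thesis unfolding F_def
      by (intro continuous_intros continuous_on_compose2[OF cont[OF that]]) auto
  qed
  define U where "U = (\<lambda>(p, n::nat). {z. 1 / real (Suc n) < F p z})"
  have cover: "?X \<subseteq> \<Union>(U ` (Q \<times> UNIV))"
  proof
    fix z assume "z \<in> ?X"
    then obtain x \<nu> where z: "z = (x, \<nu>)" "\<forall>i. x i \<in> (if i < K then sphere 0 1 else {0})"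
      "\<forall>i. \<nu> i \<in> (if i < K then {0..1} else {0})" "(\<Sum>i<K. \<nu> i) = 1" by auto
    have "\<forall>i<K. x i \<in> sphere 0 1 \<and> 0 \<le> \<nu> i" using z(2,3) by (metis atLeastAtMost_iff)
    then obtain p where p: "p \<in> Q" "(\<Sum>i<K. \<nu> i * p (x i)) \<noteq> 0" using nondeg z(4) by blast
    then have "F p z > 0" by (simp add: F_def z(1))
    then obtain n where "1 / real (Suc n) < F p z"
      using reals_Archimedean by (metis inverse_eq_divide)
    then show "z \<in> \<Union>(U ` (Q \<times> UNIV))" using p by (auto simp: U_def)
  qed
  have opens: "open (U q)" if qQ: "q \<in> Q \<times> UNIV" for q
  proof -
    obtain p n where q: "q = (p, n)" "p \<in> Q" using qQ by auto
    have "open {z. 1 / real (Suc n) < F p z}"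
      by (rule open_Collect_less[OF continuous_on_const cF[OF q(2)]])
    then show ?thesis by (simp add: U_def q)
  qed
  from compactE_image[OF compact_configurations[of K] opens cover]
  obtain D where D: "D \<subseteq> Q \<times> UNIV" "finite D" "?X \<subseteq> \<Union>(U ` D)" .
  define n where "n = Max (insert 0 (snd ` D))"
  have n: "snd q \<le> n" if "q \<in> D" for q using that D(2) by (auto simp: n_def)
  show ?thesis
  proof (rule that[of "fst ` D" "1 / real (Suc n)"])
    show "finite (fst ` D)" "fst ` D \<subseteq> Q" using D by auto
    fix x :: "nat \<Rightarrow> R4" and \<nu> :: "nat \<Rightarrow> real"
    assume *: "\<forall>i<K. x i \<in> sphere 0 1 \<and> 0 \<le> \<nu> i" "(\<Sum>i<K. \<nu> i) = 1"
    define x' where "x' = (\<lambda>i. if i < K then x i else 0)"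
    define \<nu>' where "\<nu>' = (\<lambda>i. if i < K then \<nu> i else 0)"
    have "\<nu> i \<le> 1" if "i < K" for i
    proof -
      have "\<nu> i \<le> (\<Sum>i<K. \<nu> i)" using * that by (intro member_le_sum) auto
      then show ?thesis using * by simp
    qed
    then have "(x', \<nu>') \<in> ?X" using * by (auto simp: x'_def \<nu>'_def)
    then obtain q where q: "q \<in> D" "(x', \<nu>') \<in> U q" using D(3) by blast
    have "1 / real (Suc n) \<le> 1 / real (Suc (snd q))" using n[OF q(1)] by (intro divide_left_mono) auto
    also have "\<dots> < F (fst q) (x', \<nu>')" using q(2) by (auto simp: U_def split_beta)
    also have "\<dots> = \<bar>\<Sum>i<K. \<nu> i * fst q (x i)\<bar>" by (simp add: F_def x'_def \<nu>'_def)
    finally show "\<exists>p\<in>fst ` D. 1 / real (Suc n) < \<bar>\<Sum>i<K. \<nu> i * p (x i)\<bar>" using q(1) by auto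
  qed simp
qed

text \<open>If the mass did not charge \<open>K + 1\<close> separated balls, it would be close to a convex combination
  of \<open>K\<close> point masses, which the functions in \<open>P\<close> would detect.\<close>
lemma concentration_points:
  fixes P :: "(R4 \<Rightarrow> real) set" and K :: nat
  assumes P: "finite P" "\<And>p. p \<in> P \<Longrightarrow> continuous_on UNIV p" and e: "e > 0"
    and nondeg: "\<And>x \<nu>. (\<forall>i<K. x i \<in> sphere 0 1 \<and> 0 \<le> \<nu> i) \<Longrightarrow> (\<Sum>i<K. \<nu> i) = 1 \<Longrightarrow> \<exists>p\<in>P. e < \<bar>\<Sum>i<K. \<nu> i * p (x i)\<bar>"
  obtains r \<delta> where "0 < r" "r \<le> 1" "0 < \<delta>"
    "\<And>\<sigma> :: R4 measure. finite_measure \<sigma> \<Longrightarrow> sets \<sigma> = sets borel \<Longrightarrow> measure \<sigma> UNIV = 1 \<Longrightarrow> (AE y in \<sigma>. norm y = 1) \<Longrightarrow>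
       (\<And>p. p \<in> P \<Longrightarrow> (LINT y|\<sigma>. p y) = 0) \<Longrightarrow>
       \<exists>z :: nat \<Rightarrow> R4. (\<forall>i<Suc K. norm (z i) = 1 \<and> \<delta> \<le> measure \<sigma> (ball (z i) r)) \<and> (\<forall>i<Suc K. \<forall>j<Suc K. i \<noteq> j \<longrightarrow> 4 * r \<le> dist (z i) (z j))"
proof -
  have "\<exists>B. \<forall>x\<in>cball 0 1. \<bar>p x\<bar> \<le> B" if "p \<in> P" for p
  proof -
    have "continuous_on (cball 0 1) p" using continuous_on_subset[OF P(2)[OF that]] by blast
    then show ?thesis by (rule continuous_on_cball_bound) blast
  qed
  then have "\<forall>p\<in>P. \<exists>B. \<forall>x\<in>cball 0 1. \<bar>p x\<bar> \<le> B" by blast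
  from bchoice[OF this] obtain B' where B': "\<And>p x. p \<in> P \<Longrightarrow> x \<in> cball 0 1 \<Longrightarrow> \<bar>p x\<bar> \<le> B' p" by blast
  define B where "B = 1 + (\<Sum>p\<in>P. \<bar>B' p\<bar>)"
  have B1: "B \<ge> 1" by (simp add: B_def sum_nonneg)
  have B: "\<bar>p x\<bar> \<le> B" if "p \<in> P" "x \<in> cball 0 1" for p x
  proof -
    have "\<bar>p x\<bar> \<le> \<bar>B' p\<bar>" using B'[OF that] by linarith
    also have "\<dots> \<le> (\<Sum>p\<in>P. \<bar>B' p\<bar>)" by (rule member_le_sum) (use that P in auto)
    finally show ?thesis by (simp add: B_def)
  qed
  have "\<exists>d>0. \<forall>x\<in>cball 0 1. \<forall>y\<in>cball 0 1. dist y x < d \<longrightarrow> \<bar>p y - p x\<bar> < e / 4" if "p \<in> P" for p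
  proof -
    have "uniformly_continuous_on (cball 0 1) p"
      by (rule compact_uniformly_continuous) (use continuous_on_subset[OF P(2)[OF that]] in auto)
    moreover have "e / 4 > 0" using e by simp
    ultimately show ?thesis unfolding uniformly_continuous_on_def dist_real_def by blast
  qed
  then have "\<forall>p\<in>P. \<exists>d>0. \<forall>x\<in>cball 0 1. \<forall>y\<in>cball 0 1. dist y x < d \<longrightarrow> \<bar>p y - p x\<bar> < e / 4" by blast
  from bchoice[OF this] obtain d' where d': "\<And>p. p \<in> P \<Longrightarrow> d' p > 0" "\<And>p x y. p \<in> P \<Longrightarrow> x \<in> cball 0 1 \<Longrightarrow> y \<in> cball 0 1 \<Longrightarrow> dist y x < d' p \<Longrightarrow> \<bar>p y - p x\<bar> < e / 4"
    by blast
  define d where "d = Min (insert 1 (d' ` P))"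
  have d: "d > 0" "d \<le> 1" unfolding d_def using P(1) d'(1) by auto
  have d2: "\<bar>p y - p x\<bar> < e / 4" if "p \<in> P" "x \<in> cball 0 1" "y \<in> cball 0 1" "dist y x < d" for p x y
  proof -
    have "d \<le> d' p" unfolding d_def using P(1) that by (intro Min_le) auto
    then show ?thesis using d'(2) that by auto
  qed
  \<comment> \<open>A point outside the light balls is within \<open>r\<close> of a heavy centre,
    which is within \<open>4 * r\<close> of the chosen separated set: \<open>5 * r\<close> in all,
    matched to the modulus of continuity \<open>d\<close>.\<close>
  define r where "r = d / 5"
  have r: "0 < r" "r \<le> 1" using d by (auto simp: r_def)
  have "compact (sphere (0::R4) 1)" by simp
  then obtain C where C: "C \<subseteq> sphere (0::R4) 1" "finite C" "sphere 0 1 \<subseteq> (\<Union>c\<in>C. ball c r)"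
    by (rule compactE_image[where C="sphere (0::R4) 1" and f="\<lambda>c. ball c r"]) (use r in auto)
  \<comment> \<open>All light balls together then have mass at most \<open>e / (8 * B)\<close> and
    at most \<open>1 / 2\<close>: the first bounds the error they cause by \<open>e / 4\<close>, the
    second prevents them from carrying the full mass.\<close>
  define \<delta> where "\<delta> = min (e / (8 * B)) (1 / 2) / (real (card C) + 1)"
  have \<delta>: "\<delta> > 0" using e B1 by (simp add: \<delta>_def)
  have C\<delta>: "real (card C) * \<delta> \<le> min (e / (8 * B)) (1 / 2)"
  proof -
    have "real (card C) * \<delta> = min (e / (8 * B)) (1 / 2) * (real (card C) / (real (card C) + 1))" by (simp add: \<delta>_def)
    also have "\<dots> \<le> min (e / (8 * B)) (1 / 2) * 1" using e B1 by (intro mult_left_mono) auto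
    finally show ?thesis by simp
  qed
  show ?thesis
  proof (rule that[OF r \<delta>])
    fix \<sigma> :: "R4 measure"
    assume fin: "finite_measure \<sigma>" and sets [simp, measurable_cong]: "sets \<sigma> = sets borel" and tot: "measure \<sigma> UNIV = 1"
      and AE: "AE y in \<sigma>. norm y = 1" and orth: "\<And>p. p \<in> P \<Longrightarrow> (LINT y|\<sigma>. p y) = 0"
    interpret finite_measure \<sigma> by (rule fin)
    have sp [simp]: "space \<sigma> = UNIV" using sets_eq_imp_space_eq[OF sets] by simp
    define G where "G = {c\<in>C. \<delta> \<le> measure \<sigma> (ball c r)}"
    define sep where "sep = (\<lambda>Z :: R4 set. Z \<subseteq> G \<and> (\<forall>a\<in>Z. \<forall>b\<in>Z. a \<noteq> b \<longrightarrow> 4 * r \<le> dist a b))"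
    have "finite G" using C by (simp add: G_def)
    have "sep {}" by (simp add: sep_def)
    moreover have "\<forall>Y. sep Y \<longrightarrow> card Y < Suc (card G)"
      using card_mono[OF \<open>finite G\<close>] by (auto simp: sep_def less_Suc_eq_le)
    \<comment> \<open>A heavy centre at distance at least \<open>4 * r\<close> from all of
      \<open>Z\<close> could be added to it, so greatest cardinality makes \<open>Z\<close> dense
      among the heavy centres at scale \<open>4 * r\<close>.\<close>
    ultimately have "\<exists>Z. sep Z \<and> (\<forall>Y. sep Y \<longrightarrow> card Y \<le> card Z)"
      by (rule ex_has_greatest_nat)
    then obtain Z where Z: "sep Z" "\<And>Y. sep Y \<Longrightarrow> card Y \<le> card Z" by blast
    have ZG: "Z \<subseteq> G" using Z(1) by (simp add: sep_def)
    then have finZ: "finite Z" using \<open>finite G\<close> finite_subset by blast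
    have ZC: "norm z = 1" if "z \<in> Z" for z using that ZG C(1) by (auto simp: G_def)
    define k where "k = card Z"
    obtain x where x: "bij_betw x {..<k} Z"
      using ex_bij_betw_nat_finite[OF finZ] by (auto simp: k_def atLeast0LessThan)
    have xZ: "x i \<in> Z" if "i < k" for i using x that by (auto simp: bij_betw_def)
    show "\<exists>z :: nat \<Rightarrow> R4. (\<forall>i<Suc K. norm (z i) = 1 \<and> \<delta> \<le> measure \<sigma> (ball (z i) r)) \<and> (\<forall>i<Suc K. \<forall>j<Suc K. i \<noteq> j \<longrightarrow> 4 * r \<le> dist (z i) (z j))"
    proof (cases "Suc K \<le> k")
      case True
      have "norm (x i) = 1 \<and> \<delta> \<le> measure \<sigma> (ball (x i) r)" if "i < Suc K" for i
        using xZ[of i] ZC ZG True that by (auto simp: G_def)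
      moreover have "4 * r \<le> dist (x i) (x j)" if "i < Suc K" "j < Suc K" "i \<noteq> j" for i j
      proof -
        have "x i \<noteq> x j" using x that True by (auto simp: bij_betw_def inj_on_def)
        then show ?thesis using Z(1) xZ[of i] xZ[of j] that True by (auto simp: sep_def)
      qed
      ultimately show ?thesis by blast
    next
      case False
      then have kK: "k \<le> K" by simp
      define bad where "bad = (\<Union>c\<in>C - G. ball c r)"
      have [measurable]: "bad \<in> sets borel" unfolding bad_def by (intro borel_open open_UN) auto
      have mbad: "measure \<sigma> bad \<le> min (e / (8 * B)) (1 / 2)"
      proof -
        have "measure \<sigma> bad \<le> (\<Sum>c\<in>C - G. measure \<sigma> (ball c r))"
          unfolding bad_def by (rule finite_measure_subadditive_finite) (use C in auto)
        also have "\<dots> \<le> (\<Sum>c\<in>C - G. \<delta>)" by (intro sum_mono) (auto simp: G_def)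
        also have "\<dots> \<le> real (card C) * \<delta>"
          using \<delta> card_mono[of C "C - G"] C(2) by simp
        also note C\<delta>
        finally show ?thesis .
      qed
      have near: "\<exists>i<k. dist (x i) y < 5 * r" if y: "norm y = 1" "y \<notin> bad" for y
      proof -
        obtain c where c: "c \<in> C" "y \<in> ball c r" using C(3) y by auto
        then have cG: "c \<in> G" using y by (auto simp: bad_def)
        have "\<exists>z\<in>Z. dist z c < 4 * r"
        proof (rule ccontr)
          assume "\<not> ?thesis"
          then have far: "4 * r \<le> dist z c" if "z \<in> Z" for z using that by force
          then have "c \<notin> Z" using r by force
          have "sep (insert c Z)" using Z(1) cG far by (auto simp: sep_def dist_commute)
          then have "card (insert c Z) \<le> card Z" by (rule Z(2))
          then show False using \<open>c \<notin> Z\<close> finZ by simp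
        qed
        then obtain z where z: "z \<in> Z" "dist z c < 4 * r" by blast
        have "z \<in> x ` {..<k}" using x z(1) by (auto simp: bij_betw_def)
        then obtain i where "i < k" "x i = z" by auto
        moreover have "dist z y < 5 * r" using z c dist_triangle[of z y c] by auto
        ultimately show ?thesis by auto
      qed
      have "k > 0"
      proof (rule ccontr)
        assume "\<not> k > 0"
        then have "AE y in \<sigma>. y \<in> bad" using AE near by (auto elim!: eventually_mono)
        then have "measure \<sigma> bad = measure \<sigma> UNIV"
          by (intro finite_measure_eq_AE) auto
        then show False using mbad tot by simp
      qed
      define near_i where "near_i = (\<lambda>y i. i < k \<and> dist (x i) y < 5 * r)"
      \<comment> \<open>The least index makes the choice of a near centre measurable. The default 0
        is a valid index because \<open>k > 0\<close>; on the sphere it is taken by default only at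
        points of \<open>bad\<close>.\<close>
      define ix where "ix = (\<lambda>y. if \<exists>i. near_i y i then (LEAST i. near_i y i) else 0)"
      have ixk: "ix y < k" for y
      proof (cases "\<exists>i. near_i y i")
        case True
        then have "near_i y (LEAST i. near_i y i)" by (rule LeastI_ex)
        then show ?thesis using True by (simp add: ix_def near_i_def)
      qed (use \<open>k > 0\<close> in \<open>auto simp: ix_def\<close>)
      have ixnear: "dist (x (ix y)) y < 5 * r" if "norm y = 1" "y \<notin> bad" for y
      proof -
        have ex: "\<exists>i. near_i y i" using near[OF that] by (auto simp: near_i_def)
        then have "near_i y (LEAST i. near_i y i)" by (rule LeastI_ex)
        then show ?thesis using ex by (simp add: ix_def near_i_def)
      qed
      have ixm [measurable]: "ix \<in> measurable borel (count_space UNIV)"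
        unfolding ix_def near_i_def by measurable
      define \<nu> where "\<nu> = (\<lambda>i. measure \<sigma> {y. ix y = i})"
      \<comment> \<open>If \<open>k < K\<close>, the list is padded by repeating \<open>x 0\<close>;
        the extra weights are 0, since \<open>ix\<close> stays below \<open>k\<close>.\<close>
      define x' where "x' = (\<lambda>i. if i < k then x i else x 0)"
      have x'n: "norm (x' i) = 1" for i using xZ ZC \<open>k > 0\<close> by (auto simp: x'_def)
      have x'x: "x' (ix y) = x (ix y)" for y using ixk by (simp add: x'_def)
      have [measurable]: "{y. ix y = i} \<in> sets borel" for i by measurable
      have simple: "(LINT y|\<sigma>. q (ix y)) = (\<Sum>i<K. \<nu> i * q i)" for q :: "nat \<Rightarrow> real"
      proof -
        have "q (ix y) = (\<Sum>i<K. q i * indicator {y. ix y = i} y)" for y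
        proof -
          have "(\<Sum>i<K. q i * indicator {y. ix y = i} y) = (\<Sum>i<K. if i = ix y then q i else 0)"
            by (intro sum.cong) (auto simp: indicator_def)
          also have "\<dots> = q (ix y)" using ixk[of y] kK by (subst sum.delta) auto
          finally show ?thesis ..
        qed
        then have "(LINT y|\<sigma>. q (ix y)) = (LINT y|\<sigma>. (\<Sum>i<K. q i * indicator {y. ix y = i} y))" by simp
        also have "\<dots> = (\<Sum>i<K. LINT y|\<sigma>. q i * indicator {y. ix y = i} y)"
          by (intro Bochner_Integration.integral_sum integrable_mult_right integrable_real_indicator) (auto simp: emeasure_finite less_top[symmetric])
        also have "\<dots> = (\<Sum>i<K. \<nu> i * q i)" by (simp add: \<nu>_def mult.commute)
        finally show ?thesis .
      qed
      have "(\<Sum>i<K. \<nu> i) = 1" using simple[of "\<lambda>_. 1"] tot by simp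
      moreover have "\<forall>i<K. x' i \<in> sphere 0 1 \<and> 0 \<le> \<nu> i" using x'n by (simp add: \<nu>_def)
      ultimately obtain p where p: "p \<in> P" "e < \<bar>\<Sum>i<K. \<nu> i * p (x' i)\<bar>" using nondeg by blast
      have pm [measurable]: "p \<in> borel_measurable borel" using P(2)[OF p(1)] by (rule borel_measurable_continuous_onI)
      have pint: "integrable \<sigma> p"
        by (rule integrable_const_bound[where B=B]) (use AE B[OF p(1)] in \<open>auto elim!: eventually_mono\<close>)
      have qm [measurable]: "(\<lambda>y. p (x' (ix y))) \<in> borel_measurable borel"
        by (rule measurable_compose[OF ixm]) simp
      have qint: "integrable \<sigma> (\<lambda>y. p (x' (ix y)))"
        by (rule integrable_const_bound[where B=B]) (use B[OF p(1)] x'n in auto)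
      have "\<bar>\<Sum>i<K. \<nu> i * p (x' i)\<bar> = \<bar>(LINT y|\<sigma>. p (x' (ix y))) - (LINT y|\<sigma>. p y)\<bar>"
        using simple[of "\<lambda>i. p (x' i)"] orth[OF p(1)] by simp
      also have "\<dots> = \<bar>LINT y|\<sigma>. p (x' (ix y)) - p y\<bar>"
        by (subst Bochner_Integration.integral_diff[OF qint pint]) simp
      also have "\<dots> \<le> (LINT y|\<sigma>. \<bar>p (x' (ix y)) - p y\<bar>)" by (rule integral_abs_bound)
      also have "\<dots> \<le> (LINT y|\<sigma>. e / 4 + 2 * B * indicator bad y)"
      proof (rule integral_mono_AE)
        show "integrable \<sigma> (\<lambda>y. \<bar>p (x' (ix y)) - p y\<bar>)"
          by (intro integrable_abs Bochner_Integration.integrable_diff qint pint)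
        show "integrable \<sigma> (\<lambda>y. e / 4 + 2 * B * indicator bad y)"
          by (intro Bochner_Integration.integrable_add integrable_const integrable_mult_right integrable_real_indicator) (auto simp: emeasure_finite less_top[symmetric])
        show "AE y in \<sigma>. \<bar>p (x' (ix y)) - p y\<bar> \<le> e / 4 + 2 * B * indicator bad y"
          using AE
        proof eventually_elim
          case (elim y)
          show ?case
          proof (cases "y \<in> bad")
            case True
            have "\<bar>p (x' (ix y)) - p y\<bar> \<le> \<bar>p (x' (ix y))\<bar> + \<bar>p y\<bar>" by (rule abs_triangle_ineq4)
            also have "\<dots> \<le> B + B" using x'n elim by (intro add_mono B p) auto
            finally show ?thesis using True e by simp
          next
            case False
            have "dist (x' (ix y)) y < d" using ixnear[OF elim False] by (simp add: x'x r_def)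
            then have "\<bar>p (x' (ix y)) - p y\<bar> < e / 4" using x'n elim by (intro d2 p) auto
            then show ?thesis using False by simp
          qed
        qed
      qed
      also have "\<dots> = e / 4 + 2 * B * measure \<sigma> bad"
      proof -
        have i: "integrable \<sigma> (\<lambda>y. 2 * B * indicator bad y)"
          by (intro integrable_mult_right integrable_real_indicator) (auto simp: emeasure_finite less_top[symmetric])
        show ?thesis by (subst Bochner_Integration.integral_add[OF integrable_const i]) (simp add: tot)
      qed
      also have "\<dots> \<le> e / 4 + 2 * B * (e / (8 * B))" using mbad B1 by (intro add_left_mono mult_left_mono) auto
      also have "\<dots> \<le> e" using B1 e by simp
      finally show ?thesis using p(2) by simp
    qed
  qed
qed

section \<open>The inequality\<close>

text \<open>Only the origin, a single point of the ball, is not projected to the sphere.\<close>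

lemma sphere_integral_cong:
  assumes "\<And>x. norm x = 1 \<Longrightarrow> g x = h x"
  shows "sphere_integral g = sphere_integral h"
proof -
  have "integral (ball 0 1) (\<lambda>x. g (x /\<^sub>R norm x)) = integral (ball 0 1) (\<lambda>x. h (x /\<^sub>R norm x))"
    by (rule integral_spike[where S="{0}"]) (use assms in auto)
  then show ?thesis by (simp add: sphere_integral_def)
qed

text \<open>For a non-integrable function the gauge integral has the default value 0, which is still
  nonnegative. This provides the lower bound 0 for the gradient term of the inequality.\<close>

lemma sphere_integral_nonneg:
  assumes "\<And>x. 0 \<le> g x"
  shows "0 \<le> sphere_integral g"
proof (cases "(\<lambda>x. g (x /\<^sub>R norm x)) integrable_on ball 0 1")
  case True
  then have "0 \<le> integral (ball 0 1) (\<lambda>x. g (x /\<^sub>R norm x))"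
    by (rule Henstock_Kurzweil_Integration.integral_nonneg) (use assms in auto)
  then show ?thesis by (simp add: sphere_integral_def)
qed (simp add: sphere_integral_def not_integrable_integral)

lemma continuous_on_polys:
  assumes "p \<in> polys m"
  shows "continuous_on UNIV p"
proof -
  obtain c where "p = (\<lambda>x. \<Sum>\<alpha>\<in>{\<alpha>. (\<Sum>i\<in>UNIV. \<alpha> i) \<le> m}. c \<alpha> * (\<Prod>i\<in>UNIV. (x $ i) ^ \<alpha> i))"
    using assms by (auto simp: polys_def)
  then show ?thesis by (simp only:) (intro continuous_intros)
qed

text \<open>The case distinction covers the junk value that \<open>N_m m\<close> would have if no cubature formula existed:
  then every \<open>K\<close> is nondegenerate, and a large one gives the bound.\<close>
lemma nondegenerate_below_N_m:
  assumes "\<epsilon> > 0"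
  obtains K :: nat where
    "\<And>x \<nu>. (\<forall>i<K. x i \<in> sphere 0 1 \<and> 0 \<le> \<nu> i) \<Longrightarrow> (\<Sum>i<K. \<nu> i) = 1 \<Longrightarrow> \<exists>p\<in>polys0 m. (\<Sum>i<K. \<nu> i * p (x i)) \<noteq> (0::real)"
    "3 / (16 * pi\<^sup>2 * real (Suc K)) \<le> 3 / (16 * pi\<^sup>2 * real (N_m m)) + \<epsilon>"
proof -
  define Q where "Q = (\<lambda>N. \<exists>(x :: nat \<Rightarrow> R4) (\<nu> :: nat \<Rightarrow> real).
      (\<forall>i<N. x i \<in> sphere 0 1 \<and> \<nu> i \<ge> 0) \<and> (\<Sum>i<N. \<nu> i) = 1 \<and>
      (\<forall>p\<in>polys0 m. (\<Sum>i<N. \<nu> i * p (x i)) = 0))"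
  have N: "N_m m = (LEAST N. Q N)" by (simp add: N_m_def Q_def)
  have nQ: "\<exists>p\<in>polys0 m. (\<Sum>i<K. \<nu> i * p (x i)) \<noteq> 0"
    if "\<not> Q K" "\<forall>i<K. x i \<in> sphere 0 1 \<and> 0 \<le> \<nu> i" "(\<Sum>i<K. \<nu> i) = 1" for K x and \<nu> :: "nat \<Rightarrow> real"
    using that unfolding Q_def by blast
  show ?thesis
  proof (cases "\<exists>N. Q N")
    case True
    then have "Q (N_m m)" unfolding N by (rule LeastI_ex)
    \<comment> \<open>The empty sum of weights is 0 and not 1, so \<open>N_m m\<close> is a
      successor \<open>Suc K\<close>, and \<open>K\<close> points do not suffice by
      minimality.\<close>
    moreover have "\<not> Q 0" by (simp add: Q_def)
    ultimately obtain K where K: "N_m m = Suc K" by (metis not0_implies_Suc)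
    then have "\<not> Q K" using not_less_Least[of K Q] N by simp
    then show ?thesis using nQ assms K by (intro that[of K]) auto
  next
    case False
    \<comment> \<open>Large enough for \<open>3 / (16 * pi^2 * (K + 1))\<close> to be at most
      \<epsilon>, because \<open>3 \<le> 16 * pi^2\<close>.\<close>
    define K where "K = nat \<lceil>1 / \<epsilon>\<rceil>"
    have "1 / \<epsilon> \<le> real (Suc K)" unfolding K_def by linarith
    then have "1 \<le> \<epsilon> * real (Suc K)" using assms by (simp add: field_simps)
    moreover have "3 \<le> 16 * pi\<^sup>2"
    proof -
      have "1 \<le> pi\<^sup>2" using pi_ge_two by (intro one_le_power) linarith
      then show ?thesis by linarith
    qed
    ultimately have "3 * 1 \<le> (16 * pi\<^sup>2) * (\<epsilon> * real (Suc K))" by (intro mult_mono) auto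
    then have "3 / (16 * pi\<^sup>2 * real (Suc K)) \<le> \<epsilon>"
      by (subst pos_divide_le_eq) (simp_all add: mult_ac del: of_nat_Suc)
    moreover have "0 \<le> 3 / (16 * pi\<^sup>2 * real (N_m m))" by simp
    ultimately have "3 / (16 * pi\<^sup>2 * real (Suc K)) \<le> 3 / (16 * pi\<^sup>2 * real (N_m m)) + \<epsilon>" by linarith
    then show ?thesis using nQ False by (intro that[of K]) auto
  qed
qed

theorem mainTheorem5:
  fixes m :: nat
  shows "\<forall>\<epsilon>>0. \<exists>C::real. \<forall>(f :: R4 \<Rightarrow> real) (u :: R4 \<Rightarrow> real).
    smooth_sphere f \<and>
    (\<forall>p\<in>polys0 m. sphere_integral (\<lambda>x. p x * exp (3 * f x)) = 0) \<and>
    smooth_closed_ball u \<and>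
    (\<forall>x\<in>sphere 0 1. u x = f x \<and> radial_deriv u x = 0)
    \<longrightarrow>
    ln (1 / (2 * pi\<^sup>2) * sphere_integral
          (\<lambda>x. exp (3 * (f x - sphere_integral f / (2 * pi\<^sup>2)))))
    \<le> (3 / (16 * pi\<^sup>2 * real (N_m m)) + \<epsilon>) *
        (integral (ball 0 1) (\<lambda>x. (laplacian u x)\<^sup>2) + 2 * sphere_integral (sph_grad_sq f))
      + C"
proof (intro allI impI)
  fix \<epsilon> :: real assume \<epsilon>: "\<epsilon> > 0"
  obtain K where K: "\<And>x \<nu>. (\<forall>i<K. x i \<in> sphere 0 1 \<and> 0 \<le> \<nu> i) \<Longrightarrow> (\<Sum>i<K. \<nu> i) = 1 \<Longrightarrow> \<exists>p\<in>polys0 m. (\<Sum>i<K. \<nu> i * p (x i)) \<noteq> (0::real)"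
    "3 / (16 * pi\<^sup>2 * real (Suc K)) \<le> 3 / (16 * pi\<^sup>2 * real (N_m m)) + \<epsilon> / 2"
    using nondegenerate_below_N_m[of "\<epsilon> / 2" m] \<epsilon> by auto
  have cpoly: "continuous_on UNIV p" if "p \<in> polys0 m" for p
    using that continuous_on_polys[of p m] by (auto simp: polys0_def)
  obtain P e where P: "finite P" "P \<subseteq> polys0 m" "e > 0"
    "\<And>x \<nu>. (\<forall>i<K. x i \<in> sphere 0 1 \<and> 0 \<le> \<nu> i) \<Longrightarrow> (\<Sum>i<K. \<nu> i) = 1 \<Longrightarrow> \<exists>p\<in>P. e < \<bar>\<Sum>i<K. \<nu> i * p (x i)\<bar>"
  proof (rule uniform_nondegeneracy[where Q="polys0 m" and K=K])
    show "continuous_on UNIV p" if "p \<in> polys0 m" for p by (rule cpoly[OF that])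
    show "\<exists>p\<in>polys0 m. (\<Sum>i<K. \<nu> i * p (x i)) \<noteq> 0"
      if "\<forall>i<K. x i \<in> sphere 0 1 \<and> 0 \<le> \<nu> i" "(\<Sum>i<K. \<nu> i) = 1" for x and \<nu> :: "nat \<Rightarrow> real"
      by (rule K(1)[OF that])
  qed (rule that)
  have cP: "continuous_on UNIV p" if "p \<in> P" for p using cpoly P(2) that by auto
  obtain r \<delta> where r: "0 < r" "r \<le> 1" and \<delta>: "0 < \<delta>" and conc:
    "\<And>\<sigma> :: R4 measure. finite_measure \<sigma> \<Longrightarrow> sets \<sigma> = sets borel \<Longrightarrow> measure \<sigma> UNIV = 1 \<Longrightarrow> (AE y in \<sigma>. norm y = 1) \<Longrightarrow>
       (\<And>p. p \<in> P \<Longrightarrow> (LINT y|\<sigma>. p y) = 0) \<Longrightarrow>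
       \<exists>z :: nat \<Rightarrow> R4. (\<forall>i<Suc K. norm (z i) = 1 \<and> \<delta> \<le> measure \<sigma> (ball (z i) r)) \<and> (\<forall>i<Suc K. \<forall>j<Suc K. i \<noteq> j \<longrightarrow> 4 * r \<le> dist (z i) (z j))"
  proof (rule concentration_points[where P=P and K=K and e=e])
    show "\<exists>p\<in>P. e < \<bar>\<Sum>i<K. \<nu> i * p (x i)\<bar>"
      if "\<forall>i<K. x i \<in> sphere 0 1 \<and> 0 \<le> \<nu> i" "(\<Sum>i<K. \<nu> i) = 1" for x and \<nu> :: "nat \<Rightarrow> real"
      by (rule P(4)[OF that])
    show "continuous_on UNIV p" if "p \<in> P" for p by (rule cP[OF that])
    show "finite P" "0 < e" by (rule P)+
  qed (erule (2) that, blast)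
  define k where "k = Suc K"
  \<comment> \<open>The cap 1 gives \<open>(1 + \<eta>)^2 \<le> 1 + 3 * \<eta>\<close>, and
    \<open>\<epsilon> / 12\<close> keeps the excess \<open>3 * \<eta>\<close> below
    \<open>\<epsilon> / 4\<close>.\<close>
  define \<eta> where "\<eta> = min 1 (\<epsilon> / 12)"
  have \<eta>: "0 < \<eta>" "\<eta> \<le> 1" "3 * \<eta> \<le> \<epsilon> / 4" using \<epsilon> by (auto simp: \<eta>_def)
  define K\<^sub>\<eta> where "K\<^sub>\<eta> = 2 * pi\<^sup>2 * exp 3 + exp 3 / (1 - exp (- 3 * \<eta>))"
  have K\<eta>: "K\<^sub>\<eta> > 0" using \<eta> by (simp add: K\<^sub>\<eta>_def add_pos_nonneg)
  define c where "c = 563 + 1 / (2 * r\<^sup>2)"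
  define \<kappa> where "\<kappa> = 3 / (16 * pi\<^sup>2)"
  have \<kappa>: "0 \<le> \<kappa>" "\<kappa> \<le> 1"
  proof -
    have "1 \<le> pi\<^sup>2" using pi_ge_two by (intro one_le_power) linarith
    then show "0 \<le> \<kappa>" "\<kappa> \<le> 1" by (auto simp: \<kappa>_def)
  qed
  \<comment> \<open>The 4 pays for the summand 1 in \<open>a^2\<close>, as
    \<open>(1 + 3 * \<eta>) * \<kappa> \<le> 4\<close>; the last two terms come from
    \<open>3 * c * A \<le> \<epsilon> / 4 * A^2 + 9 * c^2 / \<epsilon>\<close> with
    \<open>A^2 = E + 1\<close>.\<close>
  define C where "C = ln (K\<^sub>\<eta> / (2 * pi\<^sup>2 * \<delta>)) + 4 + \<epsilon> / 4 + 9 * c\<^sup>2 / \<epsilon>"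
  show "\<exists>C::real. \<forall>(f :: R4 \<Rightarrow> real) (u :: R4 \<Rightarrow> real).
    smooth_sphere f \<and>
    (\<forall>p\<in>polys0 m. sphere_integral (\<lambda>x. p x * exp (3 * f x)) = 0) \<and>
    smooth_closed_ball u \<and>
    (\<forall>x\<in>sphere 0 1. u x = f x \<and> radial_deriv u x = 0)
    \<longrightarrow>
    ln (1 / (2 * pi\<^sup>2) * sphere_integral
          (\<lambda>x. exp (3 * (f x - sphere_integral f / (2 * pi\<^sup>2)))))
    \<le> (3 / (16 * pi\<^sup>2 * real (N_m m)) + \<epsilon>) *
        (integral (ball 0 1) (\<lambda>x. (laplacian u x)\<^sup>2) + 2 * sphere_integral (sph_grad_sq f))
      + C"
  proof (intro exI[of _ C] allI impI, elim conjE)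
    fix f u :: "R4 \<Rightarrow> real"
    assume orth: "\<forall>p\<in>polys0 m. sphere_integral (\<lambda>x. p x * exp (3 * f x)) = 0"
      and su: "smooth_closed_ball u" and bc: "\<forall>x\<in>sphere 0 1. u x = f x \<and> radial_deriv u x = 0"
    interpret neumann u by unfold_locales (use su bc in auto)
    have uf: "f x = u x" if "norm x = 1" for x using bc that by auto
    define ub where "ub = sphere_integral u / (2 * pi\<^sup>2)"
    have fb: "sphere_integral f / (2 * pi\<^sup>2) = ub" unfolding ub_def using sphere_integral_cong[of f u] uf by simp
    define E where "E = (LINT y|lborel. indicator (ball 0 1) y * (laplacian u y)\<^sup>2)"
    have li: "integrable lborel (\<lambda>y. indicator (ball 0 1) y * (laplacian u y)\<^sup>2)"
      by (intro integrable_ball_continuous continuous_intros continuous_laplacian)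
    have EI: "integral (ball 0 1) (\<lambda>x. (laplacian u x)\<^sup>2) = E"
      unfolding E_def by (rule integral_ball_continuous) (intro continuous_intros continuous_laplacian)
    have E0: "E \<ge> 0" unfolding E_def by (rule Bochner_Integration.integral_nonneg) simp
    have cu: "continuous_on (sphere 0 1) u" by (rule continuous_on_subset[OF continuous_u]) auto
    obtain B where B: "B \<ge> 0" "\<And>x. x \<in> cball 0 1 \<Longrightarrow> \<bar>u x\<bar> \<le> B"
      using continuous_on_cball_bound[OF continuous_u] by blast
    define w where "w = (\<lambda>x. indicator (sphere 0 1) x * exp (3 * u x))"
    have ce: "continuous_on (sphere 0 1) (\<lambda>x. exp (3 * u x))" by (intro continuous_intros cu)
    have wm [measurable]: "w \<in> borel_measurable borel" unfolding w_def by (rule integral_S3_indicator(3)[OF ce])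
    have wi: "integrable S3 w" unfolding w_def by (rule integral_S3_indicator(1)[OF ce])
    have w0: "w x \<ge> 0" for x by (simp add: w_def)
    define Z where "Z = (LINT x|S3. w x)"
    have Z: "Z > 0"
    proof -
      have "0 < (LINT x|S3. exp (- 3 * B))" by (simp add: measure_S3_UNIV)
      also have "\<dots> \<le> (LINT x|S3. w x)"
      proof (rule integral_mono_AE[OF S3.integrable_const wi])
        show "AE x in S3. exp (- 3 * B) \<le> w x" using AE_S3
        proof eventually_elim
          case (elim x)
          have "- 3 * B \<le> 3 * u x" using B(2)[of x] elim by auto
          then show ?case using elim by (simp add: w_def)
        qed
      qed
      finally show ?thesis by (simp add: Z_def)
    qed
    define Tot where "Tot = exp (- 3 * ub) * Z"
    have Tot: "Tot > 0" using Z by (simp add: Tot_def)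
    have TotI: "sphere_integral (\<lambda>x. exp (3 * (f x - sphere_integral f / (2 * pi\<^sup>2)))) = Tot"
    proof -
      have "sphere_integral (\<lambda>x. exp (3 * (f x - sphere_integral f / (2 * pi\<^sup>2)))) = sphere_integral (\<lambda>x. exp (3 * (u x - ub)))"
        by (rule sphere_integral_cong) (simp add: fb uf)
      also have "\<dots> = (LINT x|S3. indicator (sphere 0 1) x * exp (3 * (u x - ub)))"
        by (rule integral_S3_indicator(2)) (intro continuous_intros cu)
      also have "\<dots> = (LINT x|S3. exp (- 3 * ub) * w x)"
        by (intro Bochner_Integration.integral_cong) (auto simp: w_def exp_add[symmetric] right_diff_distrib indicator_def)
      also have "\<dots> = Tot" by (simp add: Tot_def Z_def)
      finally show ?thesis .
    qed
    \<comment> \<open>The probability measure proportional to \<open>exp (3 * u)\<close> on the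
      sphere; the moment condition says that it annihilates the functions in
      \<open>P\<close>.\<close>
    define \<sigma> where "\<sigma> = density S3 (\<lambda>x. ennreal (w x / Z))"
    have \<sigma>s: "sets \<sigma> = sets borel" by (simp add: \<sigma>_def)
    have \<sigma>1: "emeasure \<sigma> UNIV = 1"
    proof -
      have "emeasure \<sigma> UNIV = (\<integral>\<^sup>+x. ennreal (w x / Z) \<partial>S3)"
        unfolding \<sigma>_def by (subst emeasure_density) auto
      also have "\<dots> = ennreal (LINT x|S3. w x / Z)"
        by (rule nn_integral_eq_integral) (use wi w0 Z in auto)
      also have "(LINT x|S3. w x / Z) = 1" using Z by (simp add: Z_def)
      finally show ?thesis by simp
    qed
    have "finite_measure \<sigma>"
      by (rule finite_measureI) (simp add: sets_eq_imp_space_eq[OF \<sigma>s] \<sigma>1)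
    moreover have "measure \<sigma> UNIV = 1" by (simp add: measure_def \<sigma>1)
    moreover have "AE y in \<sigma>. norm y = 1"
      unfolding \<sigma>_def by (subst AE_density) (use AE_S3 in \<open>auto elim: eventually_mono\<close>)
    moreover have "(LINT y|\<sigma>. p y) = 0" if "p \<in> P" for p
    proof -
      have [measurable]: "p \<in> borel_measurable borel" using cP[OF that] by (rule borel_measurable_continuous_onI)
      have "(LINT y|\<sigma>. p y) = (LINT y|S3. (w y / Z) *\<^sub>R p y)"
        unfolding \<sigma>_def by (rule integral_density) (use w0 Z in auto)
      also have "\<dots> = (LINT y|S3. 1 / Z * (indicator (sphere 0 1) y * (p y * exp (3 * u y))))"
        by (intro Bochner_Integration.integral_cong) (auto simp: w_def)
      also have "\<dots> = 1 / Z * (LINT y|S3. indicator (sphere 0 1) y * (p y * exp (3 * u y)))"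
        by (rule integral_mult_right_zero)
      also have "(LINT y|S3. indicator (sphere 0 1) y * (p y * exp (3 * u y))) = sphere_integral (\<lambda>y. p y * exp (3 * u y))"
        using continuous_on_subset[OF cP[OF that]]
        by (intro integral_S3_indicator(2)[symmetric] continuous_intros cu) auto
      also have "\<dots> = sphere_integral (\<lambda>y. p y * exp (3 * f y))"
        by (rule sphere_integral_cong) (simp add: uf)
      also have "\<dots> = 0" using orth P(2) that by auto
      finally show ?thesis by simp
    qed
    ultimately obtain z :: "nat \<Rightarrow> R4" where z: "\<And>i. i < k \<Longrightarrow> norm (z i) = 1" "\<And>i. i < k \<Longrightarrow> \<delta> \<le> measure \<sigma> (ball (z i) r)"
      "\<And>i j. i < k \<Longrightarrow> j < k \<Longrightarrow> i \<noteq> j \<Longrightarrow> 4 * r \<le> dist (z i) (z j)"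
      using conc[OF _ \<sigma>s] unfolding k_def by metis
    define \<Omega> where "\<Omega> = (\<lambda>i. ball (z i) r \<inter> sphere 0 1)"
    \<comment> \<open>The region whose energy governs \<open>\<Omega> i\<close>. It lies in the ball
      of radius \<open>2 * r\<close> about \<open>z i\<close>, so centres \<open>4 * r\<close> apart
      give disjoint regions.\<close>
    define W where "W = (\<lambda>i. ball (0::R4) 1 \<inter> (\<Union>x\<in>\<Omega> i. ball x r))"
    have \<Omega>m [measurable]: "\<Omega> i \<in> sets borel" for i by (simp add: \<Omega>_def borel_closed)
    have Wm [measurable]: "W i \<in> sets borel" for i
      unfolding W_def by (intro sets.Int borel_open open_UN) auto
    have W2: "y \<in> ball (z i) (2 * r)" if yW: "y \<in> W i" for y i
    proof -
      obtain x where "dist (z i) x < r" "dist x y < r" using yW by (auto simp: W_def \<Omega>_def)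
      then show ?thesis using dist_triangle[of "z i" y x] by auto
    qed
    have disj: "disjoint_family_on W {..<k}"
      unfolding disjoint_family_on_def
    proof (intro ballI impI)
      fix i j assume ij: "i \<in> {..<k}" "j \<in> {..<k}" "i \<noteq> j"
      show "W i \<inter> W j = {}"
      proof (rule ccontr)
        assume "W i \<inter> W j \<noteq> {}"
        then obtain y where "y \<in> W i" "y \<in> W j" by auto
        then have "dist (z i) y < 2 * r" "dist (z j) y < 2 * r" using W2 by auto
        then have "dist (z i) (z j) < 4 * r" using dist_triangle2[of "z i" "z j" y] by simp
        then show False using z(3)[of i j] ij by auto
      qed
    qed
    define I where "I = (\<lambda>i. LINT y|lborel. indicator (W i) y * (laplacian u y)\<^sup>2)"
    have Wi: "integrable lborel (\<lambda>y. indicator (W i) y * (laplacian u y)\<^sup>2)" for i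
    proof -
      have "integrable lborel (\<lambda>y. indicator (W i) y * (indicator (ball 0 1) y * (laplacian u y)\<^sup>2))"
      proof (rule Bochner_Integration.integrable_bound[OF li])
        show "(\<lambda>y. indicator (W i) y * (indicator (ball 0 1) y * (laplacian u y)\<^sup>2)) \<in> borel_measurable lborel"
          by (rule borel_measurable_times[OF _ borel_measurable_integrable[OF li]]) measurable
      qed (auto simp: indicator_def)
      moreover have "indicator (W i) y * (indicator (ball 0 1) y * (laplacian u y)\<^sup>2) = indicator (W i) y * (laplacian u y)\<^sup>2" for y
        by (auto simp: W_def indicator_def)
      ultimately show ?thesis by simp
    qed
    have "(\<Sum>i<k. I i) = (LINT y|lborel. (\<Sum>i<k. indicator (W i) y * (laplacian u y)\<^sup>2))"
      unfolding I_def by (rule Bochner_Integration.integral_sum[symmetric]) (rule Wi)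
    also have "\<dots> \<le> E" unfolding E_def
    proof (rule integral_mono)
      show "integrable lborel (\<lambda>y. \<Sum>i<k. indicator (W i) y * (laplacian u y)\<^sup>2)"
        by (intro Bochner_Integration.integrable_sum Wi)
      fix y
      have "(\<Sum>i<k. indicator (W i) y) = (indicator (\<Union>(W ` {..<k})) y :: real)"
        by (rule indicator_UN_disjoint[symmetric, OF _ disj]) simp
      also have "\<dots> \<le> indicator (ball 0 1) y" by (auto simp: W_def indicator_def)
      finally show "(\<Sum>i<k. indicator (W i) y * (laplacian u y)\<^sup>2) \<le> indicator (ball 0 1) y * (laplacian u y)\<^sup>2"
        unfolding sum_distrib_right[symmetric] by (rule mult_right_mono) simp
    qed (rule li)
    finally have sumI: "(\<Sum>i<k. I i) \<le> E" .
    \<comment> \<open>Each of the \<open>k\<close> balls carries the fraction \<delta> of the mass,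
      so the one with the least local energy may be chosen; this is where the factor
      \<open>1 / k\<close> arises.\<close>
    have "\<exists>i<k. I i \<le> E / real k"
    proof (rule ccontr)
      assume "\<not> ?thesis"
      then have "(\<Sum>i<k. E / real k) < (\<Sum>i<k. I i)" by (intro sum_strict_mono) (auto simp: k_def)
      then show False using sumI by (simp add: k_def)
    qed
    then obtain i where i: "i < k" "I i \<le> E / real k" by blast
    \<comment> \<open>Adding 1 keeps \<open>a\<close> and \<open>A\<close> positive, as
      \<open>local_exp_bound\<close> requires, even when the Laplacian vanishes.\<close>
    define a where "a = sqrt (E / real k + 1)"
    define A where "A = sqrt (E + 1)"
    have a2: "a\<^sup>2 = E / real k + 1" and A2: "A\<^sup>2 = E + 1" using E0 by (auto simp: a_def A_def)
    have aA: "0 < a" "a \<le> A"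
    proof -
      show "0 < a" unfolding a_def using E0 by (simp add: add_nonneg_pos)
      have "E / real k \<le> E" using E0 divide_left_mono[of 1 "real k" E] by (simp add: k_def)
      then show "a \<le> A" by (simp add: a_def A_def)
    qed
    define R where "R = K\<^sub>\<eta> * exp ((1 + \<eta>)\<^sup>2 * \<kappa> * a\<^sup>2) * exp (3 * c * A)"
    have R0: "R > 0" using K\<eta> by (simp add: R_def)
    have le1: "(\<integral>\<^sup>+x. ennreal (exp (3 * (u x - ub))) * indicator (\<Omega> i) x \<partial>S3) \<le> ennreal R"
      unfolding R_def K\<^sub>\<eta>_def \<kappa>_def c_def ub_def
    proof (rule local_exp_bound[OF \<eta>(1) r aA])
      show "(LINT y|lborel. indicator (ball 0 1) y * (laplacian u y)\<^sup>2) \<le> A\<^sup>2" unfolding A2 using E_def by simp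
      show "\<Omega> i \<subseteq> sphere 0 1" by (auto simp: \<Omega>_def)
      show "(LINT y|lborel. indicator (ball 0 1 \<inter> (\<Union>x\<in>\<Omega> i. ball x r)) y * (laplacian u y)\<^sup>2) \<le> a\<^sup>2"
        unfolding a2 using i(2) by (simp add: I_def W_def)
    qed simp
    have le2: "ennreal (\<delta> * Tot) \<le> (\<integral>\<^sup>+x. ennreal (exp (3 * (u x - ub))) * indicator (\<Omega> i) x \<partial>S3)"
    proof -
      interpret \<sigma>: finite_measure \<sigma> by fact
      have "ennreal (\<delta> * Tot) \<le> ennreal (Tot * measure \<sigma> (ball (z i) r))"
        using z(2)[OF i(1)] Tot by (intro ennreal_leI) (simp add: mult.commute)
      also have "\<dots> = ennreal Tot * emeasure \<sigma> (ball (z i) r)"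
        using Tot by (simp add: ennreal_mult' \<sigma>.emeasure_eq_measure)
      also have "\<dots> = ennreal Tot * (\<integral>\<^sup>+x. ennreal (w x / Z) * indicator (ball (z i) r) x \<partial>S3)"
        unfolding \<sigma>_def by (subst emeasure_density) auto
      also have "\<dots> = (\<integral>\<^sup>+x. ennreal Tot * (ennreal (w x / Z) * indicator (ball (z i) r) x) \<partial>S3)"
        by (rule nn_integral_cmult[symmetric]) measurable
      also have "\<dots> = (\<integral>\<^sup>+x. ennreal (exp (3 * (u x - ub))) * indicator (\<Omega> i) x \<partial>S3)"
      proof (rule nn_integral_cong)
        fix x
        show "ennreal Tot * (ennreal (w x / Z) * indicator (ball (z i) r) x) = ennreal (exp (3 * (u x - ub))) * indicator (\<Omega> i) x"
        proof (cases "x \<in> \<Omega> i")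
          case True
          have "Tot * (w x / Z) = exp (- 3 * ub) * exp (3 * u x)"
            using True Z by (simp add: Tot_def w_def \<Omega>_def)
          also have "\<dots> = exp (3 * (u x - ub))" by (simp add: exp_add[symmetric] right_diff_distrib)
          finally have "ennreal Tot * ennreal (w x / Z) = ennreal (exp (3 * (u x - ub)))"
            using Tot Z w0[of x] by (simp flip: ennreal_mult)
          then show ?thesis using True by (simp add: \<Omega>_def)
        qed (auto simp: \<Omega>_def w_def indicator_def)
      qed
      finally show ?thesis .
    qed
    have "\<delta> * Tot \<le> R"
      using order_trans[OF le2 le1] R0 by (simp add: ennreal_le_iff)
    then have "1 / (2 * pi\<^sup>2) * Tot \<le> R / (2 * pi\<^sup>2 * \<delta>)"
      using \<delta> by (simp add: field_simps)
    then have "ln (1 / (2 * pi\<^sup>2) * Tot) \<le> ln (R / (2 * pi\<^sup>2 * \<delta>))"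
      using Tot by (intro ln_mono) auto
    also have "R / (2 * pi\<^sup>2 * \<delta>) = K\<^sub>\<eta> / (2 * pi\<^sup>2 * \<delta>) * (exp ((1 + \<eta>)\<^sup>2 * \<kappa> * a\<^sup>2) * exp (3 * c * A))"
      by (simp add: R_def)
    also have "ln \<dots> = ln (K\<^sub>\<eta> / (2 * pi\<^sup>2 * \<delta>)) + ((1 + \<eta>)\<^sup>2 * \<kappa> * a\<^sup>2 + 3 * c * A)"
      using K\<eta> \<delta> by (subst ln_mult_pos) (auto simp flip: exp_add)
    \<comment> \<open>The budget of \<epsilon>: a quarter for the excess of
      \<open>(1 + \<eta>)^2\<close> over 1, a quarter for the term linear in \<open>A\<close>; the
      other half was spent on the choice of \<open>K\<close>.\<close>
    also have "\<dots> \<le> ln (K\<^sub>\<eta> / (2 * pi\<^sup>2 * \<delta>)) + ((\<kappa> / real k * E + \<epsilon> / 4 * E + 4) + (\<epsilon> / 4 * (E + 1) + 9 * c\<^sup>2 / \<epsilon>))"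
    proof (intro add_left_mono add_mono)
      have "(1 + \<eta>)\<^sup>2 = 1 + 2 * \<eta> + \<eta> * \<eta>" by (simp add: power2_eq_square algebra_simps)
      also have "\<dots> \<le> 1 + 3 * \<eta>" using \<eta> mult_left_le[of \<eta> \<eta>] by simp
      finally have sq: "(1 + \<eta>)\<^sup>2 \<le> 1 + 3 * \<eta>" .
      define q where "q = E / real k"
      have q: "0 \<le> q" "q \<le> E" using E0 divide_left_mono[of 1 "real k" E] by (auto simp: q_def k_def)
      have "(1 + \<eta>)\<^sup>2 * \<kappa> * (q + 1) \<le> (1 + 3 * \<eta>) * \<kappa> * (q + 1)"
        using sq \<kappa> q by (intro mult_right_mono) auto
      also have "\<dots> = \<kappa> * q + 3 * \<eta> * (\<kappa> * q) + (1 + 3 * \<eta>) * \<kappa>" by (simp add: algebra_simps)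
      also have "\<dots> \<le> \<kappa> * q + \<epsilon> / 4 * (1 * E) + 4 * 1"
        using \<eta> \<kappa> q \<epsilon> by (intro add_mono mult_mono order_refl) auto
      finally show "(1 + \<eta>)\<^sup>2 * \<kappa> * a\<^sup>2 \<le> \<kappa> / real k * E + \<epsilon> / 4 * E + 4" by (simp add: a2 q_def)
      have "0 \<le> (\<epsilon> / 2 * A - 3 * c)\<^sup>2 / \<epsilon>" using \<epsilon> by simp
      also have "\<dots> = \<epsilon> / 4 * A\<^sup>2 + 9 * c\<^sup>2 / \<epsilon> - 3 * c * A"
        using \<epsilon> by (simp add: power2_diff field_simps power2_eq_square)
      finally show "3 * c * A \<le> \<epsilon> / 4 * (E + 1) + 9 * c\<^sup>2 / \<epsilon>" by (simp add: A2)
    qed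
    also have "\<dots> = (\<kappa> / real k + \<epsilon> / 2) * E + C" by (simp add: C_def add_divide_distrib algebra_simps)
    also have "\<dots> \<le> (3 / (16 * pi\<^sup>2 * real (N_m m)) + \<epsilon>) * (E + 2 * sphere_integral (sph_grad_sq f)) + C"
    proof (intro add_right_mono mult_mono)
      have "\<kappa> / real k = 3 / (16 * pi\<^sup>2 * real (Suc K))" by (simp add: \<kappa>_def k_def)
      then show "\<kappa> / real k + \<epsilon> / 2 \<le> 3 / (16 * pi\<^sup>2 * real (N_m m)) + \<epsilon>" using K(2) by linarith
      show "E \<le> E + 2 * sphere_integral (sph_grad_sq f)"
        using sphere_integral_nonneg[of "sph_grad_sq f"] by (simp add: sph_grad_sq_def)
      show "0 \<le> 3 / (16 * pi\<^sup>2 * real (N_m m)) + \<epsilon>" using \<epsilon> by (simp add: add_nonneg_nonneg)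
    qed (rule E0)
    finally show "ln (1 / (2 * pi\<^sup>2) * sphere_integral
          (\<lambda>x. exp (3 * (f x - sphere_integral f / (2 * pi\<^sup>2)))))
      \<le> (3 / (16 * pi\<^sup>2 * real (N_m m)) + \<epsilon>) *
        (integral (ball 0 1) (\<lambda>x. (laplacian u x)\<^sup>2) + 2 * sphere_integral (sph_grad_sq f)) + C"
      unfolding TotI EI .
  qed
qed

end
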